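(* For every $\alpha\in(\alpha_{\min},\alpha_{\max})$, $$f(\alpha)=\dim_{\mathcal H} X_\alpha=\inf_{t\in\mathbb{R}}\left(\alpha t+\beta(t)\right).$$ In other words, $f$ is the Legendre transform of $\beta$. Furthermore, $f$ is differentiable with respect to $\alpha$ and concave (on $(\alpha_{\min},\alpha_{\max})$).
   Context: Let $m<n$ be positive integers and $D\subseteq\{0,\ldots,m-1\}\times\{0,\ldots,n-1\}$ a digit set having elements in more than one row and in more than one column (i.e. the first coordinates of elements of $D$ take at least two values, and the second coordinates take at least two values). For $(i,j)\in D$ define $T_{i,j}:\mathbb{R}^2\to\mathbb{R}^2$ by $T_{i,j}(x,y)=(n^{-1}x,m^{-1}y)+(j,i)$. Let $\Lambda$ be the unique non-empty compact set with $\bigcup_{(i,j)\in D}T_{i,j}(\Lambda)=\Lambda$. Put $\sigma=\frac{\log m}{\log n}$. Let $\underline p=(p_{ij})_{(i,j)\in D}$ be a probability vector with all $p_{ij}>0$, and let $q_i=\sum_{j:(i,j)\in D}p_{ij}$. Let $\mu$ be the unique Borel probability measure on $\mathbb{R}^2$ with $\mu(A)=\sum_{(i,j)\in D}p_{ij}\,\mu(T_{i,j}^{-1}A)$ for every Borel set $A\subseteq\mathbb{R}^2$. The local dimension of $\mu$ at $x$ is $d_\mu(x)=\lim_{r\to0}\frac{\log\mu(B(x,r))}{\log r}$, if this limit exists, and $X_\alpha=\{x\in\Lambda: d_\mu(x)=\alpha\}$ (the limit exists and equals $\alpha$). $\dim_{\mathcal H}$ denotes Hausdorff dimension and $f(\alpha)=\dim_{\mathcal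 H}X_\alpha$. For $t\in\mathbb{R}$ let $\gamma_i=\gamma_i(t)=\sum_{j:(i,j)\in D}p_{ij}^t$, and let $\beta(t)$ be the unique real solution of $$m^{-\beta(t)}\sum_{(i,j)\in D}p_{ij}^t\,q_i^{(1-\sigma)t}\,\gamma_i^{\sigma-1}=1 .$$ Finally, $$\alpha_{\min}=\min_{(i,j)\in D}\frac{-\sigma\log p_{ij}+(\sigma-1)\log q_i}{\log m},\qquad \alpha_{\max}=\max_{(i,j)\in D}\frac{-\sigma\log p_{ij}+(\sigma-1)\log q_i}{\log m}.$$ *)

theory Defs
  imports "HOL-Probability.Probability_Measure"
begin

(* The explicit cases give the conventions 0 powr 0 = 1 on non-empty sets and 0 on the
   empty set (the library has 0 powr 0 = 0), so that the 0-dimensional Hausdorff measure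
   is the counting measure. *)
definition diam_pow :: "real \<Rightarrow> 'a::metric_space set \<Rightarrow> ennreal" where
  "diam_pow s U =
     (if U = {} then 0 else if s = 0 then 1 else ennreal (diameter U powr s))"

(* Boundedness is required explicitly because the library's diameter is 0 on unbounded sets. *)
definition hausdorff_premeasure ::
    "real \<Rightarrow> real \<Rightarrow> 'a::metric_space set \<Rightarrow> ennreal" where
  "hausdorff_premeasure s \<delta> A =
     Inf {(\<Sum>k. diam_pow s (U k)) | U :: nat \<Rightarrow> 'a set.
            A \<subseteq> (\<Union>k. U k) \<and> (\<forall>k. bounded (U k) \<and> diameter (U k) \<le> \<delta>)}"

definition hausdorff_measure :: "real \<Rightarrow> 'a::metric_space set \<Rightarrow> ennreal" where
  "hausdorff_measure s A = (SUP \<delta>\<in>{0<..}. hausdorff_premeasure s \<delta> A)"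

definition hausdorff_dim :: "'a::metric_space set \<Rightarrow> ereal" where
  "hausdorff_dim A = Inf {ereal s | s. 0 \<le> s \<and> hausdorff_measure s A = 0}"

(* A digit (i, j) is (row, column); its row i translates the second coordinate. *)
definition carpet_map :: "nat \<Rightarrow> nat \<Rightarrow> nat \<times> nat \<Rightarrow> real \<times> real \<Rightarrow> real \<times> real" where
  "carpet_map m n = (\<lambda>(i, j) (x, y). (x / real n + real j, y / real m + real i))"

definition is_carpet ::
    "nat \<Rightarrow> nat \<Rightarrow> (nat \<times> nat) set \<Rightarrow> (real \<times> real) set \<Rightarrow> bool" where
  "is_carpet m n D \<Lambda> \<longleftrightarrow>
     compact \<Lambda> \<and> \<Lambda> \<noteq> {} \<and> (\<Union>d\<in>D. carpet_map m n d ` \<Lambda>) = \<Lambda>"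

definition is_self_affine_measure ::
    "nat \<Rightarrow> nat \<Rightarrow> (nat \<times> nat) set \<Rightarrow> (nat \<times> nat \<Rightarrow> real) \<Rightarrow> (real \<times> real) measure \<Rightarrow> bool" where
  "is_self_affine_measure m n D p \<mu> \<longleftrightarrow>
     prob_space \<mu> \<and> sets \<mu> = sets borel \<and>
     (\<forall>A\<in>sets borel. measure \<mu> A = (\<Sum>d\<in>D. p d * measure \<mu> (carpet_map m n d -` A)))"

definition sigma_exp :: "nat \<Rightarrow> nat \<Rightarrow> real" where
  "sigma_exp m n = ln (real m) / ln (real n)"

definition row_prob :: "(nat \<times> nat) set \<Rightarrow> (nat \<times> nat \<Rightarrow> real) \<Rightarrow> nat \<Rightarrow> real" where
  "row_prob D p i = (\<Sum>j | (i, j) \<in> D. p (i, j))"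

definition row_gamma :: "(nat \<times> nat) set \<Rightarrow> (nat \<times> nat \<Rightarrow> real) \<Rightarrow> real \<Rightarrow> nat \<Rightarrow> real" where
  "row_gamma D p t i = (\<Sum>j | (i, j) \<in> D. p (i, j) powr t)"

definition beta :: "nat \<Rightarrow> nat \<Rightarrow> (nat \<times> nat) set \<Rightarrow> (nat \<times> nat \<Rightarrow> real) \<Rightarrow> real \<Rightarrow> real" where
  "beta m n D p t =
     (THE b. real m powr (- b) *
        (\<Sum>(i, j)\<in>D. p (i, j) powr t * row_prob D p i powr ((1 - sigma_exp m n) * t)
            * row_gamma D p t i powr (sigma_exp m n - 1)) = 1)"

definition digit_exponent ::
    "nat \<Rightarrow> nat \<Rightarrow> (nat \<times> nat) set \<Rightarrow> (nat \<times> nat \<Rightarrow> real) \<Rightarrow> nat \<times> nat \<Rightarrow> real" where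
  "digit_exponent m n D p = (\<lambda>(i, j).
     (- sigma_exp m n * ln (p (i, j)) + (sigma_exp m n - 1) * ln (row_prob D p i)) / ln (real m))"

definition alpha_min :: "nat \<Rightarrow> nat \<Rightarrow> (nat \<times> nat) set \<Rightarrow> (nat \<times> nat \<Rightarrow> real) \<Rightarrow> real" where
  "alpha_min m n D p = Min (digit_exponent m n D p ` D)"

definition alpha_max :: "nat \<Rightarrow> nat \<Rightarrow> (nat \<times> nat) set \<Rightarrow> (nat \<times> nat \<Rightarrow> real) \<Rightarrow> real" where
  "alpha_max m n D p = Max (digit_exponent m n D p ` D)"

(* Meaningful for z in the support of \<mu>, where all balls have positive measure;
   elsewhere the library's ln 0 = 0 would intervene. *)
definition has_local_dim ::
    "'a::metric_space measure \<Rightarrow> 'a \<Rightarrow> real \<Rightarrow> bool" where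
  "has_local_dim \<mu> z \<alpha> \<longleftrightarrow>
     ((\<lambda>r. ln (measure \<mu> (cball z r)) / ln r) \<longlongrightarrow> \<alpha>) (at_right 0)"

definition level_set ::
    "'a::metric_space set \<Rightarrow> 'a measure \<Rightarrow> real \<Rightarrow> 'a set" where
  "level_set \<Lambda> \<mu> \<alpha> = {z \<in> \<Lambda>. has_local_dim \<mu> z \<alpha>}"

(* The dimension of a subset of the plane is finite, so real_of_ereal loses nothing there. *)
definition spectrum ::
    "(real \<times> real) set \<Rightarrow> (real \<times> real) measure \<Rightarrow> real \<Rightarrow> real" where
  "spectrum \<Lambda> \<mu> \<alpha> = real_of_ereal (hausdorff_dim (level_set \<Lambda> \<mu> \<alpha>))"

end

theory Submission
  imports Defs "HOL-Probability.Hoeffding"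
begin

text \<open>
  Write \<open>B\<^sub>k(\<omega>)\<close> for the approximate square of side about \<open>m\<^sup>-\<^sup>k\<close>, given by the first \<open>k\<close> row digits and the
  first \<open>\<lfloor>\<sigma>k\<rfloor>\<close> column digits. For fixed \<open>t\<close> the tilted weights
  \<open>P\<^sub>i\<^sub>j = m powr - \<beta>(t) p\<^sub>i\<^sub>j powr t q\<^sub>i powr (1 - \<sigma>)t \<gamma>\<^sub>i powr (\<sigma> - 1)\<close> define a second self-affine measure \<open>\<nu>\<close>, and
  \<open>ln \<nu>(B\<^sub>k) = t ln \<mu>(B\<^sub>k) - \<beta>(t) k ln m + \<sigma> S\<^sub>k - S\<^sub>\<lfloor>\<sigma>k\<rfloor>\<close>, where \<open>S\<close> is a Birkhoff sum of a bounded function of the row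
  digits.

  Upper bound: since the averages \<open>S\<^sub>k / k\<close> are bounded, \<open>\<sigma> S\<^sub>k - S\<^sub>\<lfloor>\<sigma>k\<rfloor>\<close> cannot stay below \<open>- \<delta>k\<close>, so a point of local
  dimension \<open>\<alpha>\<close> lies near squares with \<open>\<nu>(B\<^sub>k) \<ge> m powr - (\<alpha>t + \<beta>(t) + \<delta>)k\<close> at infinitely many levels, and there
  are few such squares. No separation is assumed, so for \<open>t > 0\<close> the mass of a ball may come from a
  neighbouring strip of rows instead of the one containing the point. While that happens the row digits of
  the point are constantly \<open>0\<close> or constantly \<open>m - 1\<close>; \<open>S\<close> is then affine, its average is dominated by the values at the
  two ends of the stretch, where the strip of the point is heavy, and the argument goes through.

  Lower bound: if \<open>\<beta>'(t) = - \<alpha>\<close>, then \<open>\<nu>\<close>-almost every point is coded by a sequence with digit frequencies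
  \<open>P\<close>. Such a sequence has only short runs of extreme digits, so small balls meet a single square of slightly larger
  scale; both \<open>\<mu>\<close> and \<open>\<nu>\<close> then have local dimensions there, namely \<open>\<alpha>\<close> and \<open>\<alpha>t + \<beta>(t)\<close>.

  Strict convexity of \<open>\<beta>\<close>, whose second derivative is a combination of variances, gives differentiability.
\<close>

section \<open>Hausdorff measure and local dimension\<close>

text \<open>The exponents in the tilted weights are dictated by the squares: a square of level k
  records full digits at its first \<sigma>k places and rows alone afterwards. Put r = ln \<gamma> -
  t ln q for a row. Up to the common factor m powr -\<beta>(t), the tilted weight is the t-th power
  of the original weight times exp ((\<sigma> - 1) r) at an early place and times exp (\<sigma> r)
  at a late one. As a proportion \<sigma> of the places is early, the corrections cancel when the
  rows have stable frequencies. In general an oscillation of their averages remains, which is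
  controlled at infinitely many levels but not at all of them; hence a covering of limsup type.

  Neighbouring squares share edges. Instead of identifying the measure of a square with its weight,
  two one-sided estimates are used: a set that contains a square has at least its weight, and a set
  has at most the total weight of the squares meeting it. The given measure is accessible only
  through its self-affinity, whereas \<nu> is constructed as the image of a Bernoulli
  measure.\<close>

lemma hausdorff_dim_le:
  assumes "0 \<le> a" "\<And>s. a < s \<Longrightarrow> hausdorff_measure s A = 0"
  shows "hausdorff_dim A \<le> ereal a"
proof (rule ereal_le_epsilon2)
  fix e :: real assume "0 < e"
  then show "hausdorff_dim A \<le> ereal a + ereal e"
    unfolding hausdorff_dim_def by (intro Inf_lower) (use assms in auto)
qed

lemma hausdorff_dim_ge:
  assumes "\<And>s. 0 \<le> s \<Longrightarrow> s < a \<Longrightarrow> hausdorff_measure s A \<noteq> 0"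
  shows "ereal a \<le> hausdorff_dim A"
  unfolding hausdorff_dim_def by (intro Inf_greatest) (use assms in force)

lemma hausdorff_premeasure_le:
  assumes "A \<subseteq> (\<Union>k. U k)" "\<And>k. bounded (U k)" "\<And>k. diameter (U k) \<le> \<delta>"
  shows "hausdorff_premeasure s \<delta> A \<le> (\<Sum>k. diam_pow s (U k))"
  unfolding hausdorff_premeasure_def by (intro Inf_lower) (use assms in blast)

text \<open>Borel-Cantelli for covers: the families from level \<open>K\<close> on still cover
  \<open>A\<close>, and the \<open>s\<close>-th powers of their diameters are dominated by a
  geometric series of ratio \<open>b * r powr s\<close>, whose tail vanishes as \<open>K\<close>
  grows.\<close>

lemma hausdorff_measure_limsup_eq_0:
  fixes V :: "nat \<Rightarrow> 'c \<Rightarrow> 'a::metric_space set"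
  assumes s: "0 < s" and r: "0 < r" "r < 1" and b: "0 < b" "b * r powr s < 1" and C: "0 < C"
    and fin: "\<And>k. finite (G k)" and card: "\<And>k. real (card (G k)) \<le> b ^ k"
    and bdd: "\<And>k c. c \<in> G k \<Longrightarrow> bounded (V k c)"
    and diam: "\<And>k c. c \<in> G k \<Longrightarrow> diameter (V k c) \<le> C * r ^ k"
    and cov: "\<And>x K. x \<in> A \<Longrightarrow> \<exists>k\<ge>K. \<exists>c\<in>G k. x \<in> V k c"
  shows "hausdorff_measure s A = 0"
proof -
  define \<rho> where "\<rho> = b * r powr s"
  have \<rho>: "0 < \<rho>" "\<rho> < 1" using b r by (auto simp: \<rho>_def)
  have "hausdorff_premeasure s \<delta> A = 0" if \<delta>: "0 < \<delta>" for \<delta>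
  proof -
    have "hausdorff_premeasure s \<delta> A \<le> ennreal \<epsilon>" if \<epsilon>: "0 < \<epsilon>" for \<epsilon>
    proof -
      have "(\<lambda>K. C * r ^ K) \<longlonglongrightarrow> C * 0"
        using r by (intro tendsto_intros LIMSEQ_power_zero) auto
      then have 1: "\<forall>\<^sub>F K in sequentially. C * r ^ K < \<delta>"
        using \<delta> by (intro order_tendstoD) auto
      have "(\<lambda>K. C powr s * (\<rho> ^ K * (1 / (1 - \<rho>)))) \<longlonglongrightarrow> C powr s * (0 * (1 / (1 - \<rho>)))"
        using \<rho> by (intro tendsto_intros LIMSEQ_power_zero) auto
      then have 2: "\<forall>\<^sub>F K in sequentially. C powr s * (\<rho> ^ K * (1 / (1 - \<rho>))) < \<epsilon>"
        using \<epsilon> by (intro order_tendstoD) auto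
      from eventually_conj[OF 1 2] obtain K where K: "C * r ^ K < \<delta>" "C powr s * (\<rho> ^ K * (1 / (1 - \<rho>))) < \<epsilon>"
        by (auto dest: eventually_happens)
      obtain e where e: "\<And>k. bij_betw (e k) {0..<card (G k)} (G k)"
        using ex_bij_betw_nat_finite[OF fin] by metis
      have eG: "e k i \<in> G k" if "i < card (G k)" for k i
        using e[of k] that by (auto simp: bij_betw_def)
      \<comment> \<open>Empty sets pad the finite families to one sequence; they are free because
        \<open>diam_pow\<close> of the empty set is 0.\<close>
      define W where "W k i = (if K \<le> k \<and> i < card (G k) then V k (e k i) else {})" for k i
      define U where "U N = (case prod_decode N of (k, i) \<Rightarrow> W k i)" for N
      have dW: "diameter (W k i) \<le> C * r ^ k" for k i
        using diam[OF eG] C r by (auto simp: W_def)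
      have "A \<subseteq> (\<Union>N. U N)"
      proof
        fix x assume "x \<in> A"
        then obtain k c where kc: "K \<le> k" "c \<in> G k" "x \<in> V k c" using cov by blast
        then obtain i where "i < card (G k)" "c = e k i"
          using e[of k] unfolding bij_betw_def by (metis atLeastLessThan_iff imageE)
        with kc have "x \<in> U (prod_encode (k, i))" by (simp add: U_def W_def)
        then show "x \<in> (\<Union>N. U N)" by blast
      qed
      moreover have "bounded (U N)" for N
        using bdd[OF eG] by (auto simp: U_def W_def split: prod.split)
      moreover have "diameter (U N) \<le> \<delta>" for N
      proof -
        obtain k i where N: "prod_decode N = (k, i)" by force
        show ?thesis
        proof (cases "K \<le> k")
          case True
          then have "C * r ^ k \<le> C * r ^ K" using C r by (simp add: power_decreasing)
          then show ?thesis using dW[of k i] K N by (simp add: U_def)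
        qed (use \<delta> in \<open>simp add: U_def N W_def\<close>)
      qed
      ultimately have "hausdorff_premeasure s \<delta> A \<le> (\<Sum>N. diam_pow s (U N))"
        by (rule hausdorff_premeasure_le)
      also have "\<dots> = (\<Sum>k. \<Sum>i. diam_pow s (W k i))"
        using suminf_ennreal_2dimen[of "\<lambda>k. \<Sum>i. diam_pow s (W k i)" "\<lambda>(k, i). diam_pow s (W k i)"]
        by (simp add: U_def split_def)
      also have "\<dots> \<le> (\<Sum>k. ennreal (if K \<le> k then C powr s * \<rho> ^ k else 0))"
      proof (intro suminf_le summableI)
        fix k
        have "(\<Sum>i. diam_pow s (W k i)) = (\<Sum>i<card (G k). diam_pow s (W k i))"
          by (intro suminf_finite) (auto simp: W_def diam_pow_def)
        also have "\<dots> \<le> ennreal (if K \<le> k then C powr s * \<rho> ^ k else 0)"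
        proof (cases "K \<le> k")
          case True
          have "(\<Sum>i<card (G k). diam_pow s (W k i)) \<le> (\<Sum>i<card (G k). ennreal ((C * r ^ k) powr s))"
          proof (intro sum_mono)
            fix i assume "i \<in> {..<card (G k)}"
            then have "bounded (W k i)" using bdd[OF eG] by (simp add: W_def)
            then have "diameter (W k i) powr s \<le> (C * r ^ k) powr s"
              using dW s by (intro powr_mono2 diameter_ge_0) auto
            then show "diam_pow s (W k i) \<le> ennreal ((C * r ^ k) powr s)"
              using s by (auto simp: diam_pow_def intro: ennreal_leI)
          qed
          also have "\<dots> = ennreal (card (G k) * (C * r ^ k) powr s)"
            by (simp add: ennreal_mult ennreal_of_nat_eq_real_of_nat)
          also have "\<dots> \<le> ennreal (b ^ k * (C * r ^ k) powr s)"
            using card by (intro ennreal_leI mult_right_mono) auto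
          also have "b ^ k * (C * r ^ k) powr s = C powr s * \<rho> ^ k"
            using C r by (simp add: \<rho>_def powr_mult power_mult_distrib powr_power powr_powr powr_realpow[symmetric] mult_ac)
          finally show ?thesis using True by simp
        qed (simp add: W_def diam_pow_def)
        finally show "(\<Sum>i. diam_pow s (W k i)) \<le> ennreal (if K \<le> k then C powr s * \<rho> ^ k else 0)" .
      qed
      also have "\<dots> = ennreal (C powr s * (\<rho> ^ K * (1 / (1 - \<rho>))))"
      proof (rule suminf_ennreal_eq)
        have "(\<lambda>k. C powr s * (\<rho> ^ K * \<rho> ^ k)) sums (C powr s * (\<rho> ^ K * (1 / (1 - \<rho>))))"
          using \<rho> by (intro sums_mult geometric_sums) auto
        then have "(\<lambda>k. if K \<le> k + K then C powr s * \<rho> ^ (k + K) else 0) sums (C powr s * (\<rho> ^ K * (1 / (1 - \<rho>))))"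
          by (simp add: power_add mult_ac)
        then show "(\<lambda>k. if K \<le> k then C powr s * \<rho> ^ k else 0) sums (C powr s * (\<rho> ^ K * (1 / (1 - \<rho>))))"
          by (subst (asm) sums_iff_shift) simp
      qed (use \<rho> in auto)
      also have "\<dots> \<le> ennreal \<epsilon>" using K by (intro ennreal_leI) auto
      finally show ?thesis .
    qed
    then have "hausdorff_premeasure s \<delta> A \<le> 0"
      using ennreal_le_epsilon[of 0 "hausdorff_premeasure s \<delta> A"] by simp
    then show ?thesis by simp
  qed
  then show ?thesis unfolding hausdorff_measure_def by simp
qed

text \<open>Mass distribution principle. The radius below which the ball estimate holds depends on
  the point, so \<open>A\<close> is split into sets \<open>B K\<close> with a uniform radius. These
  may fail to be measurable, hence the measurable covers of arbitrarily small measure.\<close>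

lemma AE_not_in_hausdorff_null:
  fixes \<nu> :: "'a::metric_space measure"
  assumes \<nu>: "prob_space \<nu>" "sets \<nu> = sets borel" and s: "0 \<le> s"
    and null: "hausdorff_measure s A = 0"
    and ball: "\<And>x. x \<in> A \<Longrightarrow> \<exists>r0>0. \<forall>r. 0 < r \<and> r < r0 \<longrightarrow> measure \<nu> (cball x r) \<le> r powr s"
  shows "AE x in \<nu>. x \<notin> A"
proof -
  interpret prob_space \<nu> by fact
  define B where "B K = {x \<in> A. \<forall>r. 0 < r \<and> r < 1 / real (Suc K) \<longrightarrow> measure \<nu> (cball x r) \<le> r powr s}" for K
  have A: "A \<subseteq> (\<Union>K. B K)"
  proof
    fix x assume x: "x \<in> A"
    then obtain r0 where r0: "0 < r0" "\<forall>r. 0 < r \<and> r < r0 \<longrightarrow> measure \<nu> (cball x r) \<le> r powr s"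
      using ball by blast
    obtain K where "inverse (real (Suc K)) < r0" using reals_Archimedean[OF r0(1)] by blast
    then have "x \<in> B K" using x r0 by (auto simp: B_def inverse_eq_divide)
    then show "x \<in> (\<Union>K. B K)" by blast
  qed
  have "AE x in \<nu>. x \<notin> B K" for K
  proof -
    have cov: "\<exists>N\<in>sets \<nu>. B K \<subseteq> N \<and> emeasure \<nu> N \<le> ennreal \<epsilon>" if \<epsilon>: "0 < \<epsilon>" for \<epsilon>
    proof -
      \<comment> \<open>Strictly below the uniform radius, so that the ball estimate applies to
        every positive covering diameter.\<close>
      define \<delta> where "\<delta> = 1 / real (Suc K) / 2"
      have \<delta>: "0 < \<delta>" "\<delta> < 1 / real (Suc K)" by (auto simp: \<delta>_def field_simps)
      have "hausdorff_premeasure s \<delta> A \<le> hausdorff_measure s A"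
        unfolding hausdorff_measure_def using \<delta> by (intro SUP_upper) auto
      then have "hausdorff_premeasure s \<delta> A < ennreal \<epsilon>" using null \<epsilon> by simp
      then obtain U where U: "A \<subseteq> (\<Union>k. U k)" "\<And>k. bounded (U k)" "\<And>k. diameter (U k) \<le> \<delta>"
        "(\<Sum>k. diam_pow s (U k)) < ennreal \<epsilon>"
        unfolding hausdorff_premeasure_def Inf_less_iff by auto
      \<comment> \<open>The estimate is known only for balls centred in \<open>B K\<close>, so each
        covering set that meets \<open>B K\<close> is replaced by a ball around one of its points
        there.\<close>
      define c where "c k = (SOME x. x \<in> U k \<inter> B K)" for k
      define W where "W k = (if U k \<inter> B K = {} then {} else cball (c k) (diameter (U k)))" for k
      have c: "c k \<in> U k \<inter> B K" if "U k \<inter> B K \<noteq> {}" for k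
        unfolding c_def using that by (metis ex_in_conv someI_ex)
      have W: "U k \<inter> B K \<subseteq> W k" for k
      proof
        fix x assume x: "x \<in> U k \<inter> B K"
        then have "c k \<in> U k" using c by blast
        then have "dist (c k) x \<le> diameter (U k)"
          using x diameter_bounded_bound[OF U(2)] by blast
        then show "x \<in> W k" using x by (auto simp: W_def)
      qed
      have [measurable]: "W k \<in> sets \<nu>" for k by (auto simp: W_def \<nu>(2))
      have le: "emeasure \<nu> (W k) \<le> diam_pow s (U k)" for k
      proof (cases "U k \<inter> B K = {}")
        case False
        let ?d = "diameter (U k)"
        have ck: "c k \<in> B K" "U k \<noteq> {}" using c[OF False] by auto
        then have m: "measure \<nu> (cball (c k) r) \<le> r powr s" if "0 < r" "r < 1 / real (Suc K)" for r
          using that by (auto simp: B_def)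
        have "measure \<nu> (cball (c k) ?d) \<le> ?d powr s" if s0: "s \<noteq> 0"
        proof (cases "?d = 0")
          case True
          \<comment> \<open>The ball estimate says nothing about radius 0, but letting the radius
            shrink excludes an atom.\<close>
          have "measure \<nu> (cball (c k) 0) \<le> 0"
          proof (rule field_le_epsilon)
            fix e :: real assume e: "0 < e"
            define r where "r = min \<delta> (e powr (1 / s))"
            have r: "0 < r" "r < 1 / real (Suc K)" "r \<le> e powr (1 / s)" using \<delta> e by (auto simp: r_def)
            have "measure \<nu> (cball (c k) 0) \<le> measure \<nu> (cball (c k) r)"
              using r by (intro finite_measure_mono subset_cball) (auto simp: \<nu>(2))
            also have "\<dots> \<le> r powr s" using m r by auto
            also have "\<dots> \<le> (e powr (1 / s)) powr s" using r s by (intro powr_mono2) auto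
            also have "\<dots> = e" using e s0 by (simp add: powr_powr)
            finally show "measure \<nu> (cball (c k) 0) \<le> 0 + e" by simp
          qed
          then show ?thesis using True by simp
        next
          case False
          then have "0 < ?d" using diameter_ge_0[OF U(2)[of k]] by simp
          moreover have "?d < 1 / real (Suc K)" using U(3)[of k] \<delta> by simp
          ultimately show ?thesis by (rule m)
        qed
        then show ?thesis
          using False ck by (auto simp: W_def diam_pow_def emeasure_eq_measure intro: ennreal_leI)
      qed (simp add: W_def)
      have "emeasure \<nu> (\<Union>k. W k) \<le> (\<Sum>k. emeasure \<nu> (W k))"
        by (intro emeasure_subadditive_countably) auto
      also have "\<dots> \<le> (\<Sum>k. diam_pow s (U k))" by (intro suminf_le le summableI)
      also have "\<dots> \<le> ennreal \<epsilon>" using U(4) by simp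
      finally have "emeasure \<nu> (\<Union>k. W k) \<le> ennreal \<epsilon>" .
      moreover have "B K \<subseteq> (\<Union>k. W k)"
      proof
        fix x assume x: "x \<in> B K"
        then have "x \<in> A" by (simp add: B_def)
        then obtain k where "x \<in> U k" using U(1) by blast
        then show "x \<in> (\<Union>k. W k)" using W[of k] x by blast
      qed
      ultimately show ?thesis by (intro bexI[of _ "\<Union>k. W k"]) auto
    qed
    obtain N where N: "\<And>i. N i \<in> sets \<nu>" "\<And>i. B K \<subseteq> N i" "\<And>i. emeasure \<nu> (N i) \<le> ennreal (1 / real (Suc i))"
      using cov[of "1 / real (Suc _)"] by (metis of_nat_0_less_iff zero_less_Suc zero_less_divide_1_iff)
    show ?thesis
    proof (rule AE_I')
      have "emeasure \<nu> (\<Inter>i. N i) \<le> 0"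
      proof (rule ennreal_le_epsilon)
        fix e :: real assume "0 < e"
        then obtain i where i: "inverse (real (Suc i)) < e" using reals_Archimedean by blast
        have "emeasure \<nu> (\<Inter>i. N i) \<le> emeasure \<nu> (N i)" by (intro emeasure_mono N) auto
        also have "\<dots> \<le> ennreal (1 / real (Suc i))" by (rule N)
        also have "\<dots> \<le> 0 + ennreal e" using i by (auto simp: inverse_eq_divide intro: ennreal_leI)
        finally show "emeasure \<nu> (\<Inter>i. N i) \<le> 0 + ennreal e" .
      qed
      then show "(\<Inter>i. N i) \<in> null_sets \<nu>" using N(1) by (auto simp: null_sets_def)
    qed (use N(2) in auto)
  qed
  then have "AE x in \<nu>. \<forall>K. x \<notin> B K" by (simp add: AE_all_countable)
  then show ?thesis by eventually_elim (use A in auto)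
qed

lemma has_local_dim_imp_ball_le:
  assumes "has_local_dim \<nu> x a" "s < a"
  shows "\<exists>r0>0. \<forall>r. 0 < r \<and> r < r0 \<longrightarrow> measure \<nu> (cball x r) \<le> r powr s"
proof -
  have "\<forall>\<^sub>F r in at_right 0. s < ln (measure \<nu> (cball x r)) / ln r"
    using assms unfolding has_local_dim_def by (rule order_tendstoD)
  then obtain b where b: "0 < b" "\<And>r. 0 < r \<Longrightarrow> r < b \<Longrightarrow> s < ln (measure \<nu> (cball x r)) / ln r"
    unfolding eventually_at_right_field by auto
  have "measure \<nu> (cball x r) \<le> r powr s" if r: "0 < r" "r < min b 1" for r
  proof (cases "measure \<nu> (cball x r) = 0")
    case False
    then have pos: "0 < measure \<nu> (cball x r)" using measure_nonneg[of \<nu> "cball x r"] by linarith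
    have "ln r < 0" using r by simp
    then have "ln (measure \<nu> (cball x r)) < s * ln r"
      using b(2)[of r] r by (simp add: neg_less_divide_eq)
    then have "exp (ln (measure \<nu> (cball x r))) \<le> exp (s * ln r)" by simp
    then show ?thesis using pos r by (simp add: powr_def)
  qed simp
  then show ?thesis using b(1) by (intro exI[of _ "min b 1"]) auto
qed

text \<open>Along geometric radii ln r equals -k ln b up to a bounded term, so the factor
  \<open>c\<close> is invisible in the exponents.\<close>

lemma has_local_dim_scales:
  assumes "has_local_dim \<nu> x a" and b: "1 < b" and c: "0 < c" and \<epsilon>: "0 < \<epsilon>"
    and pos: "\<And>r. 0 < r \<Longrightarrow> 0 < measure \<nu> (cball x r)"
  shows "\<forall>\<^sub>F k in sequentially. b powr (- (a + \<epsilon>) * real k) \<le> measure \<nu> (cball x (c / b ^ k))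
           \<and> measure \<nu> (cball x (c / b ^ k)) \<le> b powr (- (a - \<epsilon>) * real k)"
proof -
  let ?r = "\<lambda>k. c / b ^ k" and ?\<mu> = "\<lambda>k. measure \<nu> (cball x (c / b ^ k))"
  have r0: "?r \<longlonglongrightarrow> 0"
    using b by (simp add: LIMSEQ_divide_realpow_zero)
  have "filterlim ?r (at_right 0) sequentially"
    using r0 b c by (auto simp: filterlim_at intro!: always_eventually)
  then have 1: "(\<lambda>k. ln (?\<mu> k) / ln (?r k)) \<longlonglongrightarrow> a"
    using assms(1) unfolding has_local_dim_def by (rule filterlim_compose[rotated])
  have "(\<lambda>k. (ln c / ln b) / real k - 1) \<longlonglongrightarrow> 0 - 1"
    by (intro tendsto_intros lim_const_over_n)
  then have "(\<lambda>k. (ln c / ln b) / real k - 1) \<longlonglongrightarrow> - 1" by simp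
  then have 2: "(\<lambda>k. ln (?r k) / (real k * ln b)) \<longlonglongrightarrow> -1"
  proof (rule Lim_transform_eventually)
    show "\<forall>\<^sub>F k in sequentially. ln c / ln b / real k - 1 = ln (?r k) / (real k * ln b)"
      using eventually_gt_at_top[of 0] 
      by eventually_elim (use b c in \<open>simp add: ln_div ln_realpow field_simps\<close>)
  qed
  have "(\<lambda>k. ln (?\<mu> k) / ln (?r k) * (ln (?r k) / (real k * ln b))) \<longlonglongrightarrow> a * (-1)"
    by (intro tendsto_mult 1 2)
  then have "\<forall>\<^sub>F k in sequentially. dist (ln (?\<mu> k) / ln (?r k) * (ln (?r k) / (real k * ln b))) (a * (-1)) < \<epsilon>"
    using \<epsilon> by (rule tendstoD)
  moreover have "\<forall>\<^sub>F k in sequentially. ?r k < 1" using r0 by (rule order_tendstoD) simp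
  ultimately show ?thesis
    using eventually_gt_at_top[of 0]
  proof eventually_elim
    case (elim k)
    have "ln (?r k) \<noteq> 0" using elim b c by (simp del: ln_div) 
    then have "\<bar>ln (?\<mu> k) / (real k * ln b) + a\<bar> < \<epsilon>"
      using elim by (simp add: dist_real_def)
    then have "-(a + \<epsilon>) < ln (?\<mu> k) / (real k * ln b)" "ln (?\<mu> k) / (real k * ln b) < - (a - \<epsilon>)"
      unfolding abs_less_iff by auto
    then have "-(a + \<epsilon>) * (real k * ln b) \<le> ln (?\<mu> k)" "ln (?\<mu> k) \<le> - (a - \<epsilon>) * (real k * ln b)"
      using elim b by (auto simp: pos_less_divide_eq pos_divide_less_eq simp del: minus_add_distrib minus_diff_eq)
    then have "exp (-(a + \<epsilon>) * (real k * ln b)) \<le> exp (ln (?\<mu> k))" "exp (ln (?\<mu> k)) \<le> exp (- (a - \<epsilon>) * (real k * ln b))"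
      by simp_all
    then show ?case using b pos[of "?r k"] c by (simp add: powr_def mult_ac)
  qed
qed

text \<open>Monotonicity in the radius fills in between the geometric scales, at a bounded cost in
  ln r. The constant \<open>C\<close> stands on one side only: lower bounds will come from balls
  that contain a whole square, upper bounds from balls that meet only few squares.\<close>

lemma has_local_dimI_scales:
  assumes \<nu>: "prob_space \<nu>" "sets \<nu> = sets borel" and a: "0 \<le> a" and b: "1 < b" and C: "1 \<le> C"
    and lo: "\<And>\<epsilon>. 0 < \<epsilon> \<Longrightarrow> \<forall>\<^sub>F k in sequentially. b powr (- (a + \<epsilon>) * real k) \<le> measure \<nu> (cball x (C / b ^ k))"
    and hi: "\<And>\<epsilon>. 0 < \<epsilon> \<Longrightarrow> \<forall>\<^sub>F k in sequentially. measure \<nu> (cball x (1 / b ^ k)) \<le> b powr (- (a - \<epsilon>) * real k)"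
  shows "has_local_dim \<nu> x a"
  unfolding has_local_dim_def
proof (rule tendstoI)
  fix e :: real assume e: "0 < e"
  interpret prob_space \<nu> by fact
  define \<epsilon> where "\<epsilon> = e / 3"
  have \<epsilon>: "0 < \<epsilon>" using e by (simp add: \<epsilon>_def)
  define L where "L = ln b"
  have L: "0 < L" using b by (simp add: L_def)
  have lnC: "0 \<le> ln C" using C by simp
  from lo[OF \<epsilon>] hi[OF \<epsilon>] obtain K1 K2 where
    K1: "\<And>k. K1 \<le> k \<Longrightarrow> b powr (- (a + \<epsilon>) * real k) \<le> measure \<nu> (cball x (C / b ^ k))"
    and K2: "\<And>k. K2 \<le> k \<Longrightarrow> measure \<nu> (cball x (1 / b ^ k)) \<le> b powr (- (a - \<epsilon>) * real k)"
    unfolding eventually_sequentially by blast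
  \<comment> \<open>In terms of T = - ln r: the first two entries push the levels chosen below past
    \<open>K1\<close> and \<open>K2\<close>, the last one makes the rounding cost (a +
    \<epsilon>)(ln C + ln b) smaller than \<epsilon>T.\<close>
  define T0 where "T0 = max (max (real K1 * L) ((real K2 + 1) * L)) (max 1 ((a + \<epsilon>) * (ln C + L) / \<epsilon>))"
  have main: "dist (ln (measure \<nu> (cball x r)) / ln r) a < e" if r: "0 < r" "r < exp (- T0)" for r
  proof -
    define T where "T = - ln r"
    have "ln r < - T0" using r by (metis ln_exp ln_less_cancel_iff exp_gt_zero)
    then have T: "T0 < T" by (simp add: T_def)
    have T': "0 < T" "real K1 * L < T" "(real K2 + 1) * L < T" "(a + \<epsilon>) * (ln C + L) < \<epsilon> * T"
      using T \<epsilon> by (auto simp: T0_def pos_divide_less_eq mult.commute)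
    have bexp: "b ^ k = exp (real k * L)" for k
      using b by (simp add: L_def exp_of_nat_mult)
    have rexp: "r = exp (- T)" using r by (simp add: T_def)
    have powr: "b powr y = exp (y * L)" for y using b by (simp add: powr_def L_def)
    let ?M = "measure \<nu> (cball x r)"
    \<comment> \<open>The first level whose ball of radius \<open>C / b ^ k\<close> fits inside
      \<open>cball x r\<close>.\<close>
    define k where "k = nat \<lceil>(T + ln C) / L\<rceil>"
    have k: "(T + ln C) / L \<le> real k" "real k \<le> (T + ln C) / L + 1"
      using T' L lnC by (auto simp: k_def)
    have "C / b ^ k = exp (ln C - real k * L)" using C by (simp add: bexp exp_diff)
    also have "\<dots> \<le> r" using k(1) L by (simp add: rexp pos_divide_le_eq)
    finally have "cball x (C / b ^ k) \<subseteq> cball x r" by (rule subset_cball)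
    then have "measure \<nu> (cball x (C / b ^ k)) \<le> ?M"
      by (intro finite_measure_mono) (auto simp: \<nu>(2))
    moreover have "K1 \<le> k"
    proof -
      have "real K1 \<le> T / L" using T' L by (simp add: pos_le_divide_eq)
      also have "\<dots> \<le> (T + ln C) / L" using lnC L by (intro divide_right_mono) auto
      finally show ?thesis using k(1) by linarith
    qed
    ultimately have M1: "exp (- (a + \<epsilon>) * real k * L) \<le> ?M"
      using K1[of k] by (simp add: powr)
    then have Mpos: "0 < ?M" by (rule less_le_trans[rotated]) simp
    have "real k * L \<le> T + ln C + L"
      using k(2) L by (simp add: field_simps)
    then have "(a + \<epsilon>) * (real k * L) \<le> (a + \<epsilon>) * (T + ln C + L)"
      using a \<epsilon> by (intro mult_left_mono) auto
    moreover have "- (a + \<epsilon>) * real k * L \<le> ln ?M"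
      using M1 Mpos by (subst ln_ge_iff) auto
    ultimately have A: "- ln ?M \<le> (a + 2 * \<epsilon>) * T"
      using T'(4) by (simp add: algebra_simps)
    \<comment> \<open>The last level whose ball of radius \<open>1 / b ^ l\<close> still contains
      \<open>cball x r\<close>.\<close>
    define l where "l = nat \<lfloor>T / L\<rfloor>"
    have l: "real l \<le> T / L" "T / L - 1 \<le> real l"
      using T' L by (auto simp: l_def) 
    have "r \<le> 1 / b ^ l" using l(1) L by (simp add: rexp bexp exp_minus divide_inverse[symmetric] pos_le_divide_eq field_simps)
    then have "?M \<le> measure \<nu> (cball x (1 / b ^ l))"
      by (intro finite_measure_mono subset_cball) (auto simp: \<nu>(2))
    also have "\<dots> \<le> exp (- (a - \<epsilon>) * real l * L)"
    proof -
      have "real K2 + 1 < T / L" using T' L by (simp add: pos_less_divide_eq)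
      then have "K2 \<le> l" using l(2) by linarith
      then show ?thesis using K2[of l] by (simp add: powr)
    qed
    finally have "ln ?M \<le> - (a - \<epsilon>) * real l * L"
      using Mpos by (metis ln_exp ln_le_cancel_iff exp_gt_zero)
    moreover have "real l * L \<le> T" "T - L \<le> real l * L"
      using l L by (auto simp: field_simps)
    then have "a * (T - L) \<le> a * (real l * L)" "\<epsilon> * (real l * L) \<le> \<epsilon> * T"
      using a \<epsilon> by (auto intro: mult_left_mono)
    moreover have "a * L \<le> (a + \<epsilon>) * (ln C + L)"
      using a \<epsilon> L lnC by (intro mult_mono) auto
    ultimately have B: "(a - 2 * \<epsilon>) * T \<le> - ln ?M"
      using T'(4) by (simp add: algebra_simps)
    have eq: "ln ?M / ln r = - ln ?M / T" by (simp add: T_def)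
    have "- ln ?M / T \<le> a + 2 * \<epsilon>" "a - 2 * \<epsilon> \<le> - ln ?M / T"
      using A B T'(1) by (simp_all only: pos_divide_le_eq pos_le_divide_eq)
    then show ?thesis unfolding eq dist_real_def using \<epsilon> by (simp add: \<epsilon>_def)
  qed
  show "\<forall>\<^sub>F r in at_right 0. dist (ln (measure \<nu> (cball x r)) / ln r) a < e"
    unfolding eventually_at_right_field using main by (intro exI[of _ "exp (- T0)"]) auto
qed

lemma hausdorff_measure_mono:
  assumes "A \<subseteq> B"
  shows "hausdorff_measure s A \<le> hausdorff_measure s B"
  unfolding hausdorff_measure_def hausdorff_premeasure_def
  using assms by (intro SUP_mono bexI Inf_superset_mono) blast+

section \<open>The pressure function and its Legendre transform\<close>

lemma DERIV_ln_sum_exp: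
  fixes h h' :: "'i \<Rightarrow> real \<Rightarrow> real"
  assumes "finite I" "I \<noteq> {}" "\<And>i. i \<in> I \<Longrightarrow> (h i has_real_derivative h' i t) (at t)"
  shows "((\<lambda>t. ln (\<Sum>i\<in>I. exp (h i t))) has_real_derivative
           (\<Sum>i\<in>I. exp (h i t) * h' i t) / (\<Sum>i\<in>I. exp (h i t))) (at t)"
proof -
  have "0 < (\<Sum>i\<in>I. exp (h i t))"
    using assms by (intro sum_pos) auto
  then show ?thesis
    using assms(3) by (auto intro!: derivative_eq_intros sum.cong simp: mult.commute)
qed

text \<open>The derivative is the Gibbs average of \<open>h''\<close> plus the Gibbs variance of
  \<open>h'\<close>, a form in which positivity and the case of equality can be read off.\<close>

lemma DERIV_ln_sum_exp2:
  fixes h h' h'' :: "'i \<Rightarrow> real \<Rightarrow> real"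
  assumes "finite I" "I \<noteq> {}"
    and "\<And>i. i \<in> I \<Longrightarrow> (h i has_real_derivative h' i t) (at t)"
    and "\<And>i. i \<in> I \<Longrightarrow> (h' i has_real_derivative h'' i t) (at t)"
  defines "G \<equiv> \<lambda>t. \<Sum>i\<in>I. exp (h i t)"
  defines "L \<equiv> \<lambda>t. (\<Sum>i\<in>I. exp (h i t) * h' i t) / G t"
  shows "(L has_real_derivative (\<Sum>i\<in>I. exp (h i t) * (h'' i t + (h' i t - L t)\<^sup>2)) / G t) (at t)"
proof -
  have G: "0 < G t" unfolding G_def
    using assms by (intro sum_pos) auto
  have dG: "(G has_real_derivative L t * G t) (at t)"
    using assms(3) G unfolding G_def L_def
    by (auto intro!: derivative_eq_intros sum.cong simp: mult.commute)
  have dN: "((\<lambda>t. \<Sum>i\<in>I. exp (h i t) * h' i t) has_real_derivative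
      (\<Sum>i\<in>I. exp (h i t) * (h'' i t + (h' i t)\<^sup>2))) (at t)"
    using assms(3,4)
    by (auto intro!: derivative_eq_intros sum.cong simp: algebra_simps power2_eq_square)
  have N: "(\<Sum>i\<in>I. exp (h i t) * h' i t) = L t * G t"
    using G by (simp add: L_def)
  have "(L has_real_derivative
     ((\<Sum>i\<in>I. exp (h i t) * (h'' i t + (h' i t)\<^sup>2)) * G t - (L t * G t) * (L t * G t)) / (G t * G t)) (at t)"
    using DERIV_divide[OF dN dG] G N unfolding L_def[symmetric] by simp
  moreover have eq: "(\<Sum>i\<in>I. exp (h i t) * (h'' i t + (h' i t - L t)\<^sup>2)) =
     (\<Sum>i\<in>I. exp (h i t) * (h'' i t + (h' i t)\<^sup>2)) - 2 * L t * (\<Sum>i\<in>I. exp (h i t) * h' i t) + (L t)\<^sup>2 * G t"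
    unfolding G_def by (simp add: sum_distrib_left sum.distrib[symmetric] sum_subtractf[symmetric] power2_eq_square algebra_simps)
  moreover have "(A * g - (l * g) * (l * g)) / (g * g) = (A - 2 * l * (l * g) + l\<^sup>2 * g) / g" if "0 < g" for A g l :: real
    using that by (simp add: field_simps power2_eq_square)
  ultimately show ?thesis
    using G unfolding eq N by simp
qed

text \<open>The minimiser \<open>T \<alpha>\<close> is the derivative of \<open>F\<close>: it is
  continuous because \<open>b'\<close> is strictly increasing, and it squeezes the difference
  quotients of \<open>F\<close>. Concavity holds because \<open>F\<close> is a minimum of affine
  functions.\<close>

lemma legendre_transform_regular:
  fixes b b' F :: "real \<Rightarrow> real"
  assumes der: "\<And>t. (b has_real_derivative b' t) (at t)"
    and mono: "\<And>s t. s < t \<Longrightarrow> b' s < b' t"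
    and F: "\<And>\<alpha>. \<alpha> \<in> {l<..<u} \<Longrightarrow> \<exists>t. b' t = - \<alpha> \<and> F \<alpha> = \<alpha> * t + b t \<and> (\<forall>s. \<alpha> * t + b t \<le> \<alpha> * s + b s)"
  shows "F differentiable_on {l<..<u}" "concave_on {l<..<u} F"
proof -
  obtain T where T: "\<And>\<alpha>. \<alpha> \<in> {l<..<u} \<Longrightarrow> b' (T \<alpha>) = - \<alpha>"
    "\<And>\<alpha>. \<alpha> \<in> {l<..<u} \<Longrightarrow> F \<alpha> = \<alpha> * T \<alpha> + b (T \<alpha>)"
    "\<And>\<alpha> s. \<alpha> \<in> {l<..<u} \<Longrightarrow> F \<alpha> \<le> \<alpha> * s + b s"
    using F by metis
  have mono': "s < t" if "b' s < b' t" for s t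
    using mono[of t s] that by (cases s t rule: linorder_cases) auto
  have cont: "(T \<longlongrightarrow> T \<alpha>) (at \<alpha>)" if \<alpha>: "\<alpha> \<in> {l<..<u}" for \<alpha>
  proof (rule order_tendstoI)
    have op: "eventually (\<lambda>x. x \<in> {l<..<u}) (at \<alpha>)"
      using \<alpha> by (intro eventually_at_in_open') auto
    { fix a assume "a < T \<alpha>"
      then have "b' a < - \<alpha>" using mono T(1)[OF \<alpha>] by metis
      then have "eventually (\<lambda>x. b' a < - x) (at \<alpha>)"
        by (intro order_tendstoD(1)[of _ "-\<alpha>"] tendsto_intros) auto
      with op show "eventually (\<lambda>x. a < T x) (at \<alpha>)"
        by eventually_elim (use T(1) mono' in metis) }
    { fix a assume "T \<alpha> < a"
      then have "- \<alpha> < b' a" using mono T(1)[OF \<alpha>] by metis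
      then have "eventually (\<lambda>x. - x < b' a) (at \<alpha>)"
        by (intro order_tendstoD(2)[of _ "-\<alpha>"] tendsto_intros) auto
      with op show "eventually (\<lambda>x. T x < a) (at \<alpha>)"
        by eventually_elim (use T(1) mono' in metis) }
  qed
  have "(F has_real_derivative T \<alpha>) (at \<alpha>)" if \<alpha>: "\<alpha> \<in> {l<..<u}" for \<alpha>
    unfolding DERIV_def
  proof -
    have op: "eventually (\<lambda>x. x \<in> {l<..<u}) (at \<alpha>)"
      using \<alpha> by (intro eventually_at_in_open') auto
    have "((\<lambda>x. (F x - F \<alpha>) / (x - \<alpha>)) \<longlongrightarrow> T \<alpha>) (at \<alpha>)"
    proof (rule tendsto_sandwich)
      \<comment> \<open>Testing each of the two minima with the minimiser of the other bounds
        \<open>F x - F \<alpha>\<close> from both sides.\<close>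
      have *: "min (T x) (T \<alpha>) \<le> (F x - F \<alpha>) / (x - \<alpha>) \<and> (F x - F \<alpha>) / (x - \<alpha>) \<le> max (T x) (T \<alpha>)"
        if "x \<in> {l<..<u}" "x \<noteq> \<alpha>" for x
      proof -
        have "(x - \<alpha>) * T x \<le> F x - F \<alpha>"
          using T(2)[OF that(1)] T(3)[OF \<alpha>, of "T x"] by (simp add: algebra_simps)
        moreover have "F x - F \<alpha> \<le> (x - \<alpha>) * T \<alpha>"
          using T(2)[OF \<alpha>] T(3)[OF that(1), of "T \<alpha>"] by (simp add: algebra_simps)
        ultimately show ?thesis
          using that(2) by (cases "x < \<alpha>")
            (simp_all add: min_le_iff_disj le_max_iff_disj neg_divide_le_eq neg_le_divide_eq pos_divide_le_eq pos_le_divide_eq mult.commute)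
      qed
      show "eventually (\<lambda>x. min (T x) (T \<alpha>) \<le> (F x - F \<alpha>) / (x - \<alpha>)) (at \<alpha>)"
        using op eventually_neq_at_within[of \<alpha> \<alpha> UNIV] by eventually_elim (use * in auto)
      show "eventually (\<lambda>x. (F x - F \<alpha>) / (x - \<alpha>) \<le> max (T x) (T \<alpha>)) (at \<alpha>)"
        using op eventually_neq_at_within[of \<alpha> \<alpha> UNIV] by eventually_elim (use * in auto)
      show "((\<lambda>x. min (T x) (T \<alpha>)) \<longlongrightarrow> T \<alpha>) (at \<alpha>)"
        using tendsto_min[OF cont[OF \<alpha>] tendsto_const[of "T \<alpha>"]] by simp
      show "((\<lambda>x. max (T x) (T \<alpha>)) \<longlongrightarrow> T \<alpha>) (at \<alpha>)"
        using tendsto_max[OF cont[OF \<alpha>] tendsto_const[of "T \<alpha>"]] by simp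
    qed
    then show "((\<lambda>h. (F (\<alpha> + h) - F \<alpha>) / h) \<longlongrightarrow> T \<alpha>) (at 0)"
      by (simp add: LIM_offset_zero_iff[of \<alpha>])
  qed
  then show "F differentiable_on {l<..<u}"
    unfolding differentiable_on_def
    by (meson differentiable_at_withinI real_differentiable_def)
  show "concave_on {l<..<u} F"
    unfolding concave_on_iff
  proof (intro conjI ballI allI impI)
    fix x y v w :: real assume xy: "x \<in> {l<..<u}" "y \<in> {l<..<u}" and vw: "0 \<le> v" "0 \<le> w" "v + w = 1"
    let ?z = "v *\<^sub>R x + w *\<^sub>R y"
    have z: "?z \<in> {l<..<u}" using convexD[OF convex_real_interval(8) xy vw] by simp
    have "v * F x + w * F y \<le> v * (x * T ?z + b (T ?z)) + w * (y * T ?z + b (T ?z))"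
      using T(3)[OF xy(1)] T(3)[OF xy(2)] vw by (intro add_mono mult_left_mono) auto
    also have "\<dots> = ?z * T ?z + (v + w) * b (T ?z)" by (simp add: algebra_simps)
    also have "\<dots> = F ?z" using T(2)[OF z] vw by simp
    finally show "v * F x + w * F y \<le> F (v *\<^sub>R x + w *\<^sub>R y)" .
  qed auto
qed

section \<open>Weighted carpets and their pressure\<close>

locale digit_carpet =
  fixes m n :: nat and D :: "(nat \<times> nat) set"
  assumes m_less_n: "m < n"
    and D_subset: "D \<subseteq> {0..<m} \<times> {0..<n}"
    and two_rows: "\<exists>d\<in>D. \<exists>d'\<in>D. fst d \<noteq> fst d'"
    and two_cols: "\<exists>d\<in>D. \<exists>d'\<in>D. snd d \<noteq> snd d'"
begin

abbreviation \<sigma> :: real where "\<sigma> \<equiv> sigma_exp m n"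
abbreviation R :: "nat set" where "R \<equiv> fst ` D"
abbreviation row :: "nat \<Rightarrow> nat set" where "row i \<equiv> {j. (i, j) \<in> D}"

lemma fst_less: "d \<in> D \<Longrightarrow> fst d < m" and snd_less: "d \<in> D \<Longrightarrow> snd d < n"
  using D_subset by auto

lemma m_ge_2: "2 \<le> m" and n_ge_2: "2 \<le> n"
proof -
  obtain d d' where "d \<in> D" "d' \<in> D" "fst d \<noteq> fst d'"
    using two_rows by auto
  then show "2 \<le> m" using fst_less[of d] fst_less[of d'] by linarith
  then show "2 \<le> n" using m_less_n by linarith
qed

lemma ln_m_pos: "0 < ln (real m)"
  using m_ge_2 by simp

lemma sigma_bounds: "0 < \<sigma>" "\<sigma> < 1"
  using m_ge_2 m_less_n by (auto simp: sigma_exp_def)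

lemma finite_D: "finite D" and D_nonempty: "D \<noteq> {}"
  using finite_subset[OF D_subset] two_rows by auto

lemma finite_row: "finite (row i)"
  using finite_subset[of "row i" "snd ` D"] finite_D by force

lemma row_nonempty: "i \<in> R \<Longrightarrow> row i \<noteq> {}"
  by auto

lemma D_Sigma: "D = Sigma R row"
  by force

lemma sum_over_D: "(\<Sum>d\<in>D. f d) = (\<Sum>i\<in>R. \<Sum>j\<in>row i. f (i, j))"
  by (subst D_Sigma, subst sum.Sigma) (use finite_D finite_row in auto)

end

locale weighted_carpet = digit_carpet +
  fixes p :: "nat \<times> nat \<Rightarrow> real"
  assumes p_pos: "\<And>d. d \<in> D \<Longrightarrow> 0 < p d"
    and p_sum: "(\<Sum>d\<in>D. p d) = 1"
begin

abbreviation q :: "nat \<Rightarrow> real" where "q \<equiv> row_prob D p"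
abbreviation \<gamma> :: "real \<Rightarrow> nat \<Rightarrow> real" where "\<gamma> \<equiv> row_gamma D p"
abbreviation \<beta> :: "real \<Rightarrow> real" where "\<beta> \<equiv> beta m n D p"
abbreviation expo :: "nat \<times> nat \<Rightarrow> real" where "expo \<equiv> digit_exponent m n D p"

lemma p_le_row_prob: "d \<in> D \<Longrightarrow> p d \<le> q (fst d)"
  unfolding row_prob_def
  using member_le_sum[of "snd d" "row (fst d)" "\<lambda>j. p (fst d, j)"] p_pos finite_row
  by (auto simp: less_imp_le)

lemma row_prob_pos: "i \<in> R \<Longrightarrow> 0 < q i"
  using p_le_row_prob p_pos by fastforce

lemma sum_row_prob: "(\<Sum>i\<in>R. q i) = 1"
  using p_sum unfolding sum_over_D row_prob_def .

lemma row_prob_le_1: "i \<in> R \<Longrightarrow> q i \<le> 1"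
  using member_le_sum[of i R q] sum_row_prob finite_D row_prob_pos by (force simp: less_imp_le)

lemma p_le_1: "d \<in> D \<Longrightarrow> p d \<le> 1"
  using p_le_row_prob[of d] row_prob_le_1[of "fst d"] by auto

lemma row_gamma_exp: "i \<in> R \<Longrightarrow> \<gamma> t i = (\<Sum>j\<in>row i. exp (t * ln (p (i, j))))"
  unfolding row_gamma_def by (intro sum.cong) (auto simp: powr_def p_pos less_imp_neq[symmetric])

lemma row_gamma_pos: "i \<in> R \<Longrightarrow> 0 < \<gamma> t i"
  using row_nonempty[of i] finite_row by (auto simp: row_gamma_exp intro!: sum_pos)

text \<open>Logarithm of the tilted row weight before normalisation: summing
  \<open>p powr t * \<gamma> powr (\<sigma> - 1)\<close> over the columns of a row leaves
  \<open>\<gamma> powr \<sigma>\<close>.\<close>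

definition row_pressure :: "nat \<Rightarrow> real \<Rightarrow> real" where
  "row_pressure i t = (1 - \<sigma>) * t * ln (q i) + \<sigma> * ln (\<gamma> t i)"

definition row_pressure' :: "nat \<Rightarrow> real \<Rightarrow> real" where
  "row_pressure' i t = (1 - \<sigma>) * ln (q i) + \<sigma> * ((\<Sum>j\<in>row i. exp (t * ln (p (i, j))) * ln (p (i, j))) / (\<Sum>j\<in>row i. exp (t * ln (p (i, j)))))"

text \<open>This is \<sigma> times the variance of \<open>ln p\<close> within row \<open>i\<close>,
  under the weights proportional to \<open>p powr t\<close>.\<close>

definition row_pressure'' :: "nat \<Rightarrow> real \<Rightarrow> real" where
  "row_pressure'' i t = \<sigma> * ((\<Sum>j\<in>row i. exp (t * ln (p (i, j))) * (ln (p (i, j)) -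
     (\<Sum>j\<in>row i. exp (t * ln (p (i, j))) * ln (p (i, j))) / (\<Sum>j\<in>row i. exp (t * ln (p (i, j)))))\<^sup>2) / (\<Sum>j\<in>row i. exp (t * ln (p (i, j)))))"

lemma DERIV_row_pressure: "i \<in> R \<Longrightarrow> (row_pressure i has_real_derivative row_pressure' i t) (at t)"
proof -
  assume i: "i \<in> R"
  have 1: "((\<lambda>t. ln (\<Sum>j\<in>row i. exp (t * ln (p (i, j))))) has_real_derivative
      (\<Sum>j\<in>row i. exp (t * ln (p (i, j))) * ln (p (i, j))) / (\<Sum>j\<in>row i. exp (t * ln (p (i, j))))) (at t)"
    by (rule DERIV_ln_sum_exp[where h = "\<lambda>j t. t * ln (p (i, j))" and h' = "\<lambda>j t. ln (p (i, j))"])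
       (use i in \<open>auto intro!: derivative_eq_intros finite_row\<close>)
  have 2: "row_pressure i = (\<lambda>t. (1 - \<sigma>) * t * ln (q i) + \<sigma> * ln (\<Sum>j\<in>row i. exp (t * ln (p (i, j)))))"
    using i by (auto simp: fun_eq_iff row_pressure_def row_gamma_exp)
  show ?thesis
    using DERIV_add[OF DERIV_cmult_right[OF DERIV_cmult[OF DERIV_ident, of "1 - \<sigma>"], of "ln (q i)"] DERIV_cmult[OF 1, of \<sigma>]]
    unfolding row_pressure'_def 2 by simp
qed

lemma DERIV_row_pressure': "i \<in> R \<Longrightarrow> (row_pressure' i has_real_derivative row_pressure'' i t) (at t)"
proof -
  assume i: "i \<in> R"
  have "((\<lambda>t. (\<Sum>j\<in>row i. exp (t * ln (p (i, j))) * ln (p (i, j))) / (\<Sum>j\<in>row i. exp (t * ln (p (i, j)))))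
     has_real_derivative (\<Sum>j\<in>row i. exp (t * ln (p (i, j))) * (0 + (ln (p (i, j)) -
     (\<Sum>j\<in>row i. exp (t * ln (p (i, j))) * ln (p (i, j))) / (\<Sum>j\<in>row i. exp (t * ln (p (i, j)))))\<^sup>2)) / (\<Sum>j\<in>row i. exp (t * ln (p (i, j))))) (at t)"
    by (rule DERIV_ln_sum_exp2[where h = "\<lambda>j t. t * ln (p (i, j))" and h' = "\<lambda>j t. ln (p (i, j))"
        and h'' = "\<lambda>j t. 0" and I = "row i" and t = t])
       (use i finite_row in \<open>auto intro!: derivative_eq_intros\<close>)
  from DERIV_add[OF DERIV_const[of "(1 - \<sigma>) * ln (q i)"] DERIV_cmult[OF this, of \<sigma>]]
  show ?thesis
    unfolding row_pressure'_def[abs_def] row_pressure''_def by simp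
qed

abbreviation Z :: "real \<Rightarrow> real" where "Z t \<equiv> \<Sum>i\<in>R. exp (row_pressure i t)"

lemma R_finite: "finite R" and R_nonempty: "R \<noteq> {}"
  using finite_D D_nonempty by auto

lemma Z_pos: "0 < Z t"
  using R_finite R_nonempty by (intro sum_pos) auto

lemma exp_row_pressure: "i \<in> R \<Longrightarrow> exp (row_pressure i t) = q i powr ((1 - \<sigma>) * t) * \<gamma> t i powr \<sigma>"
  using row_prob_pos[of i] row_gamma_pos[of i t] by (simp add: powr_def row_pressure_def exp_add)

lemma pressure_row:
  assumes "i \<in> R"
  shows "(\<Sum>j\<in>row i. p (i, j) powr t * q i powr ((1 - \<sigma>) * t) * \<gamma> t i powr (\<sigma> - 1)) = exp (row_pressure i t)"
proof -
  have "(\<Sum>j\<in>row i. p (i, j) powr t * q i powr ((1 - \<sigma>) * t) * \<gamma> t i powr (\<sigma> - 1))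
     = \<gamma> t i * \<gamma> t i powr (\<sigma> - 1) * q i powr ((1 - \<sigma>) * t)"
    by (simp add: row_gamma_def sum_distrib_right sum_distrib_left mult_ac)
  also have "\<gamma> t i * \<gamma> t i powr (\<sigma> - 1) = \<gamma> t i powr \<sigma>"
    using row_gamma_pos[OF assms, of t] by (simp add: powr_diff)
  finally show ?thesis using exp_row_pressure[OF assms] by simp
qed

lemma pressure_eq:
  "(\<Sum>(i, j)\<in>D. p (i, j) powr t * q i powr ((1 - \<sigma>) * t) * \<gamma> t i powr (\<sigma> - 1)) = Z t"
  by (subst sum_over_D) (simp add: pressure_row)

lemma beta_eq: "\<beta> t = ln (Z t) / ln m"
proof -
  have "real m powr - b * Z t = 1 \<longleftrightarrow> b = ln (Z t) / ln m" for b
  proof -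
    have "real m powr - b * Z t = exp (ln (Z t) - b * ln m)"
      using Z_pos[of t] m_ge_2 by (simp add: powr_def exp_diff exp_minus field_simps)
    then show ?thesis using ln_m_pos by (auto simp: eq_divide_eq)
  qed
  then show ?thesis
    unfolding beta_def pressure_eq by (intro the_equality) auto
qed

lemma m_powr_beta: "real m powr (- \<beta> t) = 1 / Z t"
proof -
  have "\<beta> t * ln m = ln (Z t)" using ln_m_pos by (simp add: beta_eq)
  then show ?thesis
    using Z_pos[of t] m_ge_2 by (simp add: powr_def exp_minus divide_inverse)
qed

definition tilt :: "real \<Rightarrow> nat \<times> nat \<Rightarrow> real" where
  "tilt t = (\<lambda>(i, j). real m powr (- \<beta> t) * (p (i, j) powr t * q i powr ((1 - \<sigma>) * t) * \<gamma> t i powr (\<sigma> - 1)))"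

lemma row_prob_tilt: "i \<in> R \<Longrightarrow> row_prob D (tilt t) i = exp (row_pressure i t) / Z t"
proof -
  assume i: "i \<in> R"
  have "row_prob D (tilt t) i = 1 / Z t *
      (\<Sum>j\<in>row i. p (i, j) powr t * q i powr ((1 - \<sigma>) * t) * \<gamma> t i powr (\<sigma> - 1))"
    unfolding row_prob_def[of D "tilt t"] by (simp add: tilt_def m_powr_beta sum_distrib_left)
  then show ?thesis using pressure_row[OF i, of t] by simp
qed

lemma weighted_carpet_tilt: "weighted_carpet m n D (tilt t)"
proof
  fix d assume "d \<in> D"
  then show "0 < tilt t d"
    using p_pos[of d] row_prob_pos[of "fst d"] row_gamma_pos[of "fst d" t] m_ge_2
    by (auto simp: tilt_def split: prod.split)
next
  have "(\<Sum>d\<in>D. tilt t d) = (\<Sum>i\<in>R. row_prob D (tilt t) i)"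
    unfolding sum_over_D row_prob_def ..
  also have "\<dots> = 1"
    using Z_pos[of t] by (simp add: row_prob_tilt sum_divide_distrib[symmetric])
  finally show "(\<Sum>d\<in>D. tilt t d) = 1" .
qed

text \<open>Two-stage choice of a tilted digit: first the row, with probability
  \<open>exp (row_pressure i t) / Z t\<close>, then the column, with probability proportional to
  \<open>p powr t\<close>.\<close>

lemma tilt_eq:
  assumes "(i, j) \<in> D"
  shows "tilt t (i, j) = exp (row_pressure i t) / Z t * (exp (t * ln (p (i, j))) / \<gamma> t i)"
proof -
  have i: "i \<in> R" using assms by force
  have "\<gamma> t i powr (\<sigma> - 1) = \<gamma> t i powr \<sigma> / \<gamma> t i"
    using row_gamma_pos[OF i, of t] by (simp add: powr_diff)
  then show ?thesis
    using p_pos[OF assms] by (simp add: tilt_def m_powr_beta exp_row_pressure[OF i] powr_def[of "p (i,j)"] mult_ac)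
qed

abbreviation mean_expo :: "real \<Rightarrow> real" where "mean_expo t \<equiv> \<Sum>d\<in>D. tilt t d * expo d"

lemma mean_expo_eq: "- mean_expo t = (\<Sum>i\<in>R. exp (row_pressure i t) * row_pressure' i t) / Z t / ln m"
proof -
  have "(\<Sum>j\<in>row i. tilt t (i, j) * - expo (i, j)) = exp (row_pressure i t) * row_pressure' i t / Z t / ln m" if i: "i \<in> R" for i
  proof -
    let ?E = "\<lambda>j. exp (t * ln (p (i, j)))"
    have g: "0 < \<gamma> t i" using row_gamma_pos[OF i] .
    have alg: "z * (e / g) * - ((- \<sigma> * a + (\<sigma> - 1) * b) / l) = z / l * ((1 - \<sigma>) * b * (e / g) + \<sigma> * (e * a / g))" for z e g a b l :: real
      by (simp add: divide_inverse algebra_simps)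
    have "(\<Sum>j\<in>row i. tilt t (i, j) * - expo (i, j)) =
      (\<Sum>j\<in>row i. exp (row_pressure i t) / Z t / ln m * ((1 - \<sigma>) * ln (q i) * (?E j / \<gamma> t i) + \<sigma> * (?E j * ln (p (i, j)) / \<gamma> t i)))"
      by (intro sum.cong refl) (simp only: tilt_eq digit_exponent_def prod.case mem_Collect_eq alg)
    also have "\<dots> = exp (row_pressure i t) / Z t / ln m * ((1 - \<sigma>) * ln (q i) * ((\<Sum>j\<in>row i. ?E j) / \<gamma> t i) +
        \<sigma> * ((\<Sum>j\<in>row i. ?E j * ln (p (i, j))) / \<gamma> t i))"
      by (simp only: sum_distrib_left[symmetric] sum.distrib sum_divide_distrib[symmetric])
    also have "\<dots> = exp (row_pressure i t) / Z t / ln m * row_pressure' i t"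
      using g i by (simp add: row_gamma_exp row_pressure'_def)
    finally show ?thesis by simp
  qed
  then have "(\<Sum>d\<in>D. tilt t d * - expo d) = (\<Sum>i\<in>R. exp (row_pressure i t) * row_pressure' i t / Z t / ln m)"
    unfolding sum_over_D by (intro sum.cong) auto
  then show ?thesis
    by (simp add: sum_negf sum_divide_distrib)
qed

lemma DERIV_beta: "(\<beta> has_real_derivative - mean_expo t) (at t)"
  unfolding mean_expo_eq beta_eq[abs_def]
  by (rule DERIV_cdivide, rule DERIV_ln_sum_exp) (simp_all add: DERIV_row_pressure finite_D D_nonempty)

lemma row_pressure''_nonneg: "i \<in> R \<Longrightarrow> 0 \<le> row_pressure'' i t"
  unfolding row_pressure''_def using sigma_bounds by (intro mult_nonneg_nonneg divide_nonneg_nonneg sum_nonneg) auto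

lemma row_pressure''_eq_0:
  assumes "i \<in> R" "row_pressure'' i t = 0" "j \<in> row i"
  shows "ln (p (i, j)) = (\<Sum>j\<in>row i. exp (t * ln (p (i, j))) * ln (p (i, j))) / (\<Sum>j\<in>row i. exp (t * ln (p (i, j))))"
proof -
  have "0 < (\<Sum>j\<in>row i. exp (t * ln (p (i, j))))"
    using row_gamma_pos[OF assms(1), of t] row_gamma_exp[OF assms(1), of t] by simp
  then have 0: "(\<Sum>j\<in>row i. exp (t * ln (p (i, j))) * (ln (p (i, j)) -
     (\<Sum>j\<in>row i. exp (t * ln (p (i, j))) * ln (p (i, j))) / (\<Sum>j\<in>row i. exp (t * ln (p (i, j)))))\<^sup>2) = 0"
    using assms(2) sigma_bounds unfolding row_pressure''_def by auto
  have "f j = c"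
    if "(\<Sum>j\<in>row i. exp (t * f j) * (f j - c)\<^sup>2) = 0" for f c
    using that assms(3) finite_row by (subst (asm) sum_nonneg_eq_0_iff) auto
  from this[of "\<lambda>j. ln (p (i, j))", OF 0] show ?thesis .
qed

text \<open>Up to a constant factor, \<beta>'' is the variance of \<open>row_pressure'\<close>
  between the rows plus the mean of the variances within the rows. If it vanished, all digits would
  share one exponent, contrary to the first assumption.\<close>

lemma mean_expo_strict:
  assumes "alpha_min m n D p < alpha_max m n D p" "s < t"
  shows "- mean_expo s < - mean_expo t"
proof -
  let ?L = "\<lambda>t. (\<Sum>i\<in>R. exp (row_pressure i t) * row_pressure' i t) / Z t"
  have "?L s < ?L t"
  proof (rule DERIV_pos_imp_increasing[OF assms(2)], intro exI conjI)
    fix u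
    let ?S = "\<Sum>i\<in>R. exp (row_pressure i u) * (row_pressure'' i u + (row_pressure' i u - ?L u)\<^sup>2)"
    show "(?L has_real_derivative ?S / Z u) (at u)"
      by (rule DERIV_ln_sum_exp2) (simp_all add: DERIV_row_pressure DERIV_row_pressure' finite_D D_nonempty)
    have nn: "0 \<le> exp (row_pressure i u) * (row_pressure'' i u + (row_pressure' i u - ?L u)\<^sup>2)" if "i \<in> R" for i
      using row_pressure''_nonneg[OF that] by (intro mult_nonneg_nonneg add_nonneg_nonneg) auto
    have "?S \<noteq> 0"
    proof
      assume "?S = 0"
      then have "\<forall>i\<in>R. row_pressure'' i u + (row_pressure' i u - ?L u)\<^sup>2 = 0"
        using nn R_finite by (subst (asm) sum_nonneg_eq_0_iff) auto
      then have *: "row_pressure'' i u = 0 \<and> row_pressure' i u = ?L u" if "i \<in> R" for i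
        using row_pressure''_nonneg[OF that, of u] that by (force simp: add_nonneg_eq_0_iff)
      have "expo d = - ?L u / ln m" if d: "d \<in> D" for d
      proof -
        obtain i j where ij: "d = (i, j)" by force
        then have i: "i \<in> R" "j \<in> row i" using d by force+
        have "?L u = row_pressure' i u" using * i by simp
        also have "row_pressure' i u = (1 - \<sigma>) * ln (q i) + \<sigma> * ln (p (i, j))"
          unfolding row_pressure'_def using row_pressure''_eq_0[OF i(1) _ i(2), of u] * i by simp
        finally have "- ?L u = - \<sigma> * ln (p (i, j)) + (\<sigma> - 1) * ln (q i)" by (simp add: algebra_simps)
        then show ?thesis by (simp add: ij digit_exponent_def)
      qed
      then have "expo ` D = {- ?L u / ln m}"
        using D_nonempty by (intro equalityI image_subsetI) auto
      then show False
        using assms(1) unfolding alpha_min_def alpha_max_def by simp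
    qed
    moreover have "0 \<le> ?S" using nn by (intro sum_nonneg) auto
    ultimately show "0 < ?S / Z u" using Z_pos[of u] by simp
  qed
  then show ?thesis
    unfolding mean_expo_eq using ln_m_pos by (intro divide_strict_right_mono)
qed

text \<open>Keep a single term of each sum. Two digits with exponents on both sides of \<alpha> then
  force \<alpha>t + \<beta>(t) to grow in both directions.\<close>

lemma beta_ge: "d \<in> D \<Longrightarrow> - t * expo d \<le> \<beta> t"
proof -
  assume d: "d \<in> D"
  obtain i j where ij: "d = (i, j)" by force
  then have i: "i \<in> R" "j \<in> row i" using d by force+
  have "t * ln (p (i, j)) = ln (exp (t * ln (p (i, j))))" by simp
  also have "\<dots> \<le> ln (\<gamma> t i)"
    using i row_gamma_pos[OF i(1)] member_le_sum[of j "row i" "\<lambda>j. exp (t * ln (p (i, j)))"] finite_row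
    by (subst ln_le_cancel_iff) (auto simp: row_gamma_exp)
  finally have "(1 - \<sigma>) * t * ln (q i) + \<sigma> * (t * ln (p (i, j))) \<le> row_pressure i t"
    using sigma_bounds unfolding row_pressure_def by (intro add_left_mono mult_left_mono) auto
  also have "row_pressure i t = ln (exp (row_pressure i t))" by simp
  also have "\<dots> \<le> ln (Z t)"
    using i Z_pos[of t] member_le_sum[of i R "\<lambda>i. exp (row_pressure i t)"] R_finite
    by (subst ln_le_cancel_iff) auto
  finally have "((1 - \<sigma>) * t * ln (q i) + \<sigma> * (t * ln (p (i, j)))) / ln m \<le> ln (Z t) / ln m"
    using ln_m_pos by (intro divide_right_mono) auto
  moreover have "- t * expo d = ((1 - \<sigma>) * t * ln (q i) + \<sigma> * (t * ln (p (i, j)))) / ln m"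
    by (simp add: ij digit_exponent_def divide_inverse algebra_simps)
  ultimately show ?thesis by (simp add: beta_eq)
qed

lemma minimiser_exists:
  assumes \<alpha>: "\<alpha> \<in> {alpha_min m n D p<..<alpha_max m n D p}"
  shows "\<exists>t. \<alpha> = mean_expo t \<and> (\<forall>s. \<alpha> * t + \<beta> t \<le> \<alpha> * s + \<beta> s)"
proof -
  let ?F = "\<lambda>t. \<alpha> * t + \<beta> t"
  have fin: "finite (expo ` D)" "expo ` D \<noteq> {}" using finite_D D_nonempty by auto
  obtain d where d: "d \<in> D" "alpha_min m n D p = expo d"
    using Min_in[OF fin] unfolding alpha_min_def by auto
  obtain e where e: "e \<in> D" "alpha_max m n D p = expo e"
    using Max_in[OF fin] unfolding alpha_max_def by auto
  define c where "c = min (\<alpha> - expo d) (expo e - \<alpha>)"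
  have c: "0 < c" "c \<le> \<alpha> - expo d" "c \<le> expo e - \<alpha>" using \<alpha> d e by (auto simp: c_def)
  have grow: "c * \<bar>t\<bar> \<le> ?F t" for t
  proof (cases "0 \<le> t")
    case True
    then have "c * \<bar>t\<bar> \<le> (\<alpha> - expo d) * t" using c by (simp add: mult_right_mono)
    then show ?thesis using beta_ge[OF d(1), of t] by (simp add: algebra_simps)
  next
    case False
    then have "c * \<bar>t\<bar> \<le> (expo e - \<alpha>) * (- t)" using c by (intro mult_mono) auto
    then show ?thesis using beta_ge[OF e(1), of t] by (simp add: algebra_simps)
  qed
  \<comment> \<open>Outside [-B, B] the bound \<open>grow\<close> exceeds the value at 0, so a
    minimum over this interval is global.\<close>
  define B where "B = \<bar>?F 0\<bar> / c + 1"
  have B: "0 < B" using c by (simp add: B_def add_nonneg_pos)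
  have dF: "(?F has_real_derivative \<alpha> - mean_expo t) (at t)" for t
    by (auto intro!: derivative_eq_intros DERIV_beta)
  have "continuous_on {-B..B} ?F"
    using dF by (intro continuous_at_imp_continuous_on ballI DERIV_isCont)
  then obtain t where t: "t \<in> {-B..B}" "\<And>s. s \<in> {-B..B} \<Longrightarrow> ?F t \<le> ?F s"
    using continuous_attains_inf[of "{-B..B}" ?F] B by (auto simp: compact_Icc)
  have min: "?F t \<le> ?F s" for s
  proof (cases "s \<in> {-B..B}")
    case False
    then have "B < \<bar>s\<bar>" by auto
    then have "c * B < c * \<bar>s\<bar>" using c by simp
    moreover have "c * B = \<bar>?F 0\<bar> + c" using c by (simp add: B_def field_simps)
    moreover have "?F t \<le> ?F 0" using t(2)[of 0] B by simp
    ultimately show ?thesis using grow[of s] c by linarith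
  qed (use t in auto)
  have "\<alpha> - mean_expo t = 0"
    by (rule DERIV_local_min[OF dF, of 1]) (use min in auto)
  then show ?thesis using min by (intro exI[of _ t]) auto
qed

text \<open>The digit exponent of the tilted weights is an affine function of the original one,
  \<open>t * expo d + \<beta> t\<close>. Averaging it turns the Legendre value into the local
  dimension that the tilted measure has at its generic points.\<close>

lemma legendre_value:
  "mean_expo t * t + \<beta> t = (\<Sum>d\<in>D. tilt t d * digit_exponent m n D (tilt t) d)"
proof -
  interpret T: weighted_carpet m n D "tilt t" by (rule weighted_carpet_tilt)
  have "digit_exponent m n D (tilt t) d = t * expo d + \<beta> t" if d: "d \<in> D" for d
  proof -
    obtain i j where ij: "d = (i, j)" by force
    then have i: "i \<in> R" and dij: "(i, j) \<in> D" using d by force+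
    note g = row_gamma_pos[OF i, of t] and z = Z_pos[of t]
    have 1: "ln (tilt t (i, j)) = row_pressure i t - ln (Z t) + t * ln (p (i, j)) - ln (\<gamma> t i)"
      using g z by (simp add: tilt_eq[OF dij] ln_mult ln_div)
    have 2: "ln (row_prob D (tilt t) i) = row_pressure i t - ln (Z t)"
      using z by (simp add: row_prob_tilt[OF i] ln_div)
    have "- \<sigma> * ln (tilt t (i, j)) + (\<sigma> - 1) * ln (row_prob D (tilt t) i) =
      t * (- \<sigma> * ln (p (i, j)) + (\<sigma> - 1) * ln (q i)) + ln (Z t)"
      unfolding 1 2 by (simp add: row_pressure_def algebra_simps)
    then show ?thesis
      unfolding ij digit_exponent_def beta_eq prod.case
      by (simp only: add_divide_distrib times_divide_eq_right[symmetric])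
  qed
  then have "(\<Sum>d\<in>D. tilt t d * digit_exponent m n D (tilt t) d) = (\<Sum>d\<in>D. tilt t d * expo d * t + tilt t d * \<beta> t)"
    by (intro sum.cong) (auto simp: algebra_simps)
  then show ?thesis
    by (simp add: sum.distrib sum_distrib_right[symmetric] T.p_sum)
qed

lemma expo_nonneg: "d \<in> D \<Longrightarrow> 0 \<le> expo d"
proof -
  assume d: "d \<in> D"
  then have "0 \<le> \<sigma> * - ln (p d)" "0 \<le> (1 - \<sigma>) * - ln (q (fst d))"
    using sigma_bounds p_le_1[of d] p_pos[of d] row_prob_le_1[of "fst d"] row_prob_pos[of "fst d"]
    by (intro mult_nonneg_nonneg; simp)+
  then have "0 \<le> (\<sigma> * - ln (p d) + (1 - \<sigma>) * - ln (q (fst d))) / ln m"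
    using ln_m_pos by simp
  also have "\<dots> = expo d"
    by (simp add: digit_exponent_def algebra_simps split: prod.split)
  finally show ?thesis .
qed

end

section \<open>Digit expansions and approximate squares\<close>

fun prefix_num :: "nat \<Rightarrow> (nat \<Rightarrow> nat) \<Rightarrow> nat \<Rightarrow> nat" where
  "prefix_num b a 0 = 0"
| "prefix_num b a (Suc k) = b * prefix_num b a k + a k"

text \<open>The first digit has place value 1, because the carpet maps translate by whole digits.
  Hence the factor \<open>b / b ^ k\<close>, and expansions range over [0, b].\<close>

definition prefix_val :: "nat \<Rightarrow> (nat \<Rightarrow> nat) \<Rightarrow> nat \<Rightarrow> real" where
  "prefix_val b a k = real (prefix_num b a k) * (real b / real b ^ k)"

definition digit_ivl :: "nat \<Rightarrow> (nat \<Rightarrow> nat) \<Rightarrow> nat \<Rightarrow> real set" where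
  "digit_ivl b a k = {prefix_val b a k .. prefix_val b a k + real b / real b ^ k}"

lemma num_cong: "(\<And>c. c < k \<Longrightarrow> a c = a' c) \<Longrightarrow> prefix_num b a k = prefix_num b a' k"
  by (induction k) auto

lemma num_inj:
  assumes "\<And>c. c < k \<Longrightarrow> a c < b" "\<And>c. c < k \<Longrightarrow> a' c < b" "prefix_num b a k = prefix_num b a' k" "c < k"
  shows "a c = a' c"
  using assms
proof (induction k)
  case (Suc k)
  have "(b * prefix_num b a k + a k) div b = (b * prefix_num b a' k + a' k) div b"
    "(b * prefix_num b a k + a k) mod b = (b * prefix_num b a' k + a' k) mod b"
    using Suc.prems(3) by simp_all
  then have "prefix_num b a k = prefix_num b a' k" "a k = a' k"
    using Suc.prems(1)[of k] Suc.prems(2)[of k] by simp_all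
  then show ?case using Suc by (auto simp: less_Suc_eq)
qed simp

lemma ivl_cong: "(\<And>c. c < k \<Longrightarrow> a c = a' c) \<Longrightarrow> digit_ivl b a k = digit_ivl b a' k"
  by (simp add: digit_ivl_def prefix_val_def num_cong[of k a a'])

lemma val_Suc: "0 < b \<Longrightarrow> prefix_val b a (Suc k) = prefix_val b a k + a k / real b ^ k"
  by (simp add: prefix_val_def field_simps)

lemma val_eq_sum: "0 < b \<Longrightarrow> prefix_val b a k = (\<Sum>c<k. a c / real b ^ c)"
  by (induction k) (simp add: prefix_val_def, simp add: val_Suc)

lemma val_bounds:
  assumes "0 < b" "k \<le> l" "\<And>c. k \<le> c \<Longrightarrow> c < l \<Longrightarrow> a c < b"
  shows "prefix_val b a k \<le> prefix_val b a l" "prefix_val b a l + real b / real b ^ l \<le> prefix_val b a k + real b / real b ^ k"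
proof -
  have "prefix_val b a k \<le> prefix_val b a (k + j) \<and> prefix_val b a (k + j) + real b / real b ^ (k + j) \<le> prefix_val b a k + real b / real b ^ k"
    if "\<And>c. k \<le> c \<Longrightarrow> c < k + j \<Longrightarrow> a c < b" for j
    using that
  proof (induction j)
    case (Suc j)
    have "real (a (k + j)) + 1 \<le> b" using Suc.prems[of "k + j"] by simp
    then have "(real (a (k + j)) + 1) / real b ^ (k + j) \<le> real b / real b ^ (k + j)" by (intro divide_right_mono) auto
    moreover have "real b / real b ^ Suc (k + j) = 1 / real b ^ (k + j)" using assms(1) by simp
    moreover have "0 \<le> real (a (k + j)) / real b ^ (k + j)" by simp
    moreover have "prefix_val b a k \<le> prefix_val b a (k + j) \<and> prefix_val b a (k + j) + real b / real b ^ (k + j) \<le> prefix_val b a k + real b / real b ^ k"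
      using Suc by simp
    ultimately show ?case
      unfolding add_Suc_right val_Suc[OF assms(1)] add_divide_distrib of_nat_power by linarith
  qed simp
  from this[of "l - k"] assms have "prefix_val b a k \<le> prefix_val b a l \<and> prefix_val b a l + real b / real b ^ l \<le> prefix_val b a k + real b / real b ^ k"
    by simp
  then show "prefix_val b a k \<le> prefix_val b a l" "prefix_val b a l + real b / real b ^ l \<le> prefix_val b a k + real b / real b ^ k" by auto
qed

lemma ivl_antimono:
  assumes "0 < b" "k \<le> l" "\<And>c. c < l \<Longrightarrow> a c < b"
  shows "digit_ivl b a l \<subseteq> digit_ivl b a k"
  using val_bounds[of b k l a] assms by (auto simp: digit_ivl_def)

text \<open>Both intervals are cells of the same grid, and the window is shorter than one
  cell.\<close>

lemma near_num_le:
  assumes "digit_ivl b a k \<inter> {y - r..y + r} \<noteq> {}" "digit_ivl b a' k \<inter> {y - r..y + r} \<noteq> {}"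
    and "2 * r < real b / real b ^ k"
  shows "prefix_num b a' k \<le> prefix_num b a k + 1"
proof -
  let ?s = "real b / real b ^ k"
  have s: "0 \<le> ?s" by simp
  have "real (prefix_num b a' k) * ?s \<le> y + r" using assms(2) by (auto simp: digit_ivl_def prefix_val_def)
  moreover have "y - r \<le> real (prefix_num b a k) * ?s + ?s" using assms(1) by (auto simp: digit_ivl_def prefix_val_def)
  ultimately have "real (prefix_num b a' k) * ?s < real (prefix_num b a k) * ?s + ?s + ?s"
    using assms(3) by linarith
  then have "real (prefix_num b a' k) * ?s < (real (prefix_num b a k) + 2) * ?s"
    by (simp add: algebra_simps)
  then have "real (prefix_num b a' k) < real (prefix_num b a k) + 2"
    using s by (simp only: mult_less_cancel_right)
  then show ?thesis by linarith
qed

text \<open>As in a carry: refining by one digit multiplies the gap between different strips by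
  \<open>b\<close>, and only the extreme digits can bring them back to adjacency. This is what
  forces the digits of a point whose heavy square lies in another strip.\<close>

lemma near_split_digit:
  assumes "prefix_num b a k < prefix_num b a' k" "a k < b" "a' k < b" "prefix_num b a' (Suc k) \<le> prefix_num b a (Suc k) + 1"
  shows "prefix_num b a' (Suc k) = prefix_num b a (Suc k) + 1 \<and> a k = b - 1 \<and> a' k = 0"
proof -
  have "b * (prefix_num b a k + 1) \<le> b * prefix_num b a' k" using assms(1) by (intro mult_le_mono) auto
  then have "b * prefix_num b a k + b \<le> b * prefix_num b a' k" by simp
  then show ?thesis using assms(2-4) by (simp only: prefix_num.simps) linarith
qed

lemma card_le_2_if_gaps:
  fixes S :: "nat set"
  assumes "\<And>x y. x \<in> S \<Longrightarrow> y \<in> S \<Longrightarrow> y \<le> x + 1"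
  shows "finite S" "card S \<le> 2"
proof -
  have "finite S \<and> card S \<le> 2"
  proof (cases "S = {}")
    case False
    then obtain z where "z \<in> S" by blast
    define x where "x = (LEAST x. x \<in> S)"
    have x: "x \<in> S" "\<And>y. y \<in> S \<Longrightarrow> x \<le> y"
      unfolding x_def using \<open>z \<in> S\<close> by (auto intro: LeastI Least_le)
    have "S \<subseteq> {x, x + 1}"
    proof
      fix y assume "y \<in> S"
      then show "y \<in> {x, x + 1}" using assms[OF x(1)] x(2)[of y] by fastforce
    qed
    then show ?thesis using card_mono[of "{x, x + 1}" S] finite_subset[of S "{x, x+1}"] by auto
  qed simp
  then show "finite S" "card S \<le> 2" by auto
qed

context
  fixes b :: nat and a :: "nat \<Rightarrow> nat" and s :: real
  assumes b: "2 \<le> b" and a: "\<And>c. a c < b"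
  defines "s \<equiv> (\<Sum>c. real (a c) / real b ^ c)"
begin

lemma digits_sums: "(\<lambda>c. real (a c) / real b ^ c) sums s"
  unfolding s_def
proof (rule summable_sums, rule summableI_nonneg_bounded)
  show "(\<Sum>c<k. real (a c) / real b ^ c) \<le> b" for k
  proof -
    have "prefix_val b a k + real b / real b ^ k \<le> prefix_val b a 0 + real b / real b ^ 0"
      using val_bounds(2)[of b 0 k a] a b by auto
    moreover have "0 \<le> real b / real b ^ k" by simp
    moreover have "prefix_val b a 0 + real b / real b ^ 0 = b" by (simp add: prefix_val_def)
    ultimately have "prefix_val b a k \<le> b" by linarith
    then show ?thesis using b by (simp add: val_eq_sum)
  qed
qed simp

lemma val_tendsto: "prefix_val b a \<longlonglongrightarrow> s"
proof -
  have "prefix_val b a = (\<lambda>k. \<Sum>c<k. real (a c) / real b ^ c)" using b by (auto simp: val_eq_sum)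
  then show ?thesis using digits_sums by (simp add: sums_def)
qed

lemma val_le_digits_sum: "prefix_val b a k \<le> s"
  by (rule LIMSEQ_le_const[OF val_tendsto]) (use val_bounds(1)[of b k _ a] a b in auto)

lemma digits_sum_le_val: "s \<le> prefix_val b a k + real b / real b ^ k"
proof (rule LIMSEQ_le_const2[OF val_tendsto], intro exI allI impI)
  fix l assume "k \<le> l"
  then have "prefix_val b a l + real b / real b ^ l \<le> prefix_val b a k + real b / real b ^ k" using val_bounds(2)[of b k l a] a b by auto
  moreover have "0 \<le> real b / real b ^ l" by simp
  ultimately show "prefix_val b a l \<le> prefix_val b a k + real b / real b ^ k" by linarith
qed

text \<open>A nonzero digit keeps the sum away from the lower end of its interval of level
  \<open>k\<close>, and a digit other than \<open>b - 1\<close> keeps it away from the upper end,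
  each by at least \<open>b / b ^ l\<close>. The window is too short to reach another
  interval.\<close>

lemma near_digits_sum_unique:
  assumes kl: "k \<le> c" "c < l" "a c \<noteq> 0" "k \<le> c'" "c' < l" "a c' \<noteq> b - 1"
    and a': "\<And>c. c < k \<Longrightarrow> a' c < b"
    and r: "r < real b / real b ^ l"
    and near: "digit_ivl b a' k \<inter> {s - r..s + r} \<noteq> {}"
    and "i < k"
  shows "a' i = a i"
proof -
  let ?w = "\<lambda>k. real b / real b ^ k"
  have b0: "0 < b" using b by simp
  have pow: "?w l \<le> 1 / real b ^ c" if "c < l" for c
  proof -
    have "real b ^ Suc c \<le> real b ^ l" using that b by (intro power_increasing) auto
    then have "?w l \<le> ?w (Suc c)" using b by (intro divide_left_mono) auto
    then show ?thesis using b by simp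
  qed
  have low: "prefix_val b a k + ?w l \<le> s"
  proof -
    have "prefix_val b a k + 1 / real b ^ c \<le> prefix_val b a c + a c / real b ^ c"
      using val_bounds(1)[of b k c a] kl a b by (intro add_mono divide_right_mono) auto
    also have "\<dots> \<le> s" using val_le_digits_sum[of "Suc c"] b by (simp add: val_Suc)
    finally show ?thesis using pow[OF kl(2)] by linarith
  qed
  have high: "s \<le> prefix_val b a k + ?w k - ?w l"
  proof -
    have "real (a c') + 2 \<le> b" using kl(6) a[of c'] by linarith
    then have *: "(a c' + 2) / real b ^ c' \<le> real b / real b ^ c'" by (intro divide_right_mono) auto
    have "s \<le> prefix_val b a c' + a c' / real b ^ c' + 1 / real b ^ c'" using digits_sum_le_val[of "Suc c'"] b by (simp add: val_Suc)
    moreover have "prefix_val b a c' + ?w c' \<le> prefix_val b a k + ?w k" using val_bounds(2)[of b k c' a] kl a b by auto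
    ultimately show ?thesis using pow[OF kl(5)] * by (simp add: add_divide_distrib)
  qed
  from near obtain y where "y \<in> digit_ivl b a' k \<inter> {s - r..s + r}" by blast
  then have y: "prefix_val b a' k \<le> y" "y \<le> prefix_val b a' k + ?w k" "s - r \<le> y" "y \<le> s + r"
    by (simp_all add: digit_ivl_def)
  have "prefix_num b a' k = prefix_num b a k"
  proof (rule ccontr)
    assume "prefix_num b a' k \<noteq> prefix_num b a k"
    then consider "prefix_num b a' k + 1 \<le> prefix_num b a k" | "prefix_num b a k + 1 \<le> prefix_num b a' k" by linarith
    then show False
    proof cases
      case 1
      then have "(real (prefix_num b a' k) + 1) * ?w k \<le> real (prefix_num b a k) * ?w k" by (intro mult_right_mono) auto
      then have "prefix_val b a' k + ?w k \<le> prefix_val b a k" unfolding prefix_val_def distrib_right mult_1 .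
      then show False using y low r by linarith
    next
      case 2
      then have "(real (prefix_num b a k) + 1) * ?w k \<le> real (prefix_num b a' k) * ?w k" by (intro mult_right_mono) auto
      then have "prefix_val b a k + ?w k \<le> prefix_val b a' k" unfolding prefix_val_def distrib_right mult_1 .
      then show False using y high r by linarith
    qed
  qed
  then show ?thesis using num_inj[of k a' b a i] a' a assms(10) by auto
qed

end

lemma vimage_borel: "f \<in> borel_measurable borel \<Longrightarrow> A \<in> sets borel \<Longrightarrow> f -` A \<in> sets borel"
  using measurable_sets[of f borel borel A] by simp

section \<open>Approximate squares of a carpet and their weights\<close>

context digit_carpet
begin

definition lev :: "nat \<Rightarrow> nat" where "lev k = nat \<lfloor>\<sigma> * k\<rfloor>"

lemma lev_bounds: "real (lev k) \<le> \<sigma> * k" "\<sigma> * k < real (lev k) + 1"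
  using sigma_bounds by (auto simp: lev_def intro: of_nat_floor)

lemma lev_le: "lev k \<le> k"
proof -
  have "\<sigma> * k \<le> 1 * real k" using sigma_bounds by (intro mult_right_mono) auto
  then show ?thesis using lev_bounds[of k] by linarith
qed

lemma lev_mono: "k \<le> l \<Longrightarrow> lev k \<le> lev l"
  unfolding lev_def using sigma_bounds by (intro nat_mono floor_mono mult_left_mono) auto

lemma ln_n_pos: "0 < ln (real n)" using n_ge_2 by simp

text \<open>Since \<open>m ^ k\<close> equals \<open>n powr (\<sigma> * k)\<close>, rounding the
  exponent down costs at most one factor \<open>n\<close>.\<close>

lemma powr_lev: "real n ^ lev k \<le> real m ^ k" "real m ^ k \<le> real n * real n ^ lev k"
proof -
  have eq: "real m ^ k = real n powr (\<sigma> * k)"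
  proof -
    have "\<sigma> * k * ln n = k * ln m" using ln_n_pos by (simp add: sigma_exp_def)
    then have "real n powr (\<sigma> * k) = real m powr k" using m_ge_2 n_ge_2 by (simp only: powr_def) simp
    then show ?thesis using m_ge_2 by (simp add: powr_realpow)
  qed
  show "real n ^ lev k \<le> real m ^ k"
    using lev_bounds(1)[of k] n_ge_2 by (simp add: eq powr_realpow[symmetric])
  have "real n powr (\<sigma> * k) \<le> real n powr (1 + real (lev k))"
    using lev_bounds(2)[of k] n_ge_2 by (intro powr_mono) auto
  then show "real m ^ k \<le> real n * real n ^ lev k"
    using n_ge_2 by (simp add: eq powr_realpow[symmetric] powr_add)
qed

definition Rect :: "nat \<Rightarrow> (nat \<Rightarrow> nat \<times> nat) \<Rightarrow> (real \<times> real) set" where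
  "Rect k u = digit_ivl n (snd \<circ> u) (lev k) \<times> digit_ivl m (fst \<circ> u) k"

definition sq_weight :: "(nat \<times> nat \<Rightarrow> real) \<Rightarrow> nat \<Rightarrow> (nat \<Rightarrow> nat \<times> nat) \<Rightarrow> real" where
  "sq_weight p k u = (\<Prod>c<k. if c < lev k then p (u c) else row_prob D p (fst (u c)))"

text \<open>Digit strings are total functions of which only an initial part is meaningful; \<open>valid\<close> restricts the part
  that determines the approximate square of level \<open>k\<close>, and \<open>codes k\<close> contains one representative of each such square,
  with dummy columns \<open>0\<close> beyond \<open>lev k\<close>.\<close>
definition valid :: "nat \<Rightarrow> (nat \<Rightarrow> nat \<times> nat) \<Rightarrow> bool" where
  "valid k u \<longleftrightarrow> (\<forall>c<lev k. u c \<in> D) \<and> (\<forall>c<k. fst (u c) \<in> R)"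

definition codes :: "nat \<Rightarrow> (nat \<Rightarrow> nat \<times> nat) set" where
  "codes k = PiE {..<k} (\<lambda>c. if c < lev k then D else (\<lambda>i. (i, 0)) ` R)"

definition code :: "nat \<Rightarrow> (nat \<Rightarrow> nat \<times> nat) \<Rightarrow> nat \<Rightarrow> nat \<times> nat" where
  "code k u = (\<lambda>c\<in>{..<k}. if c < lev k then u c else (fst (u c), 0))"

definition words :: "nat \<Rightarrow> (nat \<Rightarrow> nat \<times> nat) set" where
  "words k = PiE {..<k} (\<lambda>_. D)"

lemma finite_codes: "finite (codes k)" and finite_words: "finite (words k)"
  unfolding codes_def words_def using finite_D by (auto intro!: finite_PiE)

lemma validI: "(\<And>c. u c \<in> D) \<Longrightarrow> valid k u"
  by (auto simp: valid_def)

lemma valid_words: "w \<in> words k \<Longrightarrow> valid k w"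
  using lev_le[of k] by (auto simp: valid_def words_def PiE_iff)

lemma valid_codes: "u \<in> codes k \<Longrightarrow> valid k u"
proof -
  assume u: "u \<in> codes k"
  have u': "u c \<in> (if c < lev k then D else (\<lambda>i. (i, 0)) ` R)" if "c < k" for c
    using u that by (auto simp: codes_def PiE_iff)
  have "u c \<in> D" if "c < lev k" for c
    using u'[of c] that lev_le[of k] by simp
  moreover have "fst (u c) \<in> R" if "c < k" for c
    using u'[OF that] by (force split: if_splits)
  ultimately show ?thesis by (auto simp: valid_def)
qed

lemma valid_antimono: "valid l u \<Longrightarrow> k \<le> l \<Longrightarrow> valid k u"
  using lev_mono[of k l] by (force simp: valid_def)

lemma row_less: "i \<in> R \<Longrightarrow> i < m"
  using fst_less by auto

lemma valid_digits: "valid k u \<Longrightarrow> c < k \<Longrightarrow> fst (u c) < m" "valid k u \<Longrightarrow> c < lev k \<Longrightarrow> snd (u c) < n"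
  unfolding valid_def using row_less snd_less by blast+

lemma code_in_codes: "valid k u \<Longrightarrow> code k u \<in> codes k"
  unfolding valid_def codes_def code_def by (rule restrict_PiE_iff[THEN iffD2]) auto

lemma Rect_cong:
  assumes "\<And>c. c < lev k \<Longrightarrow> snd (u c) = snd (v c)" "\<And>c. c < k \<Longrightarrow> fst (u c) = fst (v c)"
  shows "Rect k u = Rect k v"
  unfolding Rect_def using ivl_cong[of "lev k" "snd \<circ> u" "snd \<circ> v"] ivl_cong[of k "fst \<circ> u" "fst \<circ> v"] assms by simp

lemma Rect_code: "Rect k (code k u) = Rect k u"
  using lev_le[of k] by (intro Rect_cong) (auto simp: code_def)

lemma sq_weight_code: "sq_weight p k (code k u) = sq_weight p k u"
  unfolding sq_weight_def by (intro prod.cong) (auto simp: code_def)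

lemma Rect_antimono: "valid l u \<Longrightarrow> k \<le> l \<Longrightarrow> Rect l u \<subseteq> Rect k u"
  unfolding Rect_def using valid_digits[of l u] lev_mono[of k l] m_ge_2 n_ge_2
  by (intro Sigma_mono ivl_antimono) auto

definition cmap :: "(nat \<Rightarrow> nat \<times> nat) \<Rightarrow> nat \<Rightarrow> real \<times> real \<Rightarrow> real \<times> real" where
  "cmap w k = (\<lambda>(x, y). (prefix_val n (snd \<circ> w) k + x / real n ^ k, prefix_val m (fst \<circ> w) k + y / real m ^ k))"

lemma cmap_0: "cmap w 0 = id"
  by (auto simp: cmap_def prefix_val_def fun_eq_iff)

lemma cmap_Suc: "cmap w (Suc k) = cmap w k \<circ> carpet_map m n (w k)"
proof -
  have "0 < m" "0 < n" using m_ge_2 n_ge_2 by auto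
  then show ?thesis
    by (auto simp: cmap_def carpet_map_def val_Suc fun_eq_iff add_divide_distrib mult.commute split: prod.splits)
qed

lemma cmap_cong: "(\<And>c. c < k \<Longrightarrow> w c = w' c) \<Longrightarrow> cmap w k = cmap w' k"
  using num_cong[of k "fst \<circ> w" "fst \<circ> w'"] num_cong[of k "snd \<circ> w" "snd \<circ> w'"]
  by (simp add: cmap_def prefix_val_def)

text \<open>The cell of level 0; every carpet map sends it into itself.\<close>

definition box :: "(real \<times> real) set" where "box = {0..real n} \<times> {0..real m}"

lemma cmap_in_Rect:
  assumes w: "\<And>c. c < k \<Longrightarrow> w c \<in> D" and z: "z \<in> box"
  shows "cmap w k z \<in> Rect k w"
proof -
  obtain x y where xy: "z = (x, y)" "0 \<le> x" "x \<le> n" "0 \<le> y" "y \<le> m" using z by (auto simp: box_def)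
  have "prefix_val n (snd \<circ> w) k + x / real n ^ k \<in> digit_ivl n (snd \<circ> w) k" "prefix_val m (fst \<circ> w) k + y / real m ^ k \<in> digit_ivl m (fst \<circ> w) k"
    using xy by (auto simp: digit_ivl_def divide_right_mono)
  moreover have "digit_ivl n (snd \<circ> w) k \<subseteq> digit_ivl n (snd \<circ> w) (lev k)"
    using lev_le[of k] w snd_less n_ge_2 by (intro ivl_antimono) auto
  ultimately show ?thesis by (auto simp: cmap_def Rect_def xy)
qed

lemma carpet_map_measurable[measurable]: "carpet_map m n d \<in> borel_measurable borel"
  using m_ge_2 n_ge_2
  by (cases d) (auto simp: carpet_map_def split_beta intro!: borel_measurable_continuous_onI continuous_intros)

lemma cmap_measurable[measurable]: "cmap w k \<in> borel_measurable borel"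
  using m_ge_2 n_ge_2
  by (auto simp: cmap_def split_beta intro!: borel_measurable_continuous_onI continuous_intros)

lemma row_prob_eq: "row_prob D p i = (\<Sum>d\<in>{d\<in>D. fst d = i}. p d)"
  unfolding row_prob_def by (rule sum.reindex_bij_witness[of _ snd "\<lambda>j. (i, j)"]) auto

text \<open>The words with a given code differ only in the columns at the late places. Summing these
  columns within their rows turns \<open>p\<close> into \<open>row_prob\<close>.\<close>

lemma sum_fibre:
  assumes u: "u \<in> codes k"
  shows "(\<Sum>w\<in>{w\<in>words k. code k w = u}. \<Prod>c<k. p (w c)) = sq_weight p k u"
proof -
  have "{w\<in>words k. code k w = u} =
    PiE {..<k} (\<lambda>c. if c < lev k then {u c} else {d\<in>D. fst d = fst (u c)})" (is "?F = PiE _ ?B")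
  proof (intro equalityI subsetI)
    fix w assume "w \<in> ?F"
    then show "w \<in> PiE {..<k} ?B"
      by (auto simp: words_def code_def PiE_iff restrict_def)
  next
    fix w assume w: "w \<in> PiE {..<k} ?B"
    have "w c \<in> D" if "c < k" for c
    proof -
      have "w c \<in> ?B c" using w that by (simp add: PiE_iff)
      then show ?thesis using valid_codes[OF u] by (cases "c < lev k") (auto simp: valid_def)
    qed
    then have "w \<in> words k" using w by (auto simp: words_def PiE_iff)
    moreover have "code k w = u"
    proof
      fix c
      show "code k w c = u c"
      proof (cases "c < k")
        case True
        then have "w c \<in> ?B c" "u c \<in> (if c < lev k then D else (\<lambda>i. (i, 0)) ` R)"
          using w u by (auto simp: PiE_iff codes_def)
        then show ?thesis using True by (auto simp: code_def split: if_splits)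
      next
        case False
        then show ?thesis using u by (auto simp: code_def codes_def PiE_iff extensional_def)
      qed
    qed
    ultimately show "w \<in> ?F" by simp
  qed
  then have "(\<Sum>w\<in>?F. \<Prod>c<k. p (w c)) = (\<Prod>c<k. \<Sum>d\<in>?B c. p d)"
    using finite_D by (simp add: prod_sum_PiE)
  also have "\<dots> = sq_weight p k u"
    unfolding sq_weight_def by (intro prod.cong) (auto simp: row_prob_eq)
  finally show ?thesis .
qed

lemma sum_words_codes:
  "(\<Sum>w\<in>words k. (\<Prod>c<k. p (w c)) * f (code k w)) = (\<Sum>u\<in>codes k. sq_weight p k u * f u)"
proof -
  have "(\<Sum>w\<in>words k. (\<Prod>c<k. p (w c)) * f (code k w)) =
     (\<Sum>u\<in>codes k. \<Sum>w\<in>{w\<in>words k. code k w = u}. (\<Prod>c<k. p (w c)) * f (code k w))"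
    by (rule sum.group[symmetric]) (auto simp: finite_codes finite_words intro: code_in_codes valid_words)
  also have "\<dots> = (\<Sum>u\<in>codes k. (\<Sum>w\<in>{w\<in>words k. code k w = u}. (\<Prod>c<k. p (w c))) * f u)"
    by (simp add: sum_distrib_right)
  finally show ?thesis by (simp add: sum_fibre)
qed

text \<open>A code is determined by the grid indices of its row and column intervals, and the window
  meets at most two consecutive indices in each coordinate.\<close>

lemma near_codes_card:
  assumes r: "4 * r \<le> 1 / real m ^ k" "0 \<le> r"
  shows "card {u\<in>codes k. Rect k u \<inter> cball z r \<noteq> {}} \<le> 4"
proof -
  let ?S = "{u\<in>codes k. Rect k u \<inter> cball z r \<noteq> {}}"
  let ?f = "\<lambda>u. (prefix_num m (fst \<circ> u) k, prefix_num n (snd \<circ> u) (lev k))"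
  obtain x y where z: "z = (x, y)" by force
  have near: "digit_ivl n (snd \<circ> u) (lev k) \<inter> {x - r..x + r} \<noteq> {}" "digit_ivl m (fst \<circ> u) k \<inter> {y - r..y + r} \<noteq> {}"
    if "Rect k u \<inter> cball z r \<noteq> {}" for u
  proof -
    obtain x' y' where xy: "(x', y') \<in> Rect k u" "dist (x, y) (x', y') \<le> r"
      using \<open>Rect k u \<inter> cball z r \<noteq> {}\<close> by (auto simp: z)
    have "dist x x' \<le> r" "dist y y' \<le> r"
      using dist_fst_le[of "(x, y)" "(x', y')"] dist_snd_le[of "(x, y)" "(x', y')"] xy by auto
    then have "x' \<in> digit_ivl n (snd \<circ> u) (lev k) \<inter> {x - r..x + r}" "y' \<in> digit_ivl m (fst \<circ> u) k \<inter> {y - r..y + r}"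
      using xy by (auto simp: Rect_def dist_real_def)
    then show "digit_ivl n (snd \<circ> u) (lev k) \<inter> {x - r..x + r} \<noteq> {}" "digit_ivl m (fst \<circ> u) k \<inter> {y - r..y + r} \<noteq> {}" by blast+
  qed
  have rm: "2 * r < real m / real m ^ k"
  proof -
    have "2 * r \<le> (1 / real m ^ k) / 2" using r by simp
    also have "\<dots> < 2 / real m ^ k" using m_ge_2 by (simp add: field_simps)
    also have "\<dots> \<le> real m / real m ^ k" using m_ge_2 by (intro divide_right_mono) auto
    finally show ?thesis .
  qed
  have rn: "2 * r < real n / real n ^ lev k"
  proof -
    have "real m / real m ^ k \<le> real n / real n ^ lev k"
      using powr_lev(1)[of k] m_less_n n_ge_2 by (intro frac_le) auto
    then show ?thesis using rm by simp
  qed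
  have inj: "inj_on ?f ?S"
  proof (rule inj_onI)
    fix u v assume u: "u \<in> ?S" and v: "v \<in> ?S" and eq: "?f u = ?f v"
    have vu: "valid k u" "valid k v" using u v valid_codes by auto
    have 1: "fst (u c) = fst (v c)" if "c < k" for c
      using num_inj[of k "fst \<circ> u" m "fst \<circ> v" c] eq that valid_digits(1)[OF vu(1)] valid_digits(1)[OF vu(2)] by auto
    have 2: "snd (u c) = snd (v c)" if "c < lev k" for c
      using num_inj[of "lev k" "snd \<circ> u" n "snd \<circ> v" c] eq that valid_digits(2)[OF vu(1)] valid_digits(2)[OF vu(2)] by auto
    have "u c = v c" for c
    proof (cases "c < k")
      case True
      then have "u c \<in> (if c < lev k then D else (\<lambda>i. (i, 0)) ` R)" "v c \<in> (if c < lev k then D else (\<lambda>i. (i, 0)) ` R)"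
        using u v by (auto simp: codes_def PiE_iff)
      then show ?thesis using 1[OF True] 2[of c] by (cases "c < lev k") (auto simp: prod_eq_iff)
    next
      case False
      then show ?thesis using u v by (auto simp: codes_def PiE_iff extensional_def)
    qed
    then show "u = v" by blast
  qed
  let ?A = "(\<lambda>u. prefix_num m (fst \<circ> u) k) ` ?S" and ?B = "(\<lambda>u. prefix_num n (snd \<circ> u) (lev k)) ` ?S"
  have A: "finite ?A" "card ?A \<le> 2"
    using near_num_le[OF near(2) near(2) rm] by (intro card_le_2_if_gaps; force)+
  have B: "finite ?B" "card ?B \<le> 2"
    using near_num_le[OF near(1) near(1) rn] by (intro card_le_2_if_gaps; force)+
  have "card ?S = card (?f ` ?S)" using inj by (simp add: card_image)
  also have "\<dots> \<le> card (?A \<times> ?B)" using A B by (intro card_mono finite_cartesian_product) auto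
  also have "\<dots> = card ?A * card ?B" by (rule card_cartesian_product)
  also have "\<dots> \<le> 2 * 2" using A B by (intro mult_le_mono) auto
  finally show ?thesis by simp
qed

text \<open>The square of \<open>n\<close> arises from the width \<open>n / n ^ lev k\<close>, since
  the rounding in \<open>lev\<close> costs one more factor \<open>n\<close>.\<close>

lemma Rect_dist:
  assumes "z \<in> Rect k u" "w \<in> Rect k u"
  shows "dist z w \<le> (real n ^ 2 + m) / real m ^ k"
proof -
  have "dist (fst z) (fst w) \<le> real n / real n ^ lev k" "dist (snd z) (snd w) \<le> real m / real m ^ k"
    using assms by (auto simp: Rect_def digit_ivl_def dist_real_def)
  moreover have "real n / real n ^ lev k \<le> real n ^ 2 / real m ^ k"
    using powr_lev(2)[of k] m_ge_2 n_ge_2 by (simp add: field_simps power2_eq_square)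
  moreover have "dist z w \<le> dist (fst z) (fst w) + dist (snd z) (snd w)"
    by (simp add: dist_prod_def sqrt_sum_squares_le_sum)
  ultimately show ?thesis by (simp add: add_divide_distrib)
qed

end

section \<open>Self-affine measures compared with weights of squares\<close>

context weighted_carpet
begin

lemma sq_weight_pos: "valid k u \<Longrightarrow> 0 < sq_weight p k u"
  unfolding sq_weight_def valid_def using p_pos row_prob_pos by (intro prod_pos) auto

text \<open>A further level adds one factor at most 1 and may refine an earlier row factor to the
  smaller digit factor.\<close>

lemma sq_weight_Suc_le:
  assumes v: "valid (Suc k) u"
  shows "sq_weight p (Suc k) u \<le> sq_weight p k u"
proof -
  let ?f = "\<lambda>k c. if c < lev k then p (u c) else q (fst (u c))"
  have f: "0 \<le> ?f (Suc k) c \<and> ?f (Suc k) c \<le> ?f k c" if "c < k" for c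
    using v that p_pos row_prob_pos p_le_row_prob lev_mono[of k "Suc k"]
    by (auto simp: valid_def less_imp_le)
  have last: "?f (Suc k) k \<le> 1" "0 \<le> ?f (Suc k) k"
    using v p_le_1 row_prob_le_1 p_pos row_prob_pos by (auto simp: valid_def less_imp_le)
  have "sq_weight p (Suc k) u = (\<Prod>c<k. ?f (Suc k) c) * ?f (Suc k) k"
    by (simp add: sq_weight_def)
  also have "\<dots> \<le> (\<Prod>c<k. ?f (Suc k) c) * 1"
    using f last by (intro mult_left_mono prod_nonneg) auto
  also have "\<dots> \<le> sq_weight p k u"
    unfolding sq_weight_def mult_1_right using f by (intro prod_mono) auto
  finally show ?thesis .
qed

lemma sum_prod_words: "(\<Sum>w\<in>words k. \<Prod>c<k. p (w c)) = 1"
  using prod_sum_PiE[of "{..<k}" "\<lambda>_. D" "\<lambda>_. p"] finite_D p_sum by (simp add: words_def)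

lemma sum_sq_weight: "(\<Sum>u\<in>codes k. sq_weight p k u) = 1"
  using sum_words_codes[where k = k and p = p and f = "\<lambda>_. 1"] sum_prod_words by simp

context
  fixes \<mu> :: "(real \<times> real) measure"
  assumes \<mu>: "is_self_affine_measure m n D p \<mu>"
begin

lemma prob_mu: "prob_space \<mu>" and sets_mu: "sets \<mu> = sets borel"
  using \<mu> by (auto simp: is_self_affine_measure_def)

interpretation prob_space \<mu> by (rule prob_mu)

lemma space_mu: "space \<mu> = UNIV"
  using sets_eq_imp_space_eq[OF sets_mu] by simp

lemma measure_step: "A \<in> sets borel \<Longrightarrow> measure \<mu> A = (\<Sum>d\<in>D. p d * measure \<mu> (carpet_map m n d -` A))"
  using \<mu> by (auto simp: is_self_affine_measure_def)

lemma measure_iterate: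
  assumes A: "A \<in> sets borel"
  shows "measure \<mu> A = (\<Sum>w\<in>words k. (\<Prod>c<k. p (w c)) * measure \<mu> (cmap w k -` A))"
proof (induction k)
  case 0
  then show ?case by (simp add: words_def cmap_0)
next
  case (Suc k)
  have "(\<Sum>w\<in>words (Suc k). (\<Prod>c<Suc k. p (w c)) * measure \<mu> (cmap w (Suc k) -` A)) =
    (\<Sum>(d, w)\<in>D \<times> words k. (\<Prod>c<Suc k. p ((w(k := d)) c)) * measure \<mu> (cmap (w(k := d)) (Suc k) -` A))"
  proof -
    have eq: "words (Suc k) = (\<lambda>(d, w). w(k := d)) ` (D \<times> words k)"
      unfolding words_def lessThan_Suc by (rule PiE_insert_eq)
    have inj: "inj_on (\<lambda>(d, w). w(k := d)) (D \<times> words k)"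
      unfolding words_def by (rule inj_combinator) simp
    show ?thesis unfolding eq by (subst sum.reindex[OF inj]) (simp add: comp_def split_def)
  qed
  also have "\<dots> = (\<Sum>(d, w)\<in>D \<times> words k. (\<Prod>c<k. p (w c)) * (p d * measure \<mu> (carpet_map m n d -` (cmap w k -` A))))"
  proof (intro sum.cong refl, clarify)
    fix d1 d2 w
    have "(\<Prod>c<k. p ((w(k := (d1, d2))) c)) = (\<Prod>c<k. p (w c))" by (intro prod.cong) auto
    moreover have "cmap (w(k := (d1, d2))) k = cmap w k" by (intro cmap_cong) auto
    ultimately show "(\<Prod>c<Suc k. p ((w(k := (d1, d2))) c)) * measure \<mu> (cmap (w(k := (d1, d2))) (Suc k) -` A) =
      (\<Prod>c<k. p (w c)) * (p (d1, d2) * measure \<mu> (carpet_map m n (d1, d2) -` (cmap w k -` A)))"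
      by (simp add: cmap_Suc vimage_comp del: fun_upd_apply) simp
  qed
  also have "\<dots> = (\<Sum>w\<in>words k. (\<Prod>c<k. p (w c)) * (\<Sum>d\<in>D. p d * measure \<mu> (carpet_map m n d -` (cmap w k -` A))))"
    by (subst sum.cartesian_product[symmetric], subst sum.swap) (simp add: sum_distrib_left)
  also have "\<dots> = (\<Sum>w\<in>words k. (\<Prod>c<k. p (w c)) * measure \<mu> (cmap w k -` A))"
    using measure_step[OF vimage_borel[OF cmap_measurable A]] by simp
  finally show ?case using Suc by simp
qed

text \<open>The carpet maps send the box enlarged by \<open>2 * e\<close> into the box enlarged by
  \<open>e\<close>, so by self-affinity doubling the enlargement does not increase the measure. The
  doublings exhaust the plane, hence every enlargement has full measure.\<close>

lemma AE_box: "AE z in \<mu>. z \<in> box"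
proof -
  define E where "E e = {- e..n + e} \<times> {- e..m + e :: real}" for e :: real
  have E_sets[measurable]: "E e \<in> sets borel" for e
    by (simp add: E_def borel_prod[symmetric])
  have step: "measure \<mu> (E (2 * e)) \<le> measure \<mu> (E e)" if e: "0 \<le> e" for e
  proof -
    have sub: "E (2 * e) \<subseteq> carpet_map m n d -` E e" if d: "d \<in> D" for d
    proof
      fix z assume z: "z \<in> E (2 * e)"
      obtain x y where xy: "z = (x, y)" by force
      have aux: "- e \<le> x / b + i \<and> x / b + i \<le> b + e"
        if "2 \<le> b" "i < b" "- (2 * e) \<le> x" "x \<le> b + 2 * e" for b i :: nat and x :: real
      proof -
        have 1: "2 * e / b \<le> e" using that e mult_right_mono[of 2 "real b" e] by (simp add: pos_divide_le_eq mult.commute)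
        have "- (2 * e) / b \<le> x / b" "x / b \<le> (b + 2 * e) / b" using that by (intro divide_right_mono; simp)+
        moreover have "(b + 2 * e) / b = 1 + 2 * e / b" using that by (simp add: add_divide_distrib)
        moreover have "real i + 1 \<le> b" using that by linarith
        moreover have "- (2 * e) / b = - (2 * e / b)" by simp
        ultimately show ?thesis using 1 by linarith
      qed
      have "fst d < m" "snd d < n" using d fst_less snd_less by auto
      then show "z \<in> carpet_map m n d -` E e"
        using z aux[of n "snd d" x] aux[of m "fst d" y] m_ge_2 n_ge_2
        by (auto simp: xy E_def carpet_map_def split: prod.splits)
    qed
    have "measure \<mu> (E (2 * e)) = (\<Sum>d\<in>D. p d * measure \<mu> (E (2 * e)))"
      by (simp add: sum_distrib_right[symmetric] p_sum)
    also have "\<dots> \<le> (\<Sum>d\<in>D. p d * measure \<mu> (carpet_map m n d -` E e))"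
      using p_pos sub vimage_borel[OF carpet_map_measurable E_sets]
      by (intro sum_mono mult_left_mono finite_measure_mono) (auto simp: sets_mu less_imp_le)
    also have "\<dots> = measure \<mu> (E e)" using measure_step[OF E_sets] by simp
    finally show ?thesis .
  qed
  have full: "measure \<mu> (E e) = 1" if e: "0 < e" for e
  proof (rule antisym)
    have le: "measure \<mu> (E (2 ^ k * e)) \<le> measure \<mu> (E e)" for k
    proof (induction k)
      case (Suc k)
      then show ?case using step[of "2 ^ k * e"] e by (simp add: mult_ac)
    qed simp
    have mono: "E e1 \<subseteq> E e2" if "e1 \<le> e2" for e1 e2
      using that by (auto simp: E_def)
    have "incseq (\<lambda>k. E (2 ^ k * e))"
      using e by (intro incseq_SucI mono) simp
    then have "(\<lambda>k. measure \<mu> (E (2 ^ k * e))) \<longlonglongrightarrow> measure \<mu> (\<Union>k. E (2 ^ k * e))"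
      by (intro finite_Lim_measure_incseq) (auto simp: sets_mu)
    moreover have "(\<Union>k. E (2 ^ k * e)) = space \<mu>"
    proof -
      have "\<exists>k. z \<in> E (2 ^ k * e)" for z
      proof -
        obtain k where "(\<bar>fst z\<bar> + \<bar>snd z\<bar>) / e < 2 ^ k" using real_arch_pow[of 2 "(\<bar>fst z\<bar> + \<bar>snd z\<bar>) / e"] by auto
        then have "\<bar>fst z\<bar> + \<bar>snd z\<bar> < 2 ^ k * e" using e by (simp add: pos_divide_less_eq)
        then show ?thesis by (intro exI[of _ k]) (auto simp: E_def mem_Times_iff)
      qed
      then show ?thesis by (auto simp: space_mu)
    qed
    ultimately have "(\<lambda>k. measure \<mu> (E (2 ^ k * e))) \<longlonglongrightarrow> 1" using prob_space by simp
    then show "1 \<le> measure \<mu> (E e)" by (rule LIMSEQ_le_const2) (use le in auto)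
  qed simp
  have "AE z in \<mu>. \<forall>i::nat. z \<in> E (1 / Suc i)"
    unfolding AE_all_countable
    using full by (intro allI AE_prob_1) auto
  then show ?thesis
  proof eventually_elim
    case (elim z)
    have lim: "(\<lambda>i. 1 / real (Suc i)) \<longlonglongrightarrow> 0" using LIMSEQ_inverse_real_of_nat by (simp add: inverse_eq_divide)
    have *: "a \<le> c" if "\<And>i. a \<le> c + 1 / real (Suc i)" for a c :: real
      using LIMSEQ_le_const[OF tendsto_add[OF tendsto_const lim, of c], of a] that by auto
    have bound: "fst z \<le> n + 1 / real (Suc i)" "snd z \<le> m + 1 / real (Suc i)"
      "- fst z \<le> 0 + 1 / real (Suc i)" "- snd z \<le> 0 + 1 / real (Suc i)" for i
    proof -
      have "z \<in> E (1 / real (Suc i))" using elim by blast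
      then have "- (1 / real (Suc i)) \<le> fst z" "fst z \<le> n + 1 / real (Suc i)"
        "- (1 / real (Suc i)) \<le> snd z" "snd z \<le> m + 1 / real (Suc i)"
        unfolding E_def mem_Times_iff atLeastAtMost_iff by blast+
      then show "fst z \<le> n + 1 / real (Suc i)" "snd z \<le> m + 1 / real (Suc i)"
        "- fst z \<le> 0 + 1 / real (Suc i)" "- snd z \<le> 0 + 1 / real (Suc i)" by linarith+
    qed
    have "fst z \<le> n" "snd z \<le> m" "- fst z \<le> 0" "- snd z \<le> 0"
      using *[OF bound(1)] *[OF bound(2)] *[OF bound(3)] *[OF bound(4)] by blast+
    then show ?case by (auto simp: box_def mem_Times_iff)
  qed
qed

text \<open>After \<open>k\<close> iterations a word whose rectangle misses \<open>A\<close>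
  contributes nothing, because its map sends almost every point into that rectangle. Grouping the
  words by code turns products of \<open>p\<close> into square weights.\<close>

lemma measure_le_codes:
  assumes A: "A \<in> sets borel"
  shows "measure \<mu> A \<le> (\<Sum>u\<in>codes k. if Rect k u \<inter> A \<noteq> {} then sq_weight p k u else 0)"
proof -
  have "measure \<mu> (cmap w k -` A) \<le> (if Rect k (code k w) \<inter> A \<noteq> {} then 1 else 0)" if w: "w \<in> words k" for w
  proof (cases "Rect k w \<inter> A = {}")
    case True
    have "AE z in \<mu>. z \<notin> cmap w k -` A"
      using AE_box
    proof eventually_elim
      case (elim z)
      then have "cmap w k z \<in> Rect k w" using w by (intro cmap_in_Rect) (auto simp: words_def)
      then show ?case using True by auto
    qed
    then have "measure \<mu> (cmap w k -` A) = 0"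
      using vimage_borel[OF cmap_measurable A] by (subst prob_eq_0) (auto simp: sets_mu)
    then show ?thesis by simp
  qed (simp add: Rect_code)
  moreover have "0 \<le> (\<Prod>c<k. p (w c))" if "w \<in> words k" for w
    using that p_pos by (intro prod_nonneg) (auto simp: words_def less_imp_le PiE_iff)
  ultimately have "measure \<mu> A \<le> (\<Sum>w\<in>words k. (\<Prod>c<k. p (w c)) * (if Rect k (code k w) \<inter> A \<noteq> {} then 1 else 0))"
    unfolding measure_iterate[OF A, of k] by (intro sum_mono mult_left_mono)
  also have "\<dots> = (\<Sum>u\<in>codes k. sq_weight p k u * (if Rect k u \<inter> A \<noteq> {} then 1 else 0))"
    by (rule sum_words_codes)
  also have "\<dots> = (\<Sum>u\<in>codes k. if Rect k u \<inter> A \<noteq> {} then sq_weight p k u else 0)"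
    by (intro sum.cong) auto
  finally show ?thesis .
qed

lemma sq_weight_le_measure:
  assumes A: "A \<in> sets borel" and u: "valid k u" "Rect k u \<subseteq> A"
  shows "sq_weight p k u \<le> measure \<mu> A"
proof -
  have 1: "1 \<le> measure \<mu> (cmap w k -` A)" if w: "w \<in> words k" "code k w = code k u" for w
  proof -
    have eq: "Rect k w = Rect k u" using w Rect_code by metis
    have "AE z in \<mu>. z \<in> cmap w k -` A"
      using AE_box by eventually_elim (use eq w u cmap_in_Rect[of k w] in \<open>auto simp: words_def PiE_iff\<close>)
    then show ?thesis
      using vimage_borel[OF cmap_measurable A] by (subst (asm) AE_in_set_eq_1) (auto simp: sets_mu)
  qed
  have nn: "0 \<le> (\<Prod>c<k. p (w c))" if "w \<in> words k" for w
    using that p_pos by (intro prod_nonneg) (auto simp: words_def less_imp_le PiE_iff)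
  have "sq_weight p k u = (\<Sum>w\<in>{w\<in>words k. code k w = code k u}. \<Prod>c<k. p (w c))"
    using sum_fibre[OF code_in_codes[OF u(1)]] by (simp add: sq_weight_code)
  also have "\<dots> \<le> (\<Sum>w\<in>{w\<in>words k. code k w = code k u}. (\<Prod>c<k. p (w c)) * measure \<mu> (cmap w k -` A))"
    using 1 nn by (intro sum_mono) (auto simp: mult_le_cancel_left1 not_less)
  also have "\<dots> \<le> measure \<mu> A"
    unfolding measure_iterate[OF A, of k] using nn finite_words
    by (intro sum_mono2) (auto intro!: mult_nonneg_nonneg)
  finally show ?thesis .
qed

end

end

section \<open>The upper bound\<close>

text \<open>Here \<open>H k w\<close> says that the row string \<open>w\<close> is heavy at level \<open>k\<close>. At a heavy level where \<open>S\<^sub>k / k\<close> almost attains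
  the limsup of the averages over heavy strings, the average at level \<open>l k\<close> is not essentially larger, even if
  \<open>w\<close> is light there: along a light stretch \<open>S\<close> is affine.\<close>
lemma heavy_oscillation:
  fixes g :: "nat \<Rightarrow> real" and H :: "nat \<Rightarrow> (nat \<Rightarrow> nat) \<Rightarrow> bool" and l :: "nat \<Rightarrow> nat"
  assumes \<sigma>: "0 < \<sigma>" "\<sigma> < 1" and B: "\<And>i. \<bar>g i\<bar> \<le> B"
    and l: "\<And>k. real (l k) \<le> \<sigma> * k" "\<And>k. \<sigma> * k < real (l k) + 1"
    and io: "\<And>K. \<exists>k\<ge>K. \<exists>w. H k w"
    and run: "\<And>k w a b. H k w \<Longrightarrow> K0 \<le> a \<Longrightarrow> b \<le> k \<Longrightarrow> (\<And>c. a < c \<Longrightarrow> c < b \<Longrightarrow> \<not> H c w) \<Longrightarrow>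
      \<exists>d. \<forall>c. a < c \<and> c < b \<longrightarrow> w c = d"
    and \<delta>: "0 < \<delta>"
  shows "\<exists>k\<ge>K. \<exists>w. H k w \<and> - \<delta> * k \<le> \<sigma> * (\<Sum>c<k. g (w c)) - (\<Sum>c<l k. g (w c))"
proof (rule ccontr)
  define S where "S w k = (\<Sum>c<k. g (w c))" for w :: "nat \<Rightarrow> nat" and k
  assume "\<not> ?thesis"
  then have neg: "\<sigma> * S w k - S w (l k) < - \<delta> * k" if "K \<le> k" "H k w" for k w
    using that unfolding S_def by force
  have S_le: "\<bar>S w k\<bar> \<le> B * k" for w k
    using sum_norm_bound[of "{..<k}" "\<lambda>c. g (w c)" B] B by (simp add: S_def mult.commute)
  have B0: "0 \<le> B" using B[of 0] by linarith
  \<comment> \<open>The eventual upper bounds for averages over heavy strings; their infimum is the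
    limsup.\<close>
  define X :: "real set" where "X = {x. \<exists>K'. \<forall>k\<ge>K'. \<forall>w. H k w \<longrightarrow> S w k \<le> x * real k}"
  have BX: "B \<in> X" using S_le by (auto simp: X_def abs_le_iff)
  have X_low: "- B \<le> x" if "x \<in> X" for x
  proof -
    from that obtain K' where K': "\<And>k w. K' \<le> k \<Longrightarrow> H k w \<Longrightarrow> S w k \<le> x * k" by (auto simp: X_def)
    obtain k w where k: "max K' 1 \<le> k" "H k w" using io by blast
    have "- B * k \<le> S w k" using S_le[of w k] by (simp add: abs_le_iff minus_le_iff)
    also have "S w k \<le> x * k" using K' k by auto
    finally have "- B * real k \<le> x * real k" .
    then show ?thesis using k by (simp only: mult_le_cancel_right)
  qed
  then have bdd: "bdd_below X" by (auto simp: bdd_below_def)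
  define G where "G = Inf X"
  define \<eta> where "\<eta> = \<delta> / 4"
  have \<eta>: "0 < \<eta>" using \<delta> by (simp add: \<eta>_def)
  define G' where "G' = G + \<eta>"
  have "\<exists>x\<in>X. x < G'"
    using cInf_lessD[of X G'] BX \<eta> by (auto simp: G_def G'_def)
  then obtain x K' where x: "x < G'" "\<And>k w. K' \<le> k \<Longrightarrow> H k w \<Longrightarrow> S w k \<le> x * k" by (auto simp: X_def)
  define K1 where "K1 = max K' (max K0 1)"
  have up: "S w k \<le> G' * k" if "K1 \<le> k" "H k w" for k w
  proof -
    have "S w k \<le> x * k" using x that by (auto simp: K1_def)
    also have "\<dots> \<le> G' * k" using x by (intro mult_right_mono) auto
    finally show ?thesis .
  qed
  have low: "\<exists>k\<ge>K'. \<exists>w. H k w \<and> (G - \<eta>) * k < S w k" for K'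
  proof -
    have "G - \<eta> \<notin> X" using cInf_lower[OF _ bdd, of "G - \<eta>"] \<eta> by (auto simp: G_def)
    then show ?thesis by (force simp: X_def not_le)
  qed
  define C where "C = B + \<bar>G'\<bar>"
  \<comment> \<open>\<open>C\<close> bounds an increment of \<open>V\<close> below. Up to
    \<open>K1\<close> of them precede the range where \<open>up\<close> holds, and one more is due
    to the place \<open>a\<close>, which \<open>run\<close> leaves free.\<close>
  define M where "M = C * (K1 + 1)"
  have C0: "0 \<le> C" using B0 by (simp add: C_def)
  define N where "N = max K (max (nat \<lceil>(K1 + 1) / \<sigma>\<rceil>) (nat \<lceil>2 * (\<bar>G'\<bar> + M) / \<delta>\<rceil> + 1))"
  obtain k w where k: "N \<le> k" "H k w" "(G - \<eta>) * k < S w k" using low by blast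
  define j where "j = l k"
  have kK: "K \<le> k" and k1: "(K1 + 1) / \<sigma> \<le> k" and k2: "2 * (\<bar>G'\<bar> + M) / \<delta> < k"
    using k(1) by (auto simp: N_def) linarith+
  have jK: "K1 \<le> j"
  proof -
    have "K1 + 1 \<le> \<sigma> * k" using k1 \<sigma> by (simp add: pos_divide_le_eq mult.commute)
    then show ?thesis using l(2)[of k] by (simp add: j_def)
  qed
  have jk: "j \<le> k"
  proof -
    have "\<sigma> * k \<le> 1 * real k" using \<sigma> by (intro mult_right_mono) auto
    then show ?thesis using l(1)[of k] by (simp add: j_def)
  qed
  \<comment> \<open>Relative to the line of slope \<open>G'\<close> every late heavy level is
    nonpositive. The aim is to bound \<open>V\<close> at the level \<open>j\<close>, which may be
    light.\<close>
  define V where "V c = S w c - G' * c" for c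
  have V_Suc: "V (Suc c) = V c + (g (w c) - G')" for c
    by (simp add: V_def S_def algebra_simps)
  have V_heavy: "V c \<le> 0" if "K1 \<le> c" "H c w" for c
    using up[OF that] by (simp add: V_def)
  have "V j \<le> M"
  proof (cases "H j w")
    case True
    then show ?thesis using V_heavy[OF jK] C0 by (simp add: M_def add_nonneg_nonneg mult_nonneg_nonneg order_trans)
  next
    case False
    define b where "b = (LEAST b. j \<le> b \<and> H b w)"
    have b: "j \<le> b" "H b w" "b \<le> k"
      using LeastI[of "\<lambda>b. j \<le> b \<and> H b w" k] Least_le[of "\<lambda>b. j \<le> b \<and> H b w" k] k(2) jk by (auto simp: b_def)
    have light1: "\<not> H c w" if "j \<le> c" "c < b" for c
      using not_less_Least[of c "\<lambda>b. j \<le> b \<and> H b w"] that by (auto simp: b_def)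
    \<comment> \<open>The light stretch around \<open>j\<close> starts at the last heavy level
      before it, or at \<open>K1\<close> if there is none, and ends at the next heavy level
      \<open>b\<close>.\<close>
    define A where "A = {a. K1 \<le> a \<and> a \<le> j \<and> (a = K1 \<or> H a w)}"
    define a where "a = Max A"
    have fA: "finite A" "A \<noteq> {}" using jK by (auto simp: A_def intro: finite_subset[of _ "{..j}"])
    have a: "K1 \<le> a" "a \<le> j" "a = K1 \<or> H a w"
      using Max_in[OF fA] by (auto simp: a_def A_def)
    have light2: "\<not> H c w" if "a < c" "c \<le> j" for c
    proof
      assume "H c w"
      then have "c \<in> A" using that a by (auto simp: A_def)
      then have "c \<le> a" using Max_ge[OF fA(1)] by (simp add: a_def)
      then show False using that by simp
    qed
    obtain d where d: "\<And>c. a < c \<Longrightarrow> c < b \<Longrightarrow> w c = d"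
      using run[OF k(2), of a b] a b light1 light2 by (metis K1_def le_trans max.cobounded1 max.cobounded2 nat_le_linear)
    have Va: "V a \<le> C * K1"
    proof (cases "H a w")
      case True
      then show ?thesis using V_heavy[OF a(1)] C0 by (meson mult_nonneg_nonneg of_nat_0_le_iff order_trans)
    next
      case False
      then have "a = K1" using a by simp
      have "V a \<le> B * a + \<bar>G'\<bar> * a"
        using S_le[of w a] mult_right_mono[OF abs_ge_minus_self[of G'], of "real a"] by (simp add: V_def abs_le_iff)
      then show ?thesis by (simp add: C_def \<open>a = K1\<close> algebra_simps)
    qed
    have "g (w a) - G' \<le> C" using B[of "w a"] by (auto simp: C_def abs_le_iff)
    then have Va1: "V (Suc a) \<le> M" using Va by (simp add: V_Suc M_def algebra_simps)
    have CM: "C * K1 \<le> M" using C0 by (simp add: M_def algebra_simps)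
    have lin: "V (Suc a + i) = V (Suc a) + i * (g d - G')" if "Suc a + i \<le> b" for i
      using that
    proof (induction i)
      case (Suc i)
      then have "w (Suc a + i) = d" by (intro d) auto
      then show ?case using Suc by (simp add: V_Suc algebra_simps)
    qed simp
    show ?thesis
    proof (cases "a = j")
      case True
      then show ?thesis using Va CM by simp
    next
      case False
      then have aj: "Suc a \<le> j" using a by simp
      have Vj: "V j = V (Suc a) + (real j - real (Suc a)) * (g d - G')"
        using lin[of "j - Suc a"] aj b by (simp add: of_nat_diff)
      have Vb: "V b = V (Suc a) + (real b - real (Suc a)) * (g d - G')"
        using lin[of "b - Suc a"] aj b by (simp add: of_nat_diff)
      \<comment> \<open>An affine function is bounded by its values at the ends: by the left end if
        it decreases, by the heavy right end if it increases.\<close>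
      show ?thesis
      proof (cases "g d - G' \<le> 0")
        case True
        then have "(real j - real (Suc a)) * (g d - G') \<le> 0"
          using aj by (intro mult_nonneg_nonpos) auto
        then show ?thesis using Vj Va1 by linarith
      next
        case False
        then have "(real j - real (Suc a)) * (g d - G') \<le> (real b - real (Suc a)) * (g d - G')"
          using b by (intro mult_right_mono) auto
        then have "V j \<le> V b" using Vj Vb by linarith
        also have "\<dots> \<le> 0" using b jK by (intro V_heavy) auto
        finally show ?thesis using C0 by (simp add: M_def add_nonneg_nonneg mult_nonneg_nonneg order_trans)
      qed
    qed
  qed
  then have Sj: "S w j \<le> M + G' * j" by (simp add: V_def)
  have "G' * j \<le> G' * (\<sigma> * k) + \<bar>G'\<bar>"
  proof -
    have "\<bar>real j - \<sigma> * k\<bar> \<le> 1" using l[of k] by (simp add: j_def)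
    then have "\<bar>G'\<bar> * \<bar>real j - \<sigma> * k\<bar> \<le> \<bar>G'\<bar> * 1" by (intro mult_left_mono) auto
    then have "\<bar>G' * (real j - \<sigma> * k)\<bar> \<le> \<bar>G'\<bar>" by (simp add: abs_mult)
    then show ?thesis by (simp add: abs_le_iff algebra_simps)
  qed
  moreover have "\<sigma> * S w k + \<delta> * k < S w j" using neg[OF kK k(2)] by (simp add: j_def)
  moreover have "\<sigma> * ((G - \<eta>) * k) \<le> \<sigma> * S w k" using k(3) \<sigma> by (intro mult_left_mono) auto
  ultimately have "\<sigma> * ((G - \<eta>) * k) + \<delta> * k < M + G' * (\<sigma> * k) + \<bar>G'\<bar>" using Sj by linarith
  \<comment> \<open>The choice of \<eta> makes \<open>G'\<close> and \<open>G - \<eta>\<close>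
    differ by \<delta>/2, too little to pay for the assumed gap \<delta>.\<close>
  then have "\<delta> * k < M + \<bar>G'\<bar> + \<sigma> * (\<delta> / 2) * k"
    by (simp add: G'_def \<eta>_def algebra_simps)
  moreover have "\<sigma> * (\<delta> / 2) * k \<le> 1 * (\<delta> / 2) * k" using \<sigma> \<delta> by (intro mult_right_mono) auto
  ultimately have "\<delta> / 2 * k < M + \<bar>G'\<bar>" by simp
  moreover have "2 * (\<bar>G'\<bar> + M) < \<delta> * k" using k2 \<delta> by (simp add: pos_divide_less_eq mult.commute)
  ultimately show False by simp
qed

section \<open>Coding the carpet, and strips near a point\<close>

context digit_carpet
begin

text \<open>Compactness gives extreme values of each coordinate. By invariance a maximum M satisfies
  M \<le> M/b + b - 1, hence M \<le> b; a minimum is treated in the same way.\<close>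

lemma carpet_in_box:
  assumes \<Lambda>: "is_carpet m n D \<Lambda>"
  shows "\<Lambda> \<subseteq> box"
proof -
  have comp: "compact \<Lambda>" "\<Lambda> \<noteq> {}" and inv: "(\<Union>d\<in>D. carpet_map m n d ` \<Lambda>) = \<Lambda>"
    using \<Lambda> by (auto simp: is_carpet_def)
  have coord: "0 \<le> f z \<and> f z \<le> b"
    if b: "2 \<le> b" and f: "continuous_on \<Lambda> f"
      and step: "\<And>d z. d \<in> D \<Longrightarrow> f (carpet_map m n d z) = f z / real b + real (e d)"
      and e: "\<And>d. d \<in> D \<Longrightarrow> e d < b" and z: "z \<in> \<Lambda>"
    for f :: "real \<times> real \<Rightarrow> real" and b :: nat and e z
  proof -
    obtain x where x: "x \<in> \<Lambda>" "\<And>y. y \<in> \<Lambda> \<Longrightarrow> f y \<le> f x"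
      using continuous_attains_sup[OF comp f] by blast
    obtain d y where dy: "d \<in> D" "y \<in> \<Lambda>" "x = carpet_map m n d y" using x(1) inv by blast
    have "f x \<le> f x / b + (b - 1)"
    proof -
      have "f x = f y / b + e d" using dy step by simp
      moreover have "f y / b \<le> f x / b" using x dy by (intro divide_right_mono) auto
      moreover have "real (e d) \<le> real b - 1" using e[OF dy(1)] by linarith
      ultimately show ?thesis by linarith
    qed
    then have "(real b - 1) * f x \<le> (real b - 1) * b" using b by (simp add: field_simps)
    then have fx: "f x \<le> b" using b by (simp add: mult_le_cancel_left)
    obtain x' where x': "x' \<in> \<Lambda>" "\<And>y. y \<in> \<Lambda> \<Longrightarrow> f x' \<le> f y"
      using continuous_attains_inf[OF comp f] by blast
    obtain d y where dy: "d \<in> D" "y \<in> \<Lambda>" "x' = carpet_map m n d y" using x'(1) inv by blast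
    have "f x' / b \<le> f x'"
    proof -
      have "f x' = f y / b + e d" using dy step by simp
      moreover have "f x' / b \<le> f y / b" using x' dy by (intro divide_right_mono) auto
      ultimately show ?thesis by linarith
    qed
    then have "0 \<le> (real b - 1) * f x'" using b by (simp add: field_simps)
    then have "0 \<le> f x'" using b by (simp add: zero_le_mult_iff)
    then show ?thesis using x(2)[OF z] x'(2)[OF z] fx by linarith
  qed
  show ?thesis
  proof
    fix z assume z: "z \<in> \<Lambda>"
    have "0 \<le> fst z \<and> fst z \<le> n"
      by (rule coord[of n fst snd]) (use n_ge_2 snd_less z in \<open>auto intro!: continuous_intros simp: carpet_map_def split: prod.split\<close>)
    moreover have "0 \<le> snd z \<and> snd z \<le> m"
      by (rule coord[of m snd fst]) (use m_ge_2 fst_less z in \<open>auto intro!: continuous_intros simp: carpet_map_def split: prod.split\<close>)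
    ultimately show "z \<in> box" by (auto simp: box_def mem_Times_iff)
  qed
qed

lemma carpet_coding:
  assumes \<Lambda>: "is_carpet m n D \<Lambda>" and x: "x \<in> \<Lambda>"
  shows "\<exists>\<omega>. (\<forall>c. \<omega> c \<in> D) \<and> (\<forall>k. x \<in> Rect k \<omega>)"
proof -
  have inv: "(\<Union>d\<in>D. carpet_map m n d ` \<Lambda>) = \<Lambda>"
    using \<Lambda> by (auto simp: is_carpet_def)
  have "\<exists>d y. d \<in> D \<and> y \<in> \<Lambda> \<and> z = carpet_map m n d y" if "z \<in> \<Lambda>" for z
    using inv that by blast
  then obtain dg nx where dn: "\<And>z. z \<in> \<Lambda> \<Longrightarrow> dg z \<in> D \<and> nx z \<in> \<Lambda> \<and> z = carpet_map m n (dg z) (nx z)"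
    by metis
  define X where "X k = (nx ^^ k) x" for k
  define \<omega> where "\<omega> k = dg (X k)" for k
  have X: "X k \<in> \<Lambda>" for k by (induction k) (use x dn in \<open>auto simp: X_def\<close>)
  have \<omega>: "\<omega> k \<in> D" for k using X dn by (simp add: \<omega>_def)
  have "x = cmap \<omega> k (X k)" for k
  proof (induction k)
    case (Suc k)
    have "X k = carpet_map m n (\<omega> k) (X (Suc k))" using dn[OF X[of k]] by (simp add: \<omega>_def X_def)
    then show ?case using Suc by (simp add: cmap_Suc)
  qed (simp add: cmap_0 X_def)
  then have "x \<in> Rect k \<omega>" for k
    using cmap_in_Rect[of k \<omega> "X k"] \<omega> X carpet_in_box[OF \<Lambda>] by auto
  then show ?thesis using \<omega> by blast
qed

lemma Rect_near_row:
  assumes "Rect k u \<inter> cball (x, y) r \<noteq> {}"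
  shows "digit_ivl m (fst \<circ> u) k \<inter> {y - r..y + r} \<noteq> {}"
proof -
  obtain x' y' where xy: "(x', y') \<in> Rect k u" "dist (x, y) (x', y') \<le> r"
    using assms by auto
  have "dist y y' \<le> r" using dist_snd_le[of "(x, y)" "(x', y')"] xy by auto
  then have "y' \<in> digit_ivl m (fst \<circ> u) k \<inter> {y - r..y + r}"
    using xy by (auto simp: Rect_def dist_real_def)
  then show ?thesis by blast
qed

text \<open>If no near square over the rows \<open>w\<close> is heavy, then the heavy square one level deeper lies
  over adjacent rows that branched off earlier, so the point is close to an edge of the strip of
  \<open>w\<close> and the next digit of \<open>w\<close> is forced; the side of the edge does not change along a light stretch.\<close>
lemma light_stretch_constant:
  fixes y :: real and H :: "nat \<Rightarrow> (nat \<Rightarrow> nat) \<Rightarrow> bool"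
  defines "near \<equiv> \<lambda>k w. digit_ivl m w k \<inter> {y - 1 / (4 * real m ^ k)..y + 1 / (4 * real m ^ k)} \<noteq> {}"
  assumes cong: "\<And>k w w'. H k w \<Longrightarrow> (\<And>c. c < k \<Longrightarrow> w c = w' c) \<Longrightarrow> H k w'"
    and nearH: "\<And>k w. H k w \<Longrightarrow> near k w" and dig: "\<And>k w c. H k w \<Longrightarrow> c < k \<Longrightarrow> w c < m"
    and deep: "\<And>k. K0 \<le> k \<Longrightarrow> \<exists>w. H (Suc k) w \<and> H k w"
    and w: "H k w" "K0 \<le> a" "b \<le> k" and light: "\<And>c. a < c \<Longrightarrow> c < b \<Longrightarrow> \<not> H c w"
  shows "\<exists>d. \<forall>c. a < c \<and> c < b \<longrightarrow> w c = d"
proof -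
  have near_mono: "near c v" if "near k v" "c \<le> k" "\<And>c. c < k \<Longrightarrow> v c < m" for c k v
  proof -
    have "digit_ivl m v k \<subseteq> digit_ivl m v c" using that m_ge_2 by (intro ivl_antimono) auto
    moreover have "1 / (4 * real m ^ k) \<le> 1 / (4 * real m ^ c)"
      using that m_ge_2 by (intro divide_left_mono mult_left_mono power_increasing) auto
    ultimately show ?thesis using that(1) by (fastforce simp: near_def)
  qed
  have gap: "prefix_num m v' c \<le> prefix_num m v c + 1" if "near c v" "near c v'" for c v v'
  proof -
    have "2 * (1 / (4 * real m ^ c)) < real m / real m ^ c"
      using m_ge_2 by (simp add: field_simps)
    then show ?thesis using near_num_le that unfolding near_def by blast
  qed
  have wd: "w c < m" if "c < k" for c using dig w that by blast
  have wn: "near c w" if "c \<le> k" for c using near_mono[OF nearH[OF w(1)] that] wd by blast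
  have "\<exists>v. H (Suc c) v \<and> H c v" if "a < c" for c using deep[of c] w that by simp
  \<comment> \<open>The rows \<open>v c\<close> are heavy at level \<open>c\<close> and one level
    deeper. The first property keeps them apart from the light \<open>w\<close>, the second
    constrains the next digit of \<open>w\<close>.\<close>
  then obtain v where v: "\<And>c. a < c \<Longrightarrow> H (Suc c) (v c)" "\<And>c. a < c \<Longrightarrow> H c (v c)" by metis
  have vd: "v c i < m" if "a < c" "i \<le> c" for c i using dig[OF v(1)[OF that(1)]] that by simp
  have vn: "near i (v c)" if "a < c" "i \<le> Suc c" for c i
    by (rule near_mono[OF nearH[OF v(1)[OF that(1)]] that(2)]) (use vd that in auto)
  have ne: "prefix_num m (v c) c \<noteq> prefix_num m w c" if c: "a < c" "c < b" for c
  proof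
    assume eq: "prefix_num m (v c) c = prefix_num m w c"
    have "v c i = w i" if "i < c" for i
      by (rule num_inj[of c "v c" m w]) (use vd wd c w eq that in auto)
    then have "H c w" using cong[OF v(2)[OF c(1)]] by blast
    then show False using light c by blast
  qed
  have below: "prefix_num m w (Suc c) = prefix_num m (v c) (Suc c) + 1 \<and> w c = 0"
    if "a < c" "c < b" "prefix_num m (v c) c < prefix_num m w c" for c
    using near_split_digit[OF that(3) vd wd gap[OF vn wn]] that w by auto
  have above: "prefix_num m (v c) (Suc c) = prefix_num m w (Suc c) + 1 \<and> w c = m - 1"
    if "a < c" "c < b" "prefix_num m w c < prefix_num m (v c) c" for c
    using near_split_digit[OF that(3) wd vd gap[OF wn vn]] that w by auto
  have gap2: "prefix_num m (v c') (Suc c) \<le> prefix_num m (v c) (Suc c) + 1" "prefix_num m (v c) (Suc c) \<le> prefix_num m (v c') (Suc c) + 1"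
    if "a < c" "c' = Suc c" for c c'
    using gap[OF vn vn, of c "Suc c" c' ] gap[OF vn vn, of c' "Suc c" c] that by (simp_all del: prefix_num.simps)
  show ?thesis
  proof (cases "Suc a < b")
    case True
    show ?thesis
    proof (cases "prefix_num m (v (Suc a)) (Suc a) < prefix_num m w (Suc a)")
      case lt: True
      \<comment> \<open>The side cannot change: the heavy strip of the next level lies at most one
        step above the current one, which sits just below the strip of \<open>w\<close>. It is not
        the strip of \<open>w\<close>, so it is again below.\<close>
      have "prefix_num m (v (Suc a + i)) (Suc a + i) < prefix_num m w (Suc a + i)" if "Suc a + i < b" for i
        using that
      proof (induction i)
        case (Suc i)
        let ?c = "Suc a + i"
        have 1: "prefix_num m w (Suc ?c) = prefix_num m (v ?c) (Suc ?c) + 1" using below[of ?c] Suc by auto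
        have 2: "prefix_num m (v (Suc ?c)) (Suc ?c) \<noteq> prefix_num m w (Suc ?c)" using ne[of "Suc ?c"] Suc by auto
        have "prefix_num m (v (Suc ?c)) (Suc ?c) \<le> prefix_num m (v ?c) (Suc ?c) + 1" using gap2[of ?c] by auto
        then show ?case using 1 2 by simp
      qed (use lt in simp)
      then have "w c = 0" if "a < c" "c < b" for c
        using below[OF that] that by (metis Suc_leI le_iff_add)
      then show ?thesis by blast
    next
      case False
      then have gt: "prefix_num m w (Suc a) < prefix_num m (v (Suc a)) (Suc a)" using ne[of "Suc a"] True by simp
      have "prefix_num m w (Suc a + i) < prefix_num m (v (Suc a + i)) (Suc a + i)" if "Suc a + i < b" for i
        using that
      proof (induction i)
        case (Suc i)
        let ?c = "Suc a + i"
        have 1: "prefix_num m (v ?c) (Suc ?c) = prefix_num m w (Suc ?c) + 1" using above[of ?c] Suc by auto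
        have 2: "prefix_num m (v (Suc ?c)) (Suc ?c) \<noteq> prefix_num m w (Suc ?c)" using ne[of "Suc ?c"] Suc by auto
        have "prefix_num m (v ?c) (Suc ?c) \<le> prefix_num m (v (Suc ?c)) (Suc ?c) + 1" using gap2[of ?c] by auto
        then show ?case using 1 2 by simp
      qed (use gt in simp)
      then have "w c = m - 1" if "a < c" "c < b" for c
        using above[OF that] that by (metis Suc_leI le_iff_add)
      then show ?thesis by blast
    qed
  next
    case False
    then show ?thesis by (intro exI[of _ 0]) auto
  qed
qed

end

context digit_carpet
begin

definition rect_const :: real where "rect_const = (real n)\<^sup>2 + real m"

lemma rect_const_ge: "1 \<le> rect_const"
  using m_ge_2 by (simp add: rect_const_def add_increasing)

end

section \<open>Covering a level set by squares that are heavy for the tilted weights\<close>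

context weighted_carpet
begin

definition row_excess :: "real \<Rightarrow> nat \<Rightarrow> real" where
  "row_excess t i = ln (\<gamma> t i) - t * ln (q i)"

lemma row_excess_bounded: "\<exists>B. \<forall>i. \<bar>row_excess t i\<bar> \<le> B"
proof -
  \<comment> \<open>Outside \<open>R\<close> both sums are empty and \<open>ln 0 = 0\<close>, so one
    bound serves all indices.\<close>
  have "row_excess t i = 0" if "i \<notin> R" for i
  proof -
    have "row i = {}" using that by force
    then show ?thesis by (simp add: row_excess_def row_gamma_def row_prob_def)
  qed
  moreover obtain B where B: "\<And>i. i \<in> R \<Longrightarrow> \<bar>row_excess t i\<bar> \<le> B"
    using R_finite finite_imp_bounded[of "row_excess t ` R"] by (auto simp: bounded_iff)
  ultimately have "\<bar>row_excess t i\<bar> \<le> \<bar>B\<bar>" for i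
    using B[of i] abs_ge_self[of B] by (metis abs_ge_zero abs_zero order_trans)
  then show ?thesis by blast
qed

lemma ln_sq_weight: "valid k u \<Longrightarrow> ln (sq_weight p k u) = (\<Sum>c<k. if c < lev k then ln (p (u c)) else ln (q (fst (u c))))"
proof -
  assume v: "valid k u"
  have "0 < (if c < lev k then p (u c) else q (fst (u c)))" if "c < k" for c
    using v that p_pos row_prob_pos by (simp add: valid_def)
  then show ?thesis
    unfolding sq_weight_def by (subst ln_prod) (auto simp: less_imp_neq[symmetric] intro!: sum.cong)
qed

lemma sum_if_lev: "(\<Sum>c<k. if c < lev k then f c else 0) = (\<Sum>c<lev k. f c)"
  for f :: "nat \<Rightarrow> real"
proof -
  have "{..<k} \<inter> {c. c < lev k} = {..<lev k}" using lev_le[of k] by auto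
  then show ?thesis by (simp add: sum.inter_restrict[symmetric] sum.If_cases)
qed

lemma ln_sq_weight_tilt:
  assumes v: "valid k u"
  shows "ln (sq_weight (tilt t) k u) = t * ln (sq_weight p k u) - \<beta> t * real k * ln m +
    (\<sigma> * (\<Sum>c<k. row_excess t (fst (u c))) - (\<Sum>c<lev k. row_excess t (fst (u c))))"
proof -
  interpret T: weighted_carpet m n D "tilt t" by (rule weighted_carpet_tilt)
  have Zb: "ln (Z t) = \<beta> t * ln m" using ln_m_pos by (simp add: beta_eq)
  have 1: "ln (tilt t d) = t * ln (p d) - \<beta> t * ln m + \<sigma> * row_excess t (fst d) - row_excess t (fst d)" if d: "d \<in> D" for d
  proof -
    obtain i j where ij: "d = (i, j)" by force
    then have i: "i \<in> R" and dij: "(i, j) \<in> D" using d by force+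
    show ?thesis
      using row_gamma_pos[OF i, of t] Z_pos[of t]
      by (simp add: ij tilt_eq[OF dij] ln_mult ln_div Zb) (simp add: row_pressure_def row_excess_def algebra_simps)
  qed
  have 2: "ln (T.q i) = t * ln (q i) - \<beta> t * ln m + \<sigma> * row_excess t i" if i: "i \<in> R" for i
    using Z_pos[of t] by (simp add: row_prob_tilt[OF i] ln_div Zb) (simp add: row_pressure_def row_excess_def algebra_simps)
  have "ln (sq_weight (tilt t) k u) = (\<Sum>c<k. if c < lev k then ln (tilt t (u c)) else ln (T.q (fst (u c))))"
    using T.ln_sq_weight[OF v] .
  also have "\<dots> = (\<Sum>c<k. t * (if c < lev k then ln (p (u c)) else ln (q (fst (u c)))) - \<beta> t * ln m
      + \<sigma> * row_excess t (fst (u c)) - (if c < lev k then row_excess t (fst (u c)) else 0))"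
    using v 1 2 by (intro sum.cong) (auto simp: valid_def)
  also have "\<dots> = t * ln (sq_weight p k u) - \<beta> t * real k * ln m + \<sigma> * (\<Sum>c<k. row_excess t (fst (u c))) - (\<Sum>c<lev k. row_excess t (fst (u c)))"
    unfolding ln_sq_weight[OF v] sum_if_lev[symmetric]
    by (simp add: sum.distrib sum_subtractf sum_distrib_left)
  finally show ?thesis by simp
qed

lemma sq_weight_le_ball:
  assumes \<mu>: "is_self_affine_measure m n D p \<mu>" and \<omega>: "\<And>c. \<omega> c \<in> D" and x: "x \<in> Rect k \<omega>" and r: "rect_const / real m ^ k \<le> r"
  shows "sq_weight p k \<omega> \<le> measure \<mu> (cball x r)"
proof (rule sq_weight_le_measure[OF \<mu>])
  show "valid k \<omega>" using \<omega> by (rule validI)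
  show "Rect k \<omega> \<subseteq> cball x r"
    using Rect_dist[OF x] r by (fastforce simp: rect_const_def)
qed simp

context
  fixes \<mu> :: "(real \<times> real) measure" and \<Lambda> :: "(real \<times> real) set"
  assumes \<mu>: "is_self_affine_measure m n D p \<mu>" and \<Lambda>: "is_carpet m n D \<Lambda>"
begin

interpretation prob_space \<mu> by (rule prob_mu[OF \<mu>])

lemma measure_ball_pos:
  assumes x: "x \<in> \<Lambda>" and r: "0 < r"
  shows "0 < measure \<mu> (cball x r)"
proof -
  obtain \<omega> where \<omega>: "\<And>c. \<omega> c \<in> D" "\<And>k. x \<in> Rect k \<omega>" using carpet_coding[OF \<Lambda> x] by blast
  have "(\<lambda>k. rect_const / real m ^ k) \<longlonglongrightarrow> 0"
    using m_ge_2 by (intro LIMSEQ_divide_realpow_zero) auto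
  then have "\<forall>\<^sub>F k in sequentially. rect_const / real m ^ k < r" using r by (rule order_tendstoD)
  then obtain k where "rect_const / real m ^ k < r" by (auto dest: eventually_happens)
  then have "sq_weight p k \<omega> \<le> measure \<mu> (cball x r)"
    using \<omega> by (intro sq_weight_le_ball[OF \<mu>]) auto
  then show ?thesis using sq_weight_pos[OF validI, of \<omega> k] \<omega>(1) by simp
qed

text \<open>Pigeonhole: at this radius at most four squares meet the ball, and their total weight
  dominates its measure.\<close>

lemma exists_heavy_code:
  assumes x: "x \<in> \<Lambda>"
  shows "\<exists>u\<in>codes k. Rect k u \<inter> cball x (1 / (4 * real m ^ k)) \<noteq> {} \<and>
     measure \<mu> (cball x (1 / (4 * real m ^ k))) / 4 \<le> sq_weight p k u"
proof (rule ccontr)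
  let ?B = "cball x (1 / (4 * real m ^ k))" and ?S = "{u\<in>codes k. Rect k u \<inter> cball x (1 / (4 * real m ^ k)) \<noteq> {}}"
  assume neg: "\<not> ?thesis"
  have less: "sq_weight p k u < measure \<mu> ?B / 4" if u: "u \<in> ?S" for u
  proof (rule ccontr)
    assume "\<not> ?thesis"
    then have "measure \<mu> ?B / 4 \<le> sq_weight p k u" by (rule leI)
    then show False using neg u by blast
  qed
  have fin: "finite ?S" using finite_codes by simp
  have le: "measure \<mu> ?B \<le> (\<Sum>u\<in>?S. sq_weight p k u)"
    using measure_le_codes[OF \<mu>, of ?B k] finite_codes by (simp add: sum.inter_filter)
  have card: "card ?S \<le> 4"
    by (rule near_codes_card) (use m_ge_2 in auto)
  have "0 < measure \<mu> ?B" using m_ge_2 by (intro measure_ball_pos x) auto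
  then have "?S \<noteq> {}" using le by (metis (no_types, lifting) sum.empty not_less)
  then have "(\<Sum>u\<in>?S. sq_weight p k u) < (\<Sum>u\<in>?S. measure \<mu> ?B / 4)"
    using fin less by (intro sum_strict_mono)
  also have "\<dots> = card ?S * (measure \<mu> ?B / 4)" by simp
  also have "\<dots> \<le> 4 * (measure \<mu> ?B / 4)" using card by (intro mult_right_mono) auto
  finally show False using le by simp
qed

text \<open>The sign of \<open>t\<close> decides which estimate of the weight is wanted. For
  \<open>t \<le> 0\<close> it is an upper bound, which the squares of any coding of the point
  satisfy at all large levels, so a single row string serves and no light levels occur. For
  \<open>t > 0\<close> it is a lower bound, and the heavy square among the near ones may change its
  rows with the level.\<close>

lemma local_dim_row_strings:
  assumes x: "x \<in> \<Lambda>" and dim: "has_local_dim \<mu> x \<alpha>" and \<alpha>: "0 \<le> \<alpha>" and \<delta>: "0 < \<delta>"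
  shows "\<exists>(H :: nat \<Rightarrow> (nat \<Rightarrow> nat) \<Rightarrow> bool) K0. (\<forall>K. \<exists>k\<ge>K. \<exists>w. H k w) \<and>
    (\<forall>k w a b. H k w \<longrightarrow> K0 \<le> a \<longrightarrow> b \<le> k \<longrightarrow> (\<forall>c. a < c \<longrightarrow> c < b \<longrightarrow> \<not> H c w) \<longrightarrow> (\<exists>d. \<forall>c. a < c \<and> c < b \<longrightarrow> w c = d)) \<and>
    (\<forall>k w. K0 \<le> k \<longrightarrow> H k w \<longrightarrow> (\<exists>u. valid k u \<and> (\<forall>c<k. fst (u c) = w c) \<and> Rect k u \<inter> cball x (1 / real m ^ k) \<noteq> {} \<and>
       - (\<alpha> * t + \<delta>) * (k * ln m) \<le> t * ln (sq_weight p k u)))"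
proof -
  define \<epsilon> where "\<epsilon> = \<delta> / (2 * (\<bar>t\<bar> + 1))"
  have \<epsilon>: "0 < \<epsilon>" using \<delta> by (simp add: \<epsilon>_def)
  have t\<epsilon>: "\<bar>t\<bar> * \<epsilon> \<le> \<delta> / 2"
  proof -
    have "\<bar>t\<bar> * \<epsilon> \<le> (\<bar>t\<bar> + 1) * \<epsilon>" using \<epsilon> by (intro mult_right_mono) auto
    also have "\<dots> = \<delta> / 2" by (simp add: \<epsilon>_def field_simps)
    finally show ?thesis .
  qed
  have m1: "1 < real m" using m_ge_2 by simp
  note scales = has_local_dim_scales[OF dim m1 _ \<epsilon> measure_ball_pos[OF x]]
  show ?thesis
  proof (cases "t \<le> 0")
    case True
    obtain \<omega> where \<omega>: "\<And>c. \<omega> c \<in> D" "\<And>k. x \<in> Rect k \<omega>" using carpet_coding[OF \<Lambda> x] by blast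
    obtain K0 where K0: "\<And>k. K0 \<le> k \<Longrightarrow> measure \<mu> (cball x (rect_const / real m ^ k)) \<le> m powr (- (\<alpha> - \<epsilon>) * real k)"
      using scales[of rect_const] rect_const_ge unfolding eventually_sequentially by auto
    have le: "- (\<alpha> * t + \<delta>) * (k * ln m) \<le> t * ln (sq_weight p k \<omega>)" if k: "K0 \<le> k" for k
    proof -
      have "sq_weight p k \<omega> \<le> m powr (- (\<alpha> - \<epsilon>) * real k)"
        using sq_weight_le_ball[OF \<mu> \<omega> order_refl, of k] K0[OF k] by linarith
      then have "ln (sq_weight p k \<omega>) \<le> ln (m powr (- (\<alpha> - \<epsilon>) * real k))"
        using sq_weight_pos[OF validI[OF \<omega>(1)], of k] m_ge_2 by (subst ln_le_cancel_iff) auto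
      also have "\<dots> = - (\<alpha> - \<epsilon>) * real k * ln m" using m_ge_2 by (simp add: ln_powr)
      finally have "t * (- (\<alpha> - \<epsilon>) * real k * ln m) \<le> t * ln (sq_weight p k \<omega>)"
        using True by (intro mult_left_mono_neg)
      moreover have "(\<bar>t\<bar> * \<epsilon>) * (k * ln m) \<le> \<delta> * (k * ln m)"
        using t\<epsilon> \<delta> ln_m_pos by (intro mult_right_mono) auto
      ultimately show ?thesis using True by (simp add: algebra_simps)
    qed
    show ?thesis
    proof (rule exI[of _ "\<lambda>k w. w = fst \<circ> \<omega>"], rule exI[of _ K0], intro conjI allI impI)
      fix K :: nat show "\<exists>k\<ge>K. \<exists>w. w = fst \<circ> \<omega>" by (intro exI[of _ K]) auto
    next
      fix k w assume k: "K0 \<le> k" "w = fst \<circ> \<omega>"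
      have "x \<in> Rect k \<omega> \<inter> cball x (1 / real m ^ k)" using \<omega> by simp
      then show "\<exists>u. valid k u \<and> (\<forall>c<k. fst (u c) = w c) \<and> Rect k u \<inter> cball x (1 / real m ^ k) \<noteq> {} \<and>
       - (\<alpha> * t + \<delta>) * (k * ln m) \<le> t * ln (sq_weight p k u)"
        using k le validI[OF \<omega>(1)] by (intro exI[of _ \<omega>]) auto
    qed auto
  next
    case False
    \<comment> \<open>The 4 comes from the pigeonhole, the power of \<open>m\<close> from one change
      of level: the parent of a heavy square of level \<open>Suc k\<close> must still count as heavy
      at level \<open>k\<close>.\<close>
    define \<kappa> where "\<kappa> = m powr (- (\<alpha> + \<epsilon>)) / 4"
    define v where "v k = m powr (- (\<alpha> + \<epsilon>) * real k)" for k
    have \<kappa>: "0 < \<kappa>" "\<kappa> \<le> 1 / 4"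
      using m_ge_2 \<alpha> \<epsilon> powr_mono[of "- (\<alpha> + \<epsilon>)" 0 "real m"] by (auto simp: \<kappa>_def)
    have v: "0 < v k" for k using m_ge_2 by (simp add: v_def)
    have v_Suc: "v (Suc k) = m powr (- (\<alpha> + \<epsilon>)) * v k" for k
      using m_ge_2 by (simp add: v_def powr_add[symmetric] algebra_simps)
    obtain K1 where K1: "\<And>k. K1 \<le> k \<Longrightarrow> v k \<le> measure \<mu> (cball x (1 / (4 * real m ^ k)))"
      using scales[of "1 / 4"] unfolding eventually_sequentially v_def by auto
    \<comment> \<open>From this level on the constant \<open>t * ln \<kappa>\<close> is absorbed by
      half of \<delta>.\<close>
    define K0 where "K0 = max K1 (nat \<lceil>2 * \<bar>t * ln \<kappa>\<bar> / (\<delta> * ln m)\<rceil>)"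
    define P where "P k w u \<longleftrightarrow> valid k u \<and> (\<forall>c<k. fst (u c) = w c) \<and> Rect k u \<inter> cball x (1 / (4 * real m ^ k)) \<noteq> {} \<and>
       \<kappa> * v k \<le> sq_weight p k u" for k :: nat and w :: "nat \<Rightarrow> nat" and u :: "nat \<Rightarrow> nat \<times> nat"
    define H where "H k w \<longleftrightarrow> (\<exists>u. P k w u)" for k w
    have heavy: "\<exists>u. valid k u \<and> Rect k u \<inter> cball x (1 / (4 * real m ^ k)) \<noteq> {} \<and> v k / 4 \<le> sq_weight p k u"
      if "K0 \<le> k" for k
      using exists_heavy_code[OF x, of k] K1[of k] that valid_codes by (force simp: K0_def)
    have kv: "\<kappa> * v k \<le> v k / 4" for k using mult_right_mono[OF \<kappa>(2), of "v k"] v[of k] by simp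
    obtain X Y where XY: "x = (X, Y)" by force
    have io: "\<exists>k\<ge>K. \<exists>w. H k w" for K
    proof -
      obtain u where "valid (max K K0) u" "Rect (max K K0) u \<inter> cball x (1 / (4 * real m ^ max K K0)) \<noteq> {}"
        "v (max K K0) / 4 \<le> sq_weight p (max K K0) u" using heavy[of "max K K0"] by auto
      then have "P (max K K0) (fst \<circ> u) u" using kv[of "max K K0"] by (auto simp: P_def)
      then show ?thesis unfolding H_def using max.cobounded1 by blast
    qed
    have deep: "\<exists>w. H (Suc k) w \<and> H k w" if k: "K0 \<le> k" for k
    proof -
      obtain u where u: "valid (Suc k) u" "Rect (Suc k) u \<inter> cball x (1 / (4 * real m ^ Suc k)) \<noteq> {}"
        "v (Suc k) / 4 \<le> sq_weight p (Suc k) u" using heavy[of "Suc k"] k by auto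
      have "1 / (4 * real m ^ Suc k) \<le> 1 / (4 * real m ^ k)"
        using m_ge_2 by (intro divide_left_mono mult_left_mono power_increasing) auto
      then have "cball x (1 / (4 * real m ^ Suc k)) \<subseteq> cball x (1 / (4 * real m ^ k))" by (rule subset_cball)
      then have "Rect k u \<inter> cball x (1 / (4 * real m ^ k)) \<noteq> {}"
        using u(2) Rect_antimono[OF u(1), of k] by auto
      moreover have "\<kappa> * v k \<le> sq_weight p k u"
        using u(3) sq_weight_Suc_le[OF u(1)] by (simp add: v_Suc \<kappa>_def)
      ultimately have "P k (fst \<circ> u) u" using valid_antimono[OF u(1), of k] by (auto simp: P_def)
      moreover have "P (Suc k) (fst \<circ> u) u" using u kv[of "Suc k"] by (auto simp: P_def)
      ultimately show ?thesis unfolding H_def by blast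
    qed
    have run: "\<exists>d. \<forall>c. a < c \<and> c < b \<longrightarrow> w c = d"
      if "H k w" "K0 \<le> a" "b \<le> k" "\<forall>c. a < c \<longrightarrow> c < b \<longrightarrow> \<not> H c w" for k w a b
    proof (rule light_stretch_constant[where H = H and y = Y and ?K0.0 = K0])
      show "H k w'" if "H k w" "\<And>c. c < k \<Longrightarrow> w c = w' c" for k w w'
        using that by (auto simp: H_def P_def)
      show "digit_ivl m w k \<inter> {Y - 1 / (4 * real m ^ k)..Y + 1 / (4 * real m ^ k)} \<noteq> {}" if H: "H k w" for k w
      proof -
        obtain u where u: "P k w u" using H by (auto simp: H_def)
        then have "digit_ivl m (fst \<circ> u) k = digit_ivl m w k" by (intro ivl_cong) (auto simp: P_def)
        then show ?thesis using u Rect_near_row[of k u X Y "1 / (4 * real m ^ k)"] by (auto simp: P_def XY)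
      qed
      show "w c < m" if "H k w" "c < k" for k w c
        using that valid_digits(1) by (force simp: H_def P_def)
    qed (use that deep in auto)
    have good: "\<exists>u. valid k u \<and> (\<forall>c<k. fst (u c) = w c) \<and> Rect k u \<inter> cball x (1 / real m ^ k) \<noteq> {} \<and>
       - (\<alpha> * t + \<delta>) * (k * ln m) \<le> t * ln (sq_weight p k u)" if k: "K0 \<le> k" "H k w" for k w
    proof -
      obtain u where u: "valid k u" "\<forall>c<k. fst (u c) = w c" "Rect k u \<inter> cball x (1 / (4 * real m ^ k)) \<noteq> {}"
        "\<kappa> * v k \<le> sq_weight p k u" using k(2) by (auto simp: H_def P_def)
      have "1 / (4 * real m ^ k) \<le> 1 / real m ^ k" using m_ge_2 by (intro divide_left_mono) auto
      then have "cball x (1 / (4 * real m ^ k)) \<subseteq> cball x (1 / real m ^ k)" by (rule subset_cball)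
      then have near: "Rect k u \<inter> cball x (1 / real m ^ k) \<noteq> {}" using u(3) by blast
      have "ln (\<kappa> * v k) \<le> ln (sq_weight p k u)"
        using u(4) \<kappa> v[of k] sq_weight_pos[OF u(1)] by (subst ln_le_cancel_iff) auto
      moreover have "ln (\<kappa> * v k) = ln \<kappa> - (\<alpha> + \<epsilon>) * (k * ln m)"
        using \<kappa> v[of k] m_ge_2 by (simp add: ln_mult v_def ln_powr algebra_simps)
      ultimately have "t * (ln \<kappa> - (\<alpha> + \<epsilon>) * (k * ln m)) \<le> t * ln (sq_weight p k u)"
        using False by (intro mult_left_mono) auto
      moreover have "(\<bar>t\<bar> * \<epsilon>) * (k * ln m) \<le> \<delta> / 2 * (k * ln m)"
        using t\<epsilon> ln_m_pos by (intro mult_right_mono) auto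
      moreover have "\<bar>t * ln \<kappa>\<bar> \<le> \<delta> / 2 * (k * ln m)"
      proof -
        have "2 * \<bar>t * ln \<kappa>\<bar> / (\<delta> * ln m) \<le> k" using k by (auto simp: K0_def)
        then show ?thesis using \<delta> ln_m_pos by (simp add: pos_divide_le_eq mult_ac)
      qed
      ultimately have "- (\<alpha> * t + \<delta>) * (k * ln m) \<le> t * ln (sq_weight p k u)"
        using False by (simp add: algebra_simps abs_le_iff)
      then show ?thesis using u near by blast
    qed
    show ?thesis
      by (rule exI[of _ H], rule exI[of _ K0], intro conjI allI impI) (use io run good in blast)+
  qed
qed

lemma heavy_tilted_squares:
  assumes x: "x \<in> \<Lambda>" and dim: "has_local_dim \<mu> x \<alpha>" and \<alpha>: "0 \<le> \<alpha>" and \<delta>: "0 < \<delta>"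
  shows "\<exists>k\<ge>K. \<exists>u\<in>codes k. Rect k u \<inter> cball x (1 / real m ^ k) \<noteq> {} \<and>
    m powr (- (\<alpha> * t + \<beta> t + \<delta>) * real k) \<le> sq_weight (tilt t) k u"
proof -
  interpret T: weighted_carpet m n D "tilt t" by (rule weighted_carpet_tilt)
  \<comment> \<open>One half of \<delta> pays for the local dimension, the other for the oscillation
    of the averages.\<close>
  have "0 < \<delta> / 2" using \<delta> by simp
  from local_dim_row_strings[where t = t, OF x dim \<alpha> this]
  obtain H :: "nat \<Rightarrow> (nat \<Rightarrow> nat) \<Rightarrow> bool" and K0 where io: "\<forall>K. \<exists>k\<ge>K. \<exists>w. H k w"
    and run: "\<forall>k w a b. H k w \<longrightarrow> K0 \<le> a \<longrightarrow> b \<le> k \<longrightarrow> (\<forall>c. a < c \<longrightarrow> c < b \<longrightarrow> \<not> H c w) \<longrightarrow> (\<exists>d. \<forall>c. a < c \<and> c < b \<longrightarrow> w c = d)"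
    and good: "\<forall>k w. K0 \<le> k \<longrightarrow> H k w \<longrightarrow> (\<exists>u. valid k u \<and> (\<forall>c<k. fst (u c) = w c) \<and> Rect k u \<inter> cball x (1 / real m ^ k) \<noteq> {} \<and>
       - (\<alpha> * t + \<delta> / 2) * (k * ln m) \<le> t * ln (sq_weight p k u))"
    by (elim exE conjE)
  obtain B where B: "\<And>i. \<bar>row_excess t i\<bar> \<le> B" using row_excess_bounded by blast
  have "0 < \<delta> / 2 * ln m" using \<delta> ln_m_pos by simp
  have "\<exists>k\<ge>max K K0. \<exists>w. H k w \<and> - (\<delta> / 2 * ln m) * k \<le> \<sigma> * (\<Sum>c<k. row_excess t (w c)) - (\<Sum>c<lev k. row_excess t (w c))"
    by (rule heavy_oscillation[where \<sigma> = \<sigma> and g = "row_excess t" and B = B and l = lev and H = H and ?K0.0 = K0])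
       (use sigma_bounds B lev_bounds io run \<open>0 < \<delta> / 2 * ln m\<close> in blast)+
  then obtain k w where k: "max K K0 \<le> k" "H k w"
    "- (\<delta> / 2 * ln m) * k \<le> \<sigma> * (\<Sum>c<k. row_excess t (w c)) - (\<Sum>c<lev k. row_excess t (w c))" by blast
  obtain u where u: "valid k u" "\<forall>c<k. fst (u c) = w c" "Rect k u \<inter> cball x (1 / real m ^ k) \<noteq> {}"
    "- (\<alpha> * t + \<delta> / 2) * (k * ln m) \<le> t * ln (sq_weight p k u)" using good k(1,2) by (meson max.bounded_iff)
  have "(\<Sum>c<k. row_excess t (fst (u c))) = (\<Sum>c<k. row_excess t (w c))" "(\<Sum>c<lev k. row_excess t (fst (u c))) = (\<Sum>c<lev k. row_excess t (w c))"
    using u(2) lev_le[of k] by auto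
  then have "- (\<alpha> * t + \<beta> t + \<delta>) * real k * ln m \<le> ln (sq_weight (tilt t) k u)"
    using ln_sq_weight_tilt[OF u(1), of t] u(4) k(3) by (simp add: algebra_simps)
  then have "exp (- (\<alpha> * t + \<beta> t + \<delta>) * real k * ln m) \<le> exp (ln (sq_weight (tilt t) k u))" by simp
  then have "m powr (- (\<alpha> * t + \<beta> t + \<delta>) * real k) \<le> sq_weight (tilt t) k u"
    using T.sq_weight_pos[OF u(1)] m_ge_2 by (simp add: powr_def)
  then show ?thesis
    using k(1) u code_in_codes[OF u(1)] by (intro exI[of _ k] conjI bexI[of _ "code k u"]) (auto simp: Rect_code sq_weight_code)
qed

text \<open>The tilted weights of the squares of one level sum to 1, so at most
  \<open>m powr (a * k)\<close> of them reach \<open>m powr (- a * k)\<close>. Every exponent above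
  \<open>a\<close> outweighs this number.\<close>

lemma hausdorff_measure_level_set:
  assumes \<alpha>: "0 \<le> \<alpha>" and s: "\<alpha> * t + \<beta> t < s" "0 < s"
  shows "hausdorff_measure s (level_set \<Lambda> \<mu> \<alpha>) = 0"
proof -
  interpret T: weighted_carpet m n D "tilt t" by (rule weighted_carpet_tilt)
  define a where "a = (\<alpha> * t + \<beta> t + s) / 2"
  have a: "a < s" "0 < a - (\<alpha> * t + \<beta> t)" using s by (auto simp: a_def)
  define G where "G k = {u\<in>codes k. m powr (- a * real k) \<le> sq_weight (tilt t) k u}" for k
  \<comment> \<open>A point is only known to be near its heavy square, so the cover consists of
    neighbourhoods of comparable size.\<close>
  define V where "V k u = {z. \<exists>y\<in>Rect k u. dist z y \<le> 1 / real m ^ k}" for k u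
  have dist: "dist z z' \<le> (rect_const + 2) * (1 / real m) ^ k" if z: "z \<in> V k u" "z' \<in> V k u" for z z' k u
  proof -
    obtain y y' where y: "y \<in> Rect k u" "dist z y \<le> 1 / real m ^ k" "y' \<in> Rect k u" "dist z' y' \<le> 1 / real m ^ k"
      using z by (auto simp: V_def)
    have "dist z z' \<le> dist z y + dist y y' + dist z' y'"
      by (metis add.commute add_left_mono dist_commute dist_triangle dist_triangle_le order_trans)
    also have "\<dots> \<le> 1 / real m ^ k + rect_const / real m ^ k + 1 / real m ^ k"
      using y Rect_dist[OF y(1,3)] by (intro add_mono) (auto simp: rect_const_def)
    finally show ?thesis by (simp add: power_divide add_divide_distrib)
  qed
  have inv_m: "m powr (- a * real k) * (m powr a) ^ k = 1" for k
    using m_ge_2 by (simp add: powr_realpow[symmetric] powr_powr powr_add[symmetric])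
  show ?thesis
  proof (rule hausdorff_measure_limsup_eq_0[where V = V and G = G and r = "1 / real m" and b = "m powr a" and C = "rect_const + 2"])
    show "m powr a * (1 / real m) powr s < 1"
    proof -
      have "m powr a * (1 / real m) powr s = m powr (a - s)"
        using m_ge_2 by (simp add: powr_divide powr_diff)
      also have "\<dots> < 1" using a m_ge_2 by (simp add: powr_less_one)
      finally show ?thesis .
    qed
    show "real (card (G k)) \<le> (m powr a) ^ k" for k
    proof -
      have "real (card (G k)) * m powr (- a * real k) = (\<Sum>u\<in>G k. m powr (- a * real k))" by simp
      also have "\<dots> \<le> (\<Sum>u\<in>G k. sq_weight (tilt t) k u)" by (intro sum_mono) (auto simp: G_def)
      also have "\<dots> \<le> (\<Sum>u\<in>codes k. sq_weight (tilt t) k u)"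
        using finite_codes T.sq_weight_pos[OF valid_codes] by (intro sum_mono2) (auto simp: G_def less_imp_le)
      also have "\<dots> = 1" by (rule T.sum_sq_weight)
      finally have "real (card (G k)) * m powr (- a * real k) * (m powr a) ^ k \<le> 1 * (m powr a) ^ k"
        by (intro mult_right_mono) auto
      then show ?thesis using inv_m[of k] by (simp only: mult.assoc mult_1_left mult_1_right)
    qed
    show "bounded (V k c)" for k c
      using dist[of _ k c] unfolding bounded_two_points by blast
    show "diameter (V k c) \<le> (rect_const + 2) * (1 / real m) ^ k" for k c
      using dist[of _ k c] rect_const_ge m_ge_2 by (intro diameter_le) (auto simp: dist_norm)
    show "\<exists>k\<ge>K. \<exists>c\<in>G k. x \<in> V k c" if x: "x \<in> level_set \<Lambda> \<mu> \<alpha>" for x K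
    proof -
      have "x \<in> \<Lambda>" "has_local_dim \<mu> x \<alpha>" using x by (auto simp: level_set_def)
      from heavy_tilted_squares[OF this \<alpha> a(2), of K t] obtain k u where
        ku: "K \<le> k" "u \<in> codes k" "Rect k u \<inter> cball x (1 / real m ^ k) \<noteq> {}" "m powr (- a * real k) \<le> sq_weight (tilt t) k u"
        by auto
      then show ?thesis by (intro exI[of _ k] conjI bexI[of _ u]) (auto simp: G_def V_def)
    qed
  qed (use s m_ge_2 rect_const_ge finite_codes in \<open>auto simp: G_def\<close>)
qed

end

end

section \<open>The lower bound\<close>

lemma tendsto_average_subseq:
  fixes f :: "nat \<Rightarrow> real" and s :: "nat \<Rightarrow> nat"
  assumes f: "(\<lambda>k. f k / k) \<longlonglongrightarrow> a" and s: "(\<lambda>k. real (s k) / k) \<longlonglongrightarrow> \<rho>" and lim: "filterlim s at_top sequentially"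
  shows "(\<lambda>k. f (s k) / k) \<longlonglongrightarrow> a * \<rho>"
proof -
  have "(\<lambda>k. f (s k) / s k * (s k / k)) \<longlonglongrightarrow> a * \<rho>"
    by (intro tendsto_mult s filterlim_compose[OF f lim])
  moreover have "\<forall>\<^sub>F k in sequentially. 1 \<le> s k"
    using lim unfolding filterlim_at_top by blast
  then have "\<forall>\<^sub>F k in sequentially. f (s k) / s k * (s k / k) = f (s k) / k"
    by eventually_elim simp
  ultimately show ?thesis by (rule Lim_transform_eventually)
qed

lemma floor_mult_tendsto:
  fixes a :: real
  assumes a: "0 < a"
  shows "(\<lambda>k. real (nat \<lfloor>a * real k\<rfloor>) / k) \<longlonglongrightarrow> a" "filterlim (\<lambda>k. nat \<lfloor>a * real k\<rfloor>) at_top sequentially"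
proof -
  have bd: "real (nat \<lfloor>a * real k\<rfloor>) \<le> a * k" "a * k - 1 \<le> real (nat \<lfloor>a * real k\<rfloor>)" for k
    using a by (auto intro: of_nat_floor)
  show "(\<lambda>k. real (nat \<lfloor>a * real k\<rfloor>) / k) \<longlonglongrightarrow> a"
  proof (rule tendsto_sandwich)
    show "\<forall>\<^sub>F k in sequentially. a - 1 / k \<le> real (nat \<lfloor>a * real k\<rfloor>) / k"
      using eventually_gt_at_top[of 0]
    proof eventually_elim
      case (elim k)
      have "a - 1 / k = (a * k - 1) / k" using elim by (simp add: field_simps)
      also have "\<dots> \<le> real (nat \<lfloor>a * real k\<rfloor>) / k" using bd(2) by (intro divide_right_mono) auto
      finally show ?case .
    qed
    show "\<forall>\<^sub>F k in sequentially. real (nat \<lfloor>a * real k\<rfloor>) / k \<le> a"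
      using eventually_gt_at_top[of 0]
      by eventually_elim (use bd(1) in \<open>simp add: field_simps\<close>)
    have "(\<lambda>k. a - 1 / real k) \<longlonglongrightarrow> a - 0" by (intro tendsto_intros lim_1_over_n)
    then show "(\<lambda>k. a - 1 / real k) \<longlonglongrightarrow> a" by simp
  qed simp
  show "filterlim (\<lambda>k. nat \<lfloor>a * real k\<rfloor>) at_top sequentially"
    unfolding filterlim_at_top
  proof
    fix Z :: nat
    show "\<forall>\<^sub>F k in sequentially. Z \<le> nat \<lfloor>a * real k\<rfloor>"
      using eventually_ge_at_top[of "nat \<lceil>(Z + 1) / a\<rceil>"]
    proof eventually_elim
      case (elim k)
      then have "(Z + 1) / a \<le> k" by linarith
      then have "real Z + 1 \<le> a * k" using a by (simp add: pos_divide_le_eq mult.commute)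
      then show ?case using bd(2)[of k] by linarith
    qed
  qed
qed

section \<open>Points with prescribed digit frequencies\<close>

context digit_carpet
begin

definition point :: "(nat \<Rightarrow> nat \<times> nat) \<Rightarrow> real \<times> real" where
  "point \<omega> = ((\<Sum>c. real (snd (\<omega> c)) / real n ^ c), (\<Sum>c. real (fst (\<omega> c)) / real m ^ c))"

text \<open>Digit frequencies \<open>P\<close>, stated through averages of arbitrary functions so
  that logarithms of weights can be inserted directly.\<close>

definition generic :: "(nat \<times> nat \<Rightarrow> real) \<Rightarrow> (nat \<Rightarrow> nat \<times> nat) \<Rightarrow> bool" where
  "generic P \<omega> \<longleftrightarrow> (\<forall>c. \<omega> c \<in> D) \<and>
     (\<forall>\<phi> :: nat \<times> nat \<Rightarrow> real. (\<lambda>k. (\<Sum>c<k. \<phi> (\<omega> c)) / real k) \<longlonglongrightarrow> (\<Sum>d\<in>D. P d * \<phi> d))"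

lemma lev_tendsto: "(\<lambda>k. real (lev k) / k) \<longlonglongrightarrow> \<sigma>" "filterlim lev at_top sequentially"
  using floor_mult_tendsto[OF sigma_bounds(1)] by (simp_all add: lev_def[abs_def])

context
  fixes \<omega> :: "nat \<Rightarrow> nat \<times> nat"
  assumes \<omega>: "\<And>c. \<omega> c \<in> D"
begin

lemma digits_less: "fst (\<omega> c) < m" "snd (\<omega> c) < n"
  using \<omega> fst_less snd_less by auto

lemma point_in_Rect: "point \<omega> \<in> Rect k \<omega>"
  using val_le_digits_sum[of m "fst \<circ> \<omega>" k] digits_sum_le_val[of m "fst \<circ> \<omega>" k]
    val_le_digits_sum[of n "snd \<circ> \<omega>" "lev k"] digits_sum_le_val[of n "snd \<circ> \<omega>" "lev k"] digits_less m_ge_2 n_ge_2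
  by (simp add: point_def Rect_def digit_ivl_def)

lemma point_in_carpet:
  assumes \<Lambda>: "is_carpet m n D \<Lambda>"
  shows "point \<omega> \<in> \<Lambda>"
proof -
  have comp: "compact \<Lambda>" "\<Lambda> \<noteq> {}" and inv: "(\<Union>d\<in>D. carpet_map m n d ` \<Lambda>) = \<Lambda>"
    using \<Lambda> by (auto simp: is_carpet_def)
  obtain z where z: "z \<in> \<Lambda>" using comp by blast
  have mem: "cmap \<omega> k y \<in> \<Lambda>" if "y \<in> \<Lambda>" for k y
    using that
  proof (induction k arbitrary: y)
    case (Suc k)
    have "carpet_map m n (\<omega> k) y \<in> \<Lambda>" using Suc.prems \<omega> inv by blast
    then show ?case using Suc.IH by (simp add: cmap_Suc)
  qed (simp add: cmap_0)
  have "(\<lambda>k. (prefix_val n (snd \<circ> \<omega>) k + fst z / real n ^ k, prefix_val m (fst \<circ> \<omega>) k + snd z / real m ^ k)) \<longlonglongrightarrow>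
      ((\<Sum>c. real ((snd \<circ> \<omega>) c) / real n ^ c) + 0, (\<Sum>c. real ((fst \<circ> \<omega>) c) / real m ^ c) + 0)"
    using digits_less m_ge_2 n_ge_2
    by (intro tendsto_Pair tendsto_add val_tendsto LIMSEQ_divide_realpow_zero) auto
  then have "(\<lambda>k. cmap \<omega> k z) \<longlonglongrightarrow> point \<omega>"
    by (simp add: cmap_def point_def split_beta)
  then show ?thesis
    by (rule closed_sequentially[OF compact_imp_closed[OF comp(1)] mem[OF z]])
qed

lemma near_point_unique:
  assumes l: "l \<le> k" and u: "u \<in> codes l" and near: "Rect l u \<inter> cball (point \<omega>) (1 / real m ^ k) \<noteq> {}"
    and r: "l \<le> c1" "c1 < k" "fst (\<omega> c1) \<noteq> 0" "l \<le> c2" "c2 < k" "fst (\<omega> c2) \<noteq> m - 1"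
    and c: "lev l \<le> c3" "c3 < lev k" "snd (\<omega> c3) \<noteq> 0" "lev l \<le> c4" "c4 < lev k" "snd (\<omega> c4) \<noteq> n - 1"
  shows "u = code l \<omega>"
proof -
  let ?r = "1 / real m ^ k"
  have v: "valid l u" by (rule valid_codes[OF u])
  obtain z where z: "z \<in> Rect l u" "dist (point \<omega>) z \<le> ?r" using near by auto
  have "dist (fst (point \<omega>)) (fst z) \<le> ?r" "dist (snd (point \<omega>)) (snd z) \<le> ?r"
    using z dist_fst_le[of "point \<omega>" z] dist_snd_le[of "point \<omega>" z] by linarith+
  then have zz: "snd z \<in> digit_ivl m (fst \<circ> u) l \<inter> {snd (point \<omega>) - ?r..snd (point \<omega>) + ?r}"
    "fst z \<in> digit_ivl n (snd \<circ> u) (lev l) \<inter> {fst (point \<omega>) - ?r..fst (point \<omega>) + ?r}"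
    using z by (auto simp: Rect_def mem_Times_iff dist_real_def)
  have rm: "?r < real m / real m ^ k" using m_ge_2 by (intro divide_strict_right_mono) auto
  have rn: "?r < real n / real n ^ lev k"
  proof -
    have "?r \<le> 1 / real n ^ lev k" using powr_lev(1)[of k] n_ge_2 m_ge_2 by (intro divide_left_mono) auto
    also have "\<dots> < real n / real n ^ lev k" using n_ge_2 by (intro divide_strict_right_mono) auto
    finally show ?thesis .
  qed
  have near1: "digit_ivl m (fst \<circ> u) l \<inter> {(\<Sum>c. real ((fst \<circ> \<omega>) c) / real m ^ c) - ?r..(\<Sum>c. real ((fst \<circ> \<omega>) c) / real m ^ c) + ?r} \<noteq> {}"
    and near2: "digit_ivl n (snd \<circ> u) (lev l) \<inter> {(\<Sum>c. real ((snd \<circ> \<omega>) c) / real n ^ c) - ?r..(\<Sum>c. real ((snd \<circ> \<omega>) c) / real n ^ c) + ?r} \<noteq> {}"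
    using zz unfolding point_def fst_conv snd_conv comp_def by blast+
  have "(fst \<circ> u) i = (fst \<circ> \<omega>) i" if "i < l" for i
    by (rule near_digits_sum_unique[OF m_ge_2 _ r(1,2) _ r(4,5) _ _ rm near1 that])
       (use r digits_less valid_digits(1)[OF v] in simp_all)
  then have 1: "fst (u i) = fst (\<omega> i)" if "i < l" for i using that by simp
  have "(snd \<circ> u) i = (snd \<circ> \<omega>) i" if "i < lev l" for i
    by (rule near_digits_sum_unique[OF n_ge_2 _ c(1,2) _ c(4,5) _ _ rn near2 that])
       (use c digits_less valid_digits(2)[OF v] in simp_all)
  then have 2: "snd (u i) = snd (\<omega> i)" if "i < lev l" for i using that by simp
  show ?thesis
  proof
    fix i
    show "u i = code l \<omega> i"
    proof (cases "i < l")
      case True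
      then have "u i \<in> (if i < lev l then D else (\<lambda>i. (i, 0)) ` R)" using u by (auto simp: codes_def PiE_iff)
      then show ?thesis using 1[OF True] 2[of i] True by (cases "i < lev l") (auto simp: code_def prod_eq_iff)
    next
      case False
      then show ?thesis using u by (auto simp: code_def codes_def PiE_iff extensional_def)
    qed
  qed
qed

end

text \<open>Positive frequency makes the number of occurrences between positions of different
  asymptotic slopes grow linearly, so eventually it is not 0.\<close>

lemma generic_digit_between:
  assumes \<omega>: "generic P \<omega>" and d: "d \<in> D" "Q d" and P: "\<And>d. d \<in> D \<Longrightarrow> 0 < P d"
    and s: "(\<lambda>k. real (s k) / k) \<longlonglongrightarrow> \<rho>" "filterlim s at_top sequentially"
    and s': "(\<lambda>k. real (s' k) / k) \<longlonglongrightarrow> \<rho>'" "filterlim s' at_top sequentially" and \<rho>: "\<rho> < \<rho>'"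
  shows "\<forall>\<^sub>F k in sequentially. \<exists>c. s k \<le> c \<and> c < s' k \<and> Q (\<omega> c)"
proof -
  define \<phi> :: "nat \<times> nat \<Rightarrow> real" where "\<phi> d = (if Q d then 1 else 0)" for d
  define a where "a = (\<Sum>d\<in>D. P d * \<phi> d)"
  define f where "f k = (\<Sum>c<k. \<phi> (\<omega> c))" for k
  have a: "0 < a"
    unfolding a_def by (rule sum_pos2[OF finite_D d(1)]) (use P d in \<open>auto simp: \<phi>_def less_imp_le\<close>)
  have f: "(\<lambda>k. f k / k) \<longlonglongrightarrow> a"
    using \<omega> unfolding generic_def f_def a_def by blast
  have "(\<lambda>k. f (s' k) / k - f (s k) / k) \<longlonglongrightarrow> a * \<rho>' - a * \<rho>"
    by (intro tendsto_diff tendsto_average_subseq[OF f] s s')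
  moreover have "0 < a * \<rho>' - a * \<rho>" using a \<rho> by simp
  ultimately have "\<forall>\<^sub>F k in sequentially. 0 < f (s' k) / k - f (s k) / k" by (rule order_tendstoD)
  then show ?thesis
    using eventually_gt_at_top[of 0]
  proof eventually_elim
    case (elim k)
    then have less: "f (s k) < f (s' k)" by (simp add: divide_less_cancel field_simps)
    show ?case
    proof (rule ccontr)
      assume "\<not> ?thesis"
      then have 0: "\<phi> (\<omega> c) = 0" if "s k \<le> c" "c < s' k" for c using that by (auto simp: \<phi>_def)
      have "f (s' k) \<le> (\<Sum>c\<in>{..<s k}. \<phi> (\<omega> c))"
        unfolding f_def
      proof (cases "s' k \<le> s k")
        case True
        then show "(\<Sum>c<s' k. \<phi> (\<omega> c)) \<le> (\<Sum>c<s k. \<phi> (\<omega> c))"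
          by (intro sum_mono2) (auto simp: \<phi>_def)
      next
        case False
        have "(\<Sum>c<s' k. \<phi> (\<omega> c)) = (\<Sum>c<s k. \<phi> (\<omega> c))"
        proof (rule sum.mono_neutral_right)
          show "\<forall>c\<in>{..<s' k} - {..<s k}. \<phi> (\<omega> c) = 0" using 0 by auto
        qed (use False in auto)
        then show "(\<Sum>c<s' k. \<phi> (\<omega> c)) \<le> (\<Sum>c<s k. \<phi> (\<omega> c))" by simp
      qed
      then show False using less by (simp add: f_def)
    qed
  qed
qed

lemma two_rows_other: "\<exists>d\<in>D. fst d \<noteq> i"
  using two_rows by metis

lemma two_cols_other: "\<exists>d\<in>D. snd d \<noteq> i"
  using two_cols by metis

text \<open>Giving up a proportion \<epsilon> of the levels leaves room, in both coordinates, for a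
  digit that is not 0 and one that is not maximal; these isolate the square of level
  \<open>s k\<close>. Such digits exist because \<open>D\<close> has two rows and two
  columns.\<close>

lemma generic_near_unique:
  assumes \<omega>: "generic P \<omega>" and P: "\<And>d. d \<in> D \<Longrightarrow> 0 < P d" and \<epsilon>: "0 < \<epsilon>" "\<epsilon> < 1"
  defines "s \<equiv> \<lambda>k. nat \<lfloor>(1 - \<epsilon>) * real k\<rfloor>"
  shows "\<forall>\<^sub>F k in sequentially. \<forall>u\<in>codes (s k). Rect (s k) u \<inter> cball (point \<omega>) (1 / real m ^ k) \<noteq> {} \<longrightarrow> u = code (s k) \<omega>"
proof -
  have D: "\<And>c. \<omega> c \<in> D" using \<omega> by (auto simp: generic_def)
  have s: "(\<lambda>k. real (s k) / k) \<longlonglongrightarrow> 1 - \<epsilon>" "filterlim s at_top sequentially"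
    using floor_mult_tendsto[of "1 - \<epsilon>"] \<epsilon> by (simp_all add: s_def)
  have id: "(\<lambda>k. real ((\<lambda>k. k) k) / k) \<longlonglongrightarrow> 1" "filterlim (\<lambda>k::nat. k) at_top sequentially"
    by (auto intro!: Lim_transform_eventually[OF tendsto_const] eventually_mono[OF eventually_gt_at_top[of 0]] filterlim_ident)
  have ls: "(\<lambda>k. real (lev (s k)) / k) \<longlonglongrightarrow> \<sigma> * (1 - \<epsilon>)" "filterlim (\<lambda>k. lev (s k)) at_top sequentially"
    using tendsto_average_subseq[OF lev_tendsto(1) s] filterlim_compose[OF lev_tendsto(2) s(2)] by auto
  have \<sigma>\<epsilon>: "\<sigma> * (1 - \<epsilon>) < \<sigma>" using \<epsilon> sigma_bounds by simp
  obtain d1 d2 d3 d4 where d: "d1 \<in> D" "fst d1 \<noteq> 0" "d2 \<in> D" "fst d2 \<noteq> m - 1" "d3 \<in> D" "snd d3 \<noteq> 0" "d4 \<in> D" "snd d4 \<noteq> n - 1"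
    using two_rows_other two_cols_other by metis
  have e1: "\<forall>\<^sub>F k in sequentially. \<exists>c. s k \<le> c \<and> c < k \<and> fst (\<omega> c) \<noteq> 0"
    by (rule generic_digit_between[OF \<omega> d(1) _ P s id, where Q = "\<lambda>d. fst d \<noteq> 0"]) (use d \<epsilon> in auto)
  have e2: "\<forall>\<^sub>F k in sequentially. \<exists>c. s k \<le> c \<and> c < k \<and> fst (\<omega> c) \<noteq> m - 1"
    by (rule generic_digit_between[OF \<omega> d(3) _ P s id, where Q = "\<lambda>d. fst d \<noteq> m - 1"]) (use d \<epsilon> in auto)
  have e3: "\<forall>\<^sub>F k in sequentially. \<exists>c. lev (s k) \<le> c \<and> c < lev k \<and> snd (\<omega> c) \<noteq> 0"
    by (rule generic_digit_between[OF \<omega> d(5) _ P ls lev_tendsto, where Q = "\<lambda>d. snd d \<noteq> 0"]) (use d \<sigma>\<epsilon> in auto)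
  have e4: "\<forall>\<^sub>F k in sequentially. \<exists>c. lev (s k) \<le> c \<and> c < lev k \<and> snd (\<omega> c) \<noteq> n - 1"
    by (rule generic_digit_between[OF \<omega> d(7) _ P ls lev_tendsto, where Q = "\<lambda>d. snd d \<noteq> n - 1"]) (use d \<sigma>\<epsilon> in auto)
  from e1 e2 e3 e4 show ?thesis
  proof eventually_elim
    case (elim k)
    have "(1 - \<epsilon>) * k \<le> 1 * real k" using \<epsilon> by (intro mult_right_mono) auto
    then have "s k \<le> k" unfolding s_def by linarith
    from elim obtain c1 c2 c3 c4 where c: "s k \<le> c1" "c1 < k" "fst (\<omega> c1) \<noteq> 0" "s k \<le> c2" "c2 < k" "fst (\<omega> c2) \<noteq> m - 1"
      "lev (s k) \<le> c3" "c3 < lev k" "snd (\<omega> c3) \<noteq> 0" "lev (s k) \<le> c4" "c4 < lev k" "snd (\<omega> c4) \<noteq> n - 1"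
      by (elim exE conjE)
    show ?case
    proof (intro ballI impI)
      fix u assume u: "u \<in> codes (s k)" "Rect (s k) u \<inter> cball (point \<omega>) (1 / real m ^ k) \<noteq> {}"
      show "u = code (s k) \<omega>"
        by (rule near_point_unique[OF _ \<open>s k \<le> k\<close> u c]) (rule D)
    qed
  qed
qed

end

context weighted_carpet
begin

text \<open>With ln p = ln q + ln (p / q), the first term is averaged over \<open>k\<close> places
  and the second over \<open>lev k\<close> places, which produces the factor \<sigma>.\<close>

lemma generic_ln_sq_weight:
  assumes \<omega>: "generic P \<omega>"
  shows "(\<lambda>k. ln (sq_weight p k \<omega>) / real k) \<longlonglongrightarrow> - (\<Sum>d\<in>D. P d * expo d) * ln m"
proof -
  have D: "\<And>c. \<omega> c \<in> D" using \<omega> by (auto simp: generic_def)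
  define \<phi> where "\<phi> d = ln (q (fst d))" for d :: "nat \<times> nat"
  define \<psi> where "\<psi> d = ln (p d) - ln (q (fst d))" for d :: "nat \<times> nat"
  have avg: "(\<lambda>k. (\<Sum>c<k. f (\<omega> c)) / real k) \<longlonglongrightarrow> (\<Sum>d\<in>D. P d * f d)" for f :: "nat \<times> nat \<Rightarrow> real"
    using \<omega> by (auto simp: generic_def)
  have "(\<lambda>k. (\<Sum>c<k. \<phi> (\<omega> c)) / real k + (\<Sum>c<lev k. \<psi> (\<omega> c)) / real k) \<longlonglongrightarrow>
     (\<Sum>d\<in>D. P d * \<phi> d) + (\<Sum>d\<in>D. P d * \<psi> d) * \<sigma>"
    by (intro tendsto_add avg tendsto_average_subseq[OF avg] lev_tendsto)
  moreover have "ln (sq_weight p k \<omega>) / real k = (\<Sum>c<k. \<phi> (\<omega> c)) / real k + (\<Sum>c<lev k. \<psi> (\<omega> c)) / real k" for k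
  proof -
    have "ln (sq_weight p k \<omega>) = (\<Sum>c<k. \<phi> (\<omega> c) + (if c < lev k then \<psi> (\<omega> c) else 0))"
      unfolding ln_sq_weight[OF validI[OF D]] by (intro sum.cong) (auto simp: \<phi>_def \<psi>_def)
    then show ?thesis by (simp add: sum.distrib sum_if_lev add_divide_distrib)
  qed
  moreover have "(\<Sum>d\<in>D. P d * \<phi> d) + (\<Sum>d\<in>D. P d * \<psi> d) * \<sigma> = - (\<Sum>d\<in>D. P d * expo d) * ln m"
  proof -
    have "- (P d * expo d) * ln m = P d * \<phi> d + P d * \<psi> d * \<sigma>" for d
    proof -
      have "expo d * ln m = - \<sigma> * ln (p d) + (\<sigma> - 1) * ln (q (fst d))"
        using ln_m_pos by (simp add: digit_exponent_def split_beta)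
      then have "- (P d * expo d) * ln m = - P d * (- \<sigma> * ln (p d) + (\<sigma> - 1) * ln (q (fst d)))" by simp
      then show ?thesis by (simp add: \<phi>_def \<psi>_def algebra_simps)
    qed
    then show ?thesis
      by (simp only: sum_distrib_right sum.distrib[symmetric] sum_negf[symmetric])
  qed
  ultimately show ?thesis by simp
qed

lemma generic_has_local_dim:
  assumes \<mu>: "is_self_affine_measure m n D p \<mu>"
    and \<omega>: "generic P \<omega>" and P: "\<And>d. d \<in> D \<Longrightarrow> 0 < P d"
  shows "has_local_dim \<mu> (point \<omega>) (\<Sum>d\<in>D. P d * expo d)"
proof (rule has_local_dimI_scales[OF prob_mu[OF \<mu>] sets_mu[OF \<mu>] _ _ rect_const_ge])
  have D: "\<And>c. \<omega> c \<in> D" using \<omega> by (auto simp: generic_def)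
  let ?a = "\<Sum>d\<in>D. P d * expo d"
  show a: "0 \<le> ?a" using P expo_nonneg by (intro sum_nonneg mult_nonneg_nonneg) (auto simp: less_imp_le)
  show "1 < real m" using m_ge_2 by simp
  note lim = generic_ln_sq_weight[OF \<omega>]
  have pos: "0 < sq_weight p k \<omega>" for k by (rule sq_weight_pos[OF validI[OF D]])
  have powr: "m powr x = exp (x * ln m)" for x using m_ge_2 by (simp add: powr_def)
  fix \<epsilon> :: real assume \<epsilon>: "0 < \<epsilon>"
  have "- (?a + \<epsilon>) * ln m < - ?a * ln m" using \<epsilon> ln_m_pos by (intro mult_strict_right_mono) auto
  then have "\<forall>\<^sub>F k in sequentially. - (?a + \<epsilon>) * ln m < ln (sq_weight p k \<omega>) / real k"
    using lim by (rule order_tendstoD(1)[rotated])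
  then show "\<forall>\<^sub>F k in sequentially. m powr (- (?a + \<epsilon>) * real k) \<le> measure \<mu> (cball (point \<omega>) (rect_const / real m ^ k))"
    using eventually_gt_at_top[of 0]
  proof eventually_elim
    case (elim k)
    then have "- (?a + \<epsilon>) * ln m * k \<le> ln (sq_weight p k \<omega>)" by (simp only: pos_less_divide_eq of_nat_0_less_iff less_imp_le)
    then have "exp (- (?a + \<epsilon>) * ln m * k) \<le> exp (ln (sq_weight p k \<omega>))" by (subst exp_le_cancel_iff)
    then have "m powr (- (?a + \<epsilon>) * real k) \<le> sq_weight p k \<omega>" using pos[of k] by (simp add: powr mult_ac)
    also have "\<dots> \<le> measure \<mu> (cball (point \<omega>) (rect_const / real m ^ k))"
      by (rule sq_weight_le_ball[OF \<mu>, of \<omega>]) (use D point_in_Rect[of \<omega>] in auto)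
    finally show ?case .
  qed
  \<comment> \<open>Using the square of level (1 - \<epsilon>')k multiplies the exponent by 1 -
    \<epsilon>', a loss of \<epsilon>' times \<open>?a\<close>. The added 1 avoids a zero
    denominator, and the 1/2 keeps 1 - \<epsilon>' positive.\<close>
  define \<epsilon>' where "\<epsilon>' = min (1 / 2) (\<epsilon> / (2 * (?a + 1)))"
  have \<epsilon>': "0 < \<epsilon>'" "\<epsilon>' < 1" using \<epsilon> a by (auto simp: \<epsilon>'_def)
  define s where "s k = nat \<lfloor>(1 - \<epsilon>') * real k\<rfloor>" for k :: nat
  have a\<epsilon>: "?a * \<epsilon>' < \<epsilon>"
  proof -
    have "?a * \<epsilon>' \<le> (?a + 1) * \<epsilon>'" using \<epsilon>' by (intro mult_right_mono) auto
    also have "\<dots> \<le> (?a + 1) * (\<epsilon> / (2 * (?a + 1)))" using a by (intro mult_left_mono) (auto simp: \<epsilon>'_def)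
    also have "\<dots> = \<epsilon> / 2" using a by (simp add: field_simps)
    finally show ?thesis using \<epsilon> by simp
  qed
  have "(\<lambda>k. ln (sq_weight p (s k) \<omega>) / real k) \<longlonglongrightarrow> - ?a * ln m * (1 - \<epsilon>')"
    unfolding s_def by (rule tendsto_average_subseq[OF lim]) (use floor_mult_tendsto[of "1 - \<epsilon>'"] \<epsilon>' in auto)
  moreover have "- ?a * ln m * (1 - \<epsilon>') < - (?a - \<epsilon>) * ln m"
  proof -
    have "- ?a * (1 - \<epsilon>') < - (?a - \<epsilon>)" using a\<epsilon> by (simp add: algebra_simps)
    then have "- ?a * (1 - \<epsilon>') * ln m < - (?a - \<epsilon>) * ln m" using ln_m_pos by (intro mult_strict_right_mono)
    then show ?thesis by (simp only: mult_ac)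
  qed
  ultimately have "\<forall>\<^sub>F k in sequentially. ln (sq_weight p (s k) \<omega>) / real k < - (?a - \<epsilon>) * ln m"
    by (rule order_tendstoD(2))
  moreover have "\<forall>\<^sub>F k in sequentially. \<forall>u\<in>codes (s k). Rect (s k) u \<inter> cball (point \<omega>) (1 / real m ^ k) \<noteq> {} \<longrightarrow> u = code (s k) \<omega>"
    unfolding s_def by (rule generic_near_unique[OF \<omega> P \<epsilon>'])
  ultimately show "\<forall>\<^sub>F k in sequentially. measure \<mu> (cball (point \<omega>) (1 / real m ^ k)) \<le> m powr (- (?a - \<epsilon>) * real k)"
    using eventually_gt_at_top[of 0]
  proof eventually_elim
    case (elim k)
    let ?B = "cball (point \<omega>) (1 / real m ^ k)"
    have "measure \<mu> ?B \<le> (\<Sum>u\<in>codes (s k). if Rect (s k) u \<inter> ?B \<noteq> {} then sq_weight p (s k) u else 0)"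
      by (rule measure_le_codes[OF \<mu>]) simp
    also have "\<dots> \<le> (\<Sum>u\<in>codes (s k). if u = code (s k) \<omega> then sq_weight p (s k) \<omega> else 0)"
    proof (rule sum_mono)
      fix u assume "u \<in> codes (s k)"
      then have "Rect (s k) u \<inter> ?B = {} \<or> u = code (s k) \<omega>" using elim(2) by blast
      then show "(if Rect (s k) u \<inter> ?B \<noteq> {} then sq_weight p (s k) u else 0) \<le> (if u = code (s k) \<omega> then sq_weight p (s k) \<omega> else 0)"
        using pos[of "s k"] by (auto simp: sq_weight_code)
    qed
    also have "\<dots> = sq_weight p (s k) \<omega>"
      using finite_codes[of "s k"] code_in_codes[OF validI[of \<omega>]] D by (simp add: sum.delta)
    also have "\<dots> = exp (ln (sq_weight p (s k) \<omega>))" using pos by simp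
    also have "\<dots> \<le> exp (- (?a - \<epsilon>) * ln m * k)"
      using elim by (subst exp_le_cancel_iff) (simp only: pos_divide_less_eq of_nat_0_less_iff less_imp_le)
    finally show ?case by (simp add: powr mult_ac)
  qed
qed

end

text \<open>Hoeffding's inequality makes the deviation probabilities exponentially small in the
  sample size, hence summable; Borel-Cantelli then applies to each of countably many
  tolerances.\<close>

lemma (in sequence_space) iid_strong_law:
  fixes f :: "'a \<Rightarrow> real"
  assumes f[measurable]: "f \<in> borel_measurable M" and range: "\<And>x. x \<in> space M \<Longrightarrow> f x \<in> {0..1}"
  shows "AE \<omega> in S. (\<lambda>k. (\<Sum>c<k. f (\<omega> c)) / real k) \<longlonglongrightarrow> integral\<^sup>L M f"
proof -
  have comp: "distr S M (\<lambda>\<omega>. \<omega> i) = M" for i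
    using PiM_component[of i] by simp
  have distr: "distr S borel (\<lambda>\<omega>. f (\<omega> i)) = distr M borel f" for i
  proof -
    have "distr S borel (\<lambda>\<omega>. f (\<omega> i)) = distr (distr S M (\<lambda>\<omega>. \<omega> i)) borel f"
      by (subst distr_distr) (auto simp: comp_def)
    then show ?thesis by (simp add: comp)
  qed
  have space_S: "\<omega> i \<in> space M" if "\<omega> \<in> space S" for \<omega> i
    using that by (auto simp: space_PiM)
  have indep: "P.indep_vars (\<lambda>_. borel) (\<lambda>i \<omega>. f (\<omega> i)) {..<k}" for k
  proof (cases "k = 0")
    case True
    then show ?thesis by (simp add: P.indep_vars_def P.indep_sets_def)
  next
    case False
    have coord: "P.indep_vars (\<lambda>_. M) (\<lambda>i \<omega>. \<omega> i) {..<k}"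
    proof (subst P.indep_vars_iff_distr_eq_PiM')
      have "distr S (PiM {..<k} (\<lambda>_. M)) (\<lambda>\<omega>. restrict \<omega> {..<k}) = PiM {..<k} (\<lambda>_. M)"
        by (rule distr_PiM_restrict_finite) auto
      then show "distr S (PiM {..<k} (\<lambda>_. M)) (\<lambda>x. \<lambda>i\<in>{..<k}. x i) = PiM {..<k} (\<lambda>i. distr S M (\<lambda>\<omega>. \<omega> i))"
        by (simp add: comp)
    qed (use False in auto)
    show ?thesis by (rule P.indep_vars_compose2[OF coord]) simp
  qed
  have dev: "AE \<omega> in S. \<forall>\<^sub>F k in sequentially. \<bar>(\<Sum>c<k. f (\<omega> c)) / real k - integral\<^sup>L M f\<bar> < e" if e: "0 < e" for e
  proof -
    \<comment> \<open>Samples of size \<open>Suc k\<close>, since Hoeffding's inequality is applied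
      to a nonempty sample.\<close>
    define A where "A k = {\<omega>\<in>space S. \<bar>(\<Sum>c<Suc k. f (\<omega> c)) / real (Suc k) - integral\<^sup>L M f\<bar> \<ge> e}" for k
    have [measurable]: "A k \<in> sets S" for k unfolding A_def by measurable
    have le: "measure S (A k) \<le> 2 * exp (- 2 * e\<^sup>2) ^ k" for k
    proof -
      have E: "P.expectation (\<lambda>\<omega>. f (\<omega> 0)) = integral\<^sup>L M f"
      proof -
        have "integral\<^sup>L (distr S M (\<lambda>\<omega>. \<omega> 0)) f = P.expectation (\<lambda>\<omega>. f (\<omega> 0))"
          by (rule integral_distr) auto
        then show ?thesis by (simp add: comp)
      qed
      interpret H: Hoeffding_ineq_iid S "{..<Suc k}" "\<lambda>i \<omega>. f (\<omega> i)" "\<lambda>\<omega>. f (\<omega> 0)" 0 1 "P.expectation (\<lambda>\<omega>. f (\<omega> 0))"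
      proof unfold_locales
        show "AE \<omega> in S. f (\<omega> 0) \<in> {0..1}" using range space_S by (intro AE_I2) blast
      qed (use indep[of "Suc k"] distr in auto)
      have "measure S (A k) \<le> 2 * exp (- 2 * real (Suc k) * e\<^sup>2 / (1 - 0)\<^sup>2)"
      proof -
        have ne: "{..<Suc k} \<noteq> {}" by (metis lessThan_iff emptyE zero_less_Suc)
        show ?thesis
          using H.Hoeffding_ineq_abs_ge'[OF less_imp_le[OF e] zero_less_one ne] unfolding A_def E card_lessThan .
      qed
      also have "\<dots> \<le> 2 * exp (- 2 * e\<^sup>2) ^ k"
      proof -
        have "- 2 * real (Suc k) * e\<^sup>2 / (1 - 0)\<^sup>2 \<le> real k * (- 2 * e\<^sup>2)" by (simp add: algebra_simps)
        then have "exp (- 2 * real (Suc k) * e\<^sup>2 / (1 - 0)\<^sup>2) \<le> exp (real k * (- 2 * e\<^sup>2))" by (subst exp_le_cancel_iff)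
        also have "\<dots> = exp (- 2 * e\<^sup>2) ^ k" by (rule exp_of_nat_mult)
        finally show ?thesis by linarith
      qed
      finally show ?thesis .
    qed
    have "AE \<omega> in S. \<forall>\<^sub>F k in sequentially. \<omega> \<in> space S - A k"
    proof (rule borel_cantelli_AE1)
      have "summable (\<lambda>k. 2 * exp (- 2 * e\<^sup>2) ^ k)" using e by (intro summable_mult summable_geometric) auto
      then show "summable (\<lambda>k. measure S (A k))"
        by (rule summable_comparison_test'[where N = 0]) (use le in auto)
    qed (auto simp: P.emeasure_eq_measure)
    then show ?thesis
    proof eventually_elim
      case (elim \<omega>)
      then have "\<forall>\<^sub>F k in sequentially. \<bar>(\<Sum>c<Suc k. f (\<omega> c)) / real (Suc k) - integral\<^sup>L M f\<bar> < e"
        by eventually_elim (auto simp: A_def)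
      then show ?case by (subst eventually_sequentially_Suc[symmetric])
    qed
  qed
  have "AE \<omega> in S. \<forall>j::nat. \<forall>\<^sub>F k in sequentially. \<bar>(\<Sum>c<k. f (\<omega> c)) / real k - integral\<^sup>L M f\<bar> < 1 / real (Suc j)"
    unfolding AE_all_countable using dev by simp
  then show ?thesis
  proof eventually_elim
    case (elim \<omega>)
    show ?case
    proof (rule tendstoI)
      fix e :: real assume "0 < e"
      then obtain j where "inverse (real (Suc j)) < e" using reals_Archimedean by blast
      then have j: "1 / real (Suc j) < e" by (simp add: inverse_eq_divide)
      show "\<forall>\<^sub>F k in sequentially. dist ((\<Sum>c<k. f (\<omega> c)) / real k) (integral\<^sup>L M f) < e"
        using elim[rule_format, of j] by eventually_elim (use j in \<open>simp add: dist_real_def\<close>)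
    qed
  qed
qed

section \<open>Bernoulli sequences and their image measure\<close>

context weighted_carpet
begin

abbreviation digit_measure :: "(nat \<times> nat) measure" where
  "digit_measure \<equiv> point_measure D (\<lambda>d. ennreal (p d))"

lemma prob_space_digit: "prob_space digit_measure"
proof
  have "emeasure digit_measure D = ennreal (\<Sum>d\<in>D. p d)"
    using finite_D p_pos by (simp add: emeasure_point_measure_finite sum_ennreal less_imp_le)
  then show "emeasure digit_measure (space digit_measure) = 1"
    by (simp add: p_sum space_point_measure)
qed

lemma sequence_space_digit: "sequence_space digit_measure"
proof -
  interpret prob_space digit_measure by (rule prob_space_digit)
  show ?thesis by unfold_locales
qed

abbreviation code_measure :: "(nat \<Rightarrow> nat \<times> nat) measure" where
  "code_measure \<equiv> PiM UNIV (\<lambda>_. digit_measure)"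

definition carpet_measure :: "(real \<times> real) measure" where
  "carpet_measure = distr code_measure borel point"

lemma code_measure_digit: "\<omega> \<in> space code_measure \<Longrightarrow> \<omega> c \<in> D"
  by (auto simp: space_PiM space_point_measure)

lemma point_measurable[measurable]: "point \<in> borel_measurable code_measure"
proof -
  have [measurable]: "(\<lambda>\<omega>. f (\<omega> c)) \<in> borel_measurable code_measure" for f :: "nat \<times> nat \<Rightarrow> real" and c
    by (rule measurable_compose[OF measurable_component_singleton]) auto
  show ?thesis unfolding point_def by measurable
qed

lemma prob_space_code_measure: "prob_space code_measure"
  by (intro prob_space_PiM prob_space_digit)

text \<open>Finitely many digit indicators suffice, since every function on \<open>D\<close> is a
  linear combination of them.\<close>

lemma AE_generic: "AE \<omega> in code_measure. generic p \<omega>"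
proof -
  interpret sequence_space digit_measure by (rule sequence_space_digit)
  have "AE \<omega> in code_measure. \<forall>d\<in>D. (\<lambda>k. (\<Sum>c<k. if \<omega> c = d then 1 else 0) / real k) \<longlonglongrightarrow> p d"
  proof (rule AE_finite_allI[OF finite_D])
    fix d assume d: "d \<in> D"
    have "integral\<^sup>L digit_measure (\<lambda>x. if x = d then 1 else 0 :: real) = p d"
      using finite_D p_pos d by (subst lebesgue_integral_point_measure_finite) (simp_all add: less_imp_le if_distrib cong: if_cong)
    then show "AE \<omega> in code_measure. (\<lambda>k. (\<Sum>c<k. if \<omega> c = d then 1 else 0) / real k) \<longlonglongrightarrow> p d"
      using iid_strong_law[of "\<lambda>x. if x = d then 1 else 0"] by simp
  qed
  moreover have "AE \<omega> in code_measure. \<omega> \<in> space code_measure" by simp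
  ultimately show ?thesis
  proof eventually_elim
    case (elim \<omega>)
    have D: "\<omega> c \<in> D" for c using code_measure_digit[OF elim(2)] .
    have "(\<lambda>k. (\<Sum>c<k. \<phi> (\<omega> c)) / real k) \<longlonglongrightarrow> (\<Sum>d\<in>D. p d * \<phi> d)" for \<phi> :: "nat \<times> nat \<Rightarrow> real"
    proof -
      have "(\<lambda>k. \<Sum>d\<in>D. (\<Sum>c<k. if \<omega> c = d then 1 else 0) / real k * \<phi> d) \<longlonglongrightarrow> (\<Sum>d\<in>D. p d * \<phi> d)"
        using elim(1) by (intro tendsto_sum tendsto_mult tendsto_const) auto
      moreover have "(\<Sum>d\<in>D. (\<Sum>c<k. if \<omega> c = d then 1 else 0) / real k * \<phi> d) = (\<Sum>c<k. \<phi> (\<omega> c)) / real k" for k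
      proof -
        have "(\<Sum>d\<in>D. (\<Sum>c<k. if \<omega> c = d then 1 else 0) / real k * \<phi> d) =
          (\<Sum>d\<in>D. \<Sum>c<k. (if \<omega> c = d then \<phi> d else 0)) / real k"
          by (simp add: sum_divide_distrib sum_distrib_right) (intro sum.cong; simp)
        also have "(\<Sum>d\<in>D. \<Sum>c<k. (if \<omega> c = d then \<phi> d else 0)) = (\<Sum>c<k. \<Sum>d\<in>D. (if \<omega> c = d then \<phi> d else 0))"
          by (rule sum.swap)
        also have "\<dots> = (\<Sum>c<k. \<phi> (\<omega> c))" using D finite_D by simp
        finally show ?thesis .
      qed
      ultimately show ?thesis by simp
    qed
    then show ?case using D by (auto simp: generic_def)
  qed
qed

lemma point_case_nat:
  assumes D: "d \<in> D" "\<And>c. \<omega> c \<in> D"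
  shows "point (case_nat d \<omega>) = carpet_map m n d (point \<omega>)"
proof -
  have *: "(\<Sum>c. real (f (case_nat d \<omega> c)) / real b ^ c) = (\<Sum>c. real (f (\<omega> c)) / real b ^ c) / b + real (f d)"
    if "2 \<le> b" "\<And>d. d \<in> D \<Longrightarrow> f d < b" for b and f :: "nat \<times> nat \<Rightarrow> nat"
  proof -
    have "(\<lambda>c. real ((\<lambda>c. f (\<omega> c)) c) / real b ^ c) sums (\<Sum>c. real (f (\<omega> c)) / real b ^ c)"
      by (rule digits_sums) (use that D in auto)
    from sums_divide[OF this, of "real b"]
    have "(\<lambda>c. real (f (case_nat d \<omega> (Suc c))) / real b ^ Suc c) sums ((\<Sum>c. real (f (\<omega> c)) / real b ^ c) / b)"
      by (simp add: mult.commute)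
    then have "(\<lambda>c. real (f (case_nat d \<omega> c)) / real b ^ c) sums ((\<Sum>c. real (f (\<omega> c)) / real b ^ c) / b + real (f d))"
      by (subst (asm) sums_Suc_iff) simp
    then show ?thesis by (rule sums_unique[symmetric])
  qed
  show ?thesis
    using *[of n snd] *[of m fst] m_ge_2 n_ge_2 fst_less snd_less
    by (simp add: point_def carpet_map_def split_beta)
qed

text \<open>Prepending an independent digit preserves the product measure and acts on points as a
  carpet map; splitting according to the first digit gives the self-affinity.\<close>

lemma carpet_measure_self_affine: "is_self_affine_measure m n D p carpet_measure"
proof -
  interpret sequence_space digit_measure by (rule sequence_space_digit)
  interpret C: prob_space carpet_measure
    unfolding carpet_measure_def by (rule P.prob_space_distr) simp
  have "measure carpet_measure A = (\<Sum>d\<in>D. p d * measure carpet_measure (carpet_map m n d -` A))"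
    if A[measurable]: "A \<in> sets borel" for A
  proof -
    have em: "emeasure carpet_measure B = emeasure code_measure (point -` B \<inter> space code_measure)" if "B \<in> sets borel" for B
      unfolding carpet_measure_def using that by (intro emeasure_distr) auto
    let ?E = "point -` A \<inter> space code_measure"
    have E[measurable]: "?E \<in> sets code_measure" by measurable
    have cn[measurable]: "(\<lambda>(s, \<omega>). case_nat s \<omega>) \<in> measurable (digit_measure \<Otimes>\<^sub>M code_measure) code_measure"
      by measurable
    have "emeasure code_measure ?E = emeasure (distr (digit_measure \<Otimes>\<^sub>M code_measure) code_measure (\<lambda>(s, \<omega>). case_nat s \<omega>)) ?E"
      by (simp add: PiM_iter)
    also have "\<dots> = emeasure (digit_measure \<Otimes>\<^sub>M code_measure) ((\<lambda>(s, \<omega>). case_nat s \<omega>) -` ?E \<inter> space (digit_measure \<Otimes>\<^sub>M code_measure))"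
      by (rule emeasure_distr[OF cn E])
    also have "\<dots> = (\<integral>\<^sup>+d. emeasure code_measure (Pair d -` ((\<lambda>(s, \<omega>). case_nat s \<omega>) -` ?E \<inter> space (digit_measure \<Otimes>\<^sub>M code_measure))) \<partial>digit_measure)"
      by (rule P.emeasure_pair_measure_alt[OF measurable_sets[OF cn E]])
    also have "\<dots> = (\<Sum>d\<in>D. ennreal (p d) * emeasure code_measure (Pair d -` ((\<lambda>(s, \<omega>). case_nat s \<omega>) -` ?E \<inter> space (digit_measure \<Otimes>\<^sub>M code_measure))))"
      by (rule nn_integral_point_measure_finite[OF finite_D])
    also have "\<dots> = (\<Sum>d\<in>D. ennreal (p d) * emeasure carpet_measure (carpet_map m n d -` A))"
    proof (intro sum.cong refl)
      fix d assume d: "d \<in> D"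
      have "Pair d -` ((\<lambda>(s, \<omega>). case_nat s \<omega>) -` ?E \<inter> space (digit_measure \<Otimes>\<^sub>M code_measure)) =
        point -` (carpet_map m n d -` A) \<inter> space code_measure"
        using d code_measure_digit
        by (auto simp: space_pair_measure space_point_measure point_case_nat) (auto simp: space_PiM space_point_measure split: nat.split)
      then show "ennreal (p d) * emeasure code_measure (Pair d -` ((\<lambda>(s, \<omega>). case_nat s \<omega>) -` ?E \<inter> space (digit_measure \<Otimes>\<^sub>M code_measure))) =
        ennreal (p d) * emeasure carpet_measure (carpet_map m n d -` A)"
        by (simp add: em[OF vimage_borel[OF carpet_map_measurable A]])
    qed
    also have "\<dots> = ennreal (\<Sum>d\<in>D. p d * measure carpet_measure (carpet_map m n d -` A))"
      using p_pos by (simp add: C.emeasure_eq_measure ennreal_mult[symmetric] sum_ennreal less_imp_le)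
    finally have "ennreal (measure carpet_measure A) = ennreal (\<Sum>d\<in>D. p d * measure carpet_measure (carpet_map m n d -` A))"
      using em[OF A] by (simp add: C.emeasure_eq_measure)
    then show ?thesis
      using p_pos by (subst (asm) ennreal_inj) (auto intro!: sum_nonneg mult_nonneg_nonneg simp: less_imp_le)
  qed
  then show ?thesis
    unfolding is_self_affine_measure_def using C.prob_space_axioms by (simp add: carpet_measure_def)
qed

text \<open>Sequences with frequencies \<open>P\<close> give local dimensions for both measures. The
  one for \<mu> puts their points into the level set; the one for the measure built from
  \<open>P\<close> makes a Hausdorff null set of such points negligible, although almost every
  sequence codes such a point.\<close>

lemma hausdorff_dim_level_set_ge:
  assumes \<mu>: "is_self_affine_measure m n D p \<mu>" and \<Lambda>: "is_carpet m n D \<Lambda>"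
    and P: "weighted_carpet m n D P"
  shows "ereal (\<Sum>d\<in>D. P d * digit_exponent m n D P d) \<le> hausdorff_dim (level_set \<Lambda> \<mu> (\<Sum>d\<in>D. P d * expo d))"
proof (rule hausdorff_dim_ge, rule notI)
  interpret P: weighted_carpet m n D P by (rule P)
  let ?\<nu> = "P.carpet_measure" and ?a = "\<Sum>d\<in>D. P d * digit_exponent m n D P d"
  let ?X = "level_set \<Lambda> \<mu> (\<Sum>d\<in>D. P d * expo d)"
  interpret C: prob_space P.code_measure by (rule P.prob_space_code_measure)
  fix s assume s: "0 \<le> s" "s < ?a" and 0: "hausdorff_measure s ?X = 0"
  define A where "A = {x \<in> ?X. has_local_dim ?\<nu> x ?a}"
  have "hausdorff_measure s A \<le> 0"
    unfolding 0[symmetric] by (rule hausdorff_measure_mono) (auto simp: A_def)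
  then have null: "hausdorff_measure s A = 0" by simp
  have "AE x in ?\<nu>. x \<notin> A"
  proof (rule AE_not_in_hausdorff_null[OF _ _ s(1) null])
    show "prob_space ?\<nu>" "sets ?\<nu> = sets borel"
      using P.carpet_measure_self_affine by (auto simp: is_self_affine_measure_def)
    show "\<exists>r0>0. \<forall>r. 0 < r \<and> r < r0 \<longrightarrow> measure ?\<nu> (cball x r) \<le> r powr s" if "x \<in> A" for x
      using that has_local_dim_imp_ball_le[OF _ s(2)] by (auto simp: A_def)
  qed
  then have "AE \<omega> in P.code_measure. point \<omega> \<notin> A"
    unfolding P.carpet_measure_def by (rule AE_distrD[rotated]) simp
  with P.AE_generic have "AE \<omega> in P.code_measure. False"
  proof eventually_elim
    case (elim \<omega>)
    have "point \<omega> \<in> \<Lambda>" using elim(1) point_in_carpet[OF _ \<Lambda>] by (auto simp: generic_def)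
    moreover have "has_local_dim \<mu> (point \<omega>) (\<Sum>d\<in>D. P d * expo d)"
      by (rule generic_has_local_dim[OF \<mu> elim(1) P.p_pos])
    moreover have "has_local_dim ?\<nu> (point \<omega>) ?a"
      by (rule P.generic_has_local_dim[OF P.carpet_measure_self_affine elim(1) P.p_pos])
    ultimately show ?case using elim(2) by (auto simp: A_def level_set_def)
  qed
  then show False by (simp add: C.AE_False)
qed

lemma spectrum_eq:
  assumes \<mu>: "is_self_affine_measure m n D p \<mu>" and \<Lambda>: "is_carpet m n D \<Lambda>"
    and \<alpha>: "\<alpha> = mean_expo t"
  shows "hausdorff_dim (level_set \<Lambda> \<mu> \<alpha>) = ereal (\<alpha> * t + \<beta> t)"
proof (rule antisym)
  interpret T: weighted_carpet m n D "tilt t" by (rule weighted_carpet_tilt)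
  have prefix_val: "\<alpha> * t + \<beta> t = (\<Sum>d\<in>D. tilt t d * digit_exponent m n D (tilt t) d)"
    using legendre_value \<alpha> by simp
  have nonneg: "0 \<le> \<alpha> * t + \<beta> t"
    unfolding prefix_val using T.p_pos T.expo_nonneg by (intro sum_nonneg mult_nonneg_nonneg) (auto simp: less_imp_le)
  have "0 \<le> \<alpha>"
    unfolding \<alpha> using T.p_pos expo_nonneg by (intro sum_nonneg mult_nonneg_nonneg) (auto simp: less_imp_le)
  then show "hausdorff_dim (level_set \<Lambda> \<mu> \<alpha>) \<le> ereal (\<alpha> * t + \<beta> t)"
    using nonneg by (intro hausdorff_dim_le hausdorff_measure_level_set[OF \<mu> \<Lambda>]) auto
  show "ereal (\<alpha> * t + \<beta> t) \<le> hausdorff_dim (level_set \<Lambda> \<mu> \<alpha>)"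
    unfolding prefix_val unfolding \<alpha> by (rule hausdorff_dim_level_set_ge[OF \<mu> \<Lambda> weighted_carpet_tilt])
qed

end

section \<open>The multifractal spectrum\<close>

theorem theorem1:
  fixes m n :: nat
    and D :: "(nat \<times> nat) set"
    and p :: "nat \<times> nat \<Rightarrow> real"
    and \<Lambda> :: "(real \<times> real) set"
    and \<mu> :: "(real \<times> real) measure"
  assumes "0 < m" and "m < n"
    and "D \<subseteq> {0..<m} \<times> {0..<n}"
    and "\<exists>d\<in>D. \<exists>d'\<in>D. fst d \<noteq> fst d'"
    and "\<exists>d\<in>D. \<exists>d'\<in>D. snd d \<noteq> snd d'"
    and "is_carpet m n D \<Lambda>"
    and "\<forall>d\<in>D. 0 < p d" and "(\<Sum>d\<in>D. p d) = 1"
    and "is_self_affine_measure m n D p \<mu>"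
  shows "(\<forall>\<alpha>\<in>{alpha_min m n D p<..<alpha_max m n D p}.
            ereal (spectrum \<Lambda> \<mu> \<alpha>) = hausdorff_dim (level_set \<Lambda> \<mu> \<alpha>) \<and>
            hausdorff_dim (level_set \<Lambda> \<mu> \<alpha>) = (INF t. ereal (\<alpha> * t + beta m n D p t)))
       \<and> spectrum \<Lambda> \<mu> differentiable_on {alpha_min m n D p<..<alpha_max m n D p}
       \<and> concave_on {alpha_min m n D p<..<alpha_max m n D p} (spectrum \<Lambda> \<mu>)"
proof -
  interpret weighted_carpet m n D p
    using assms by unfold_locales auto
  let ?I = "{alpha_min m n D p<..<alpha_max m n D p}"
  have main: "\<exists>t. \<alpha> = mean_expo t \<and> hausdorff_dim (level_set \<Lambda> \<mu> \<alpha>) = ereal (\<alpha> * t + beta m n D p t) \<and>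
      (\<forall>s. \<alpha> * t + beta m n D p t \<le> \<alpha> * s + beta m n D p s)" if "\<alpha> \<in> ?I" for \<alpha>
    using minimiser_exists[OF that] spectrum_eq[OF assms(9,6)] by (elim exE conjE) (intro exI conjI; assumption?; simp)
  have inf: "hausdorff_dim (level_set \<Lambda> \<mu> \<alpha>) = (INF t. ereal (\<alpha> * t + beta m n D p t))" if "\<alpha> \<in> ?I" for \<alpha>
  proof -
    from main[OF that] obtain t where t: "hausdorff_dim (level_set \<Lambda> \<mu> \<alpha>) = ereal (\<alpha> * t + beta m n D p t)"
      "\<forall>s. \<alpha> * t + beta m n D p t \<le> \<alpha> * s + beta m n D p s" by (elim exE conjE)
    show ?thesis
      unfolding t(1)
    proof (rule antisym)
      show "ereal (\<alpha> * t + beta m n D p t) \<le> (INF t. ereal (\<alpha> * t + beta m n D p t))"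
        using t(2) by (intro INF_greatest) simp
      show "(INF t. ereal (\<alpha> * t + beta m n D p t)) \<le> ereal (\<alpha> * t + beta m n D p t)"
        by (rule INF_lower) simp
    qed
  qed
  show ?thesis
  proof (cases "?I = {}")
    case False
    then have lt: "alpha_min m n D p < alpha_max m n D p" by auto
    have reg: "\<exists>t. - mean_expo t = - \<alpha> \<and> spectrum \<Lambda> \<mu> \<alpha> = \<alpha> * t + beta m n D p t \<and>
        (\<forall>s. \<alpha> * t + beta m n D p t \<le> \<alpha> * s + beta m n D p s)" if "\<alpha> \<in> ?I" for \<alpha>
      using main[OF that] by (auto simp: spectrum_def)
    note regular = legendre_transform_regular[OF DERIV_beta mean_expo_strict[OF lt] reg]
    have "ereal (spectrum \<Lambda> \<mu> \<alpha>) = hausdorff_dim (level_set \<Lambda> \<mu> \<alpha>)" if "\<alpha> \<in> ?I" for \<alpha>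
      using main[OF that] by (elim exE conjE) (simp add: spectrum_def)
    then show ?thesis
      using inf regular by blast
  next
    \<comment> \<open>The interval is empty exactly when all digits share one exponent, and then
      every claim is vacuous.\<close>
    case True
    then show ?thesis by (simp only: True) (simp add: concave_on_def convex_on_def differentiable_on_def)
  qed
qed

end
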